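(* Let $(X_i)_{i\ge1}$ be i.i.d. real random variables on $(\Omega,\mathcal F,\mathbb P)$, $S_0:=0$, $S_n:=X_1+\cdots+X_n$, with $(S_n)$ recurrent and $S_n/A_n\to X$ in distribution for some positive reals $A_n$, where $X$ is a stable random variable of index $\alpha=1$ with density $f_X$. Assume the Cramér condition $\limsup_{|t|\to\infty}|\mathbb E[e^{itX_1}]|<1$. For each $\varepsilon>0$ let $M_0^\varepsilon$ be uniformly distributed on $(-\varepsilon,\varepsilon)$ and independent of $(S_n)_{n\ge0}$, let $M_n^\varepsilon:=M_0^\varepsilon+S_n$ and $\tau_\varepsilon:=\min\{n\ge1:|M_n^\varepsilon|<\varepsilon\}$. Let $\Omega^*:=\{S_n\ne0\ \forall n\ge1\}$, $\gamma:=2f_X(0)\mathbb P(\Omega^* )$, and let $G:[0,\infty)\to[0,\infty)$ be continuous with $G(0)=0$, $G(n)=\sum_{k=1}^n\frac1{A_k}$ for integers $n\ge1$, affine on each $[n,n+1]$. Then for every $t>0$, \[ \lim_{\varepsilon\to0}\mathbb P\left(\gamma\,\varepsilon\,G(\tau_\varepsilon)\le t\ \middle|\ \Omega^*\right)=\frac{t}{1+t}. \] *)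

theory Defs
  imports "HOL-Probability.Probability"
begin

definition stable_index_one :: "real measure \<Rightarrow> bool" where
  "stable_index_one \<mu> \<longleftrightarrow> real_distribution \<mu> \<and>
     (\<exists>\<sigma>>0. \<exists>\<beta>\<in>{-1..1}. \<exists>m::real. \<forall>t::real.
        char \<mu> t = exp (\<i> * complex_of_real (m * t)
          - complex_of_real (\<sigma> * \<bar>t\<bar>) *
            (1 + \<i> * complex_of_real (\<beta> * (2 / pi) * sgn t * ln \<bar>t\<bar>))))"

definition recurrent_walk :: "'a measure \<Rightarrow> (nat \<Rightarrow> 'a \<Rightarrow> real) \<Rightarrow> bool" where
  "recurrent_walk M S \<longleftrightarrow> (\<forall>\<epsilon>>0. AE \<omega> in M. \<exists>\<^sub>\<infinity>n. \<bar>S n \<omega>\<bar> < \<epsilon>)"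

definition Gsum :: "(nat \<Rightarrow> real) \<Rightarrow> nat \<Rightarrow> real" where
  "Gsum A n = (\<Sum>k=1..n. 1 / A k)"

definition Ginterp :: "(nat \<Rightarrow> real) \<Rightarrow> real \<Rightarrow> real" where
  "Ginterp A x = (let n = nat \<lfloor>x\<rfloor> in Gsum A n + (x - real n) * (Gsum A (Suc n) - Gsum A n))"

end

theory Submission
  imports Defs
begin

text \<open>
  Decomposing at the last visit to \<open>(-e, e)\<close> before time \<open>N\<close> gives, with \<open>V n = P (\<tau> > n)\<close>, an identity
  \<open>1 = \<Sum>k\<le>N. (weight of time k) * V (N - k)\<close>, up to the dependence on the position in the window, in which
  the weight lies between the infimum and the supremum over \<open>\<bar>y\<bar> < e\<close> of \<open>P (\<bar>S k - y\<bar> < e)\<close>. For bounded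
  \<open>k\<close> these tend to \<open>P (S k = 0)\<close>; for large \<open>k\<close> a local limit theorem, uniform in \<open>e\<close> thanks to the
  Cramer condition, gives \<open>2 e f(0) / A k\<close> up to a summable exponential error. As \<open>G\<close> varies slowly,
  \<open>V n * (\<Sum>k. P (S k = 0) + 2 e f(0) G n) \<rightarrow> 1\<close>, and the same decomposition for visits to \<open>0\<close> shows
  \<open>\<Sum>k. P (S k = 0) = 1 / P (\<Omega>*)\<close>. Off \<open>\<Omega>*\<close> the hitting time is bounded by the first return to \<open>0\<close>.
\<close>

section \<open>Characteristic functions\<close>

text \<open>The obstacle is that the time horizon tends to infinity while \<open>e\<close> shrinks
  to 0, so the local limit theorem has to hold for arbitrarily narrow windows. Windows are smoothed
  to trapezoids with slopes of width proportional to \<open>e\<close>: their Fourier transforms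
  decay like \<open>1 / s^2\<close>, and steep slopes cost only the scale-free ratio
  \<open>(a + b) / (b - a)\<close>, multiplied by the geometric decay from the Cramer condition. The
  error is thus summable over \<open>k\<close> with a bound free of \<open>e\<close>. Index one
  enters through \<open>A (2 * n) / A n \<rightarrow> 2\<close>, extracted from the characteristic
  functions, which gives \<open>G (2 * n) / G n \<rightarrow> 1\<close>; this permits the horizon
  \<open>N = n\<close> in the upper estimate of \<open>V n\<close> and \<open>N = 2 * n\<close> in
  the lower one. Two nondegeneracy facts have to be earned: \<open>f 0 > 0\<close>, without which
  \<gamma> would vanish, and positivity of the escape probability, which follows from the geometric
  decay of \<open>P (S k = 0)\<close>.\<close>

lemma cmod_iexp_diff_le: "cmod (iexp a - iexp b) \<le> \<bar>a - b\<bar>"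
proof -
  have "iexp a - iexp b = iexp b * (iexp (a - b) - 1)"
    by (simp add: exp_diff field_simps)
  then have "cmod (iexp a - iexp b) = cmod (iexp (a - b) - 1)"
    by (simp add: norm_mult)
  also have "\<dots> \<le> \<bar>a - b\<bar>"
    using iexp_approx1[of "a - b" 0] by simp
  finally show ?thesis .
qed

text \<open>Skorohod coupling turns weak convergence into pointwise convergence on one space. There
  \<open>|iexp (t * y) - iexp (t * y')|\<close> is at most \<open>min 2 (|T| * |y - y'|)\<close>, a
  bound free of \<open>t\<close>, so dominated convergence gives uniformity on
  \<open>{-T..T}\<close> at once.\<close>

lemma weak_conv_imp_char_uniform_limit:
  fixes N :: "nat \<Rightarrow> real measure"
  assumes N: "\<And>n. real_distribution (N n)" and \<mu>: "real_distribution \<mu>"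
    and conv: "weak_conv_m N \<mu>"
  shows "uniform_limit {-T..T} (\<lambda>n. char (N n)) (char \<mu>) sequentially"
proof -
  obtain \<Omega> :: "real measure" and Yn :: "nat \<Rightarrow> real \<Rightarrow> real" and Y :: "real \<Rightarrow> real" where
    \<Omega>: "prob_space \<Omega>" and Yn[measurable]: "\<And>n. Yn n \<in> measurable \<Omega> borel"
    and dYn: "\<And>n. distr \<Omega> borel (Yn n) = N n" and Y0: "Y \<in> measurable \<Omega> lborel"
    and dY: "distr \<Omega> borel Y = \<mu>"
    and lim: "\<And>x. x \<in> space \<Omega> \<Longrightarrow> (\<lambda>n. Yn n x) \<longlonglongrightarrow> Y x"
    using Skorohod[OF N \<mu> conv] by blast
  interpret \<Omega>: prob_space \<Omega> by fact
  have Y[measurable]: "Y \<in> borel_measurable \<Omega>" using Y0 by simp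
  define d where "d n = (\<integral>x. min 2 (\<bar>T\<bar> * \<bar>Yn n x - Y x\<bar>) \<partial>\<Omega>)" for n
  have "d \<longlonglongrightarrow> (\<integral>x. min 2 (\<bar>T\<bar> * 0) \<partial>\<Omega>)"
    unfolding d_def
  proof (rule integral_dominated_convergence[where w = "\<lambda>_. 2"])
    show "AE x in \<Omega>. (\<lambda>n. min 2 (\<bar>T\<bar> * \<bar>Yn n x - Y x\<bar>)) \<longlonglongrightarrow> min 2 (\<bar>T\<bar> * 0)"
    proof (rule AE_I2)
      fix x assume "x \<in> space \<Omega>"
      then have "(\<lambda>n. \<bar>Yn n x - Y x\<bar>) \<longlonglongrightarrow> 0"
        using lim[of x] by (simp add: LIM_zero tendsto_rabs_zero)
      then show "(\<lambda>n. min 2 (\<bar>T\<bar> * \<bar>Yn n x - Y x\<bar>)) \<longlonglongrightarrow> min 2 (\<bar>T\<bar> * 0)"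
        by (intro tendsto_intros)
    qed
  qed (auto simp: min_def)
  then have d0: "d \<longlonglongrightarrow> 0" by simp
  have bound: "cmod (char (N n) t - char \<mu> t) \<le> d n" if "t \<in> {-T..T}" for n t
  proof -
    have "char (N n) t - char \<mu> t = (CLINT x|\<Omega>. iexp (t * Yn n x) - iexp (t * Y x))"
      unfolding dYn[symmetric] dY[symmetric] char_def
      by (subst integral_distr, simp, simp)+ (simp add: \<Omega>.integrable_iexp)
    also have "cmod \<dots> \<le> (\<integral>x. cmod (iexp (t * Yn n x) - iexp (t * Y x)) \<partial>\<Omega>)"
      by (rule integral_norm_bound)
    also have "\<dots> \<le> d n"
      unfolding d_def
    proof (rule integral_mono)
      show "integrable \<Omega> (\<lambda>x. cmod (iexp (t * Yn n x) - iexp (t * Y x)))"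
        by (intro integrable_norm Bochner_Integration.integrable_diff \<Omega>.integrable_iexp) auto
      show "integrable \<Omega> (\<lambda>x. min 2 (\<bar>T\<bar> * \<bar>Yn n x - Y x\<bar>))"
        by (rule \<Omega>.integrable_const_bound[where B = 2]) (auto simp: min_def)
      fix x
      have "cmod (iexp (t * Yn n x) - iexp (t * Y x)) \<le> \<bar>t * Yn n x - t * Y x\<bar>"
        by (rule cmod_iexp_diff_le)
      also have "\<dots> = \<bar>t\<bar> * \<bar>Yn n x - Y x\<bar>" by (simp add: abs_mult flip: right_diff_distrib)
      also have "\<dots> \<le> \<bar>T\<bar> * \<bar>Yn n x - Y x\<bar>" using that by (intro mult_right_mono) auto
      finally have 1: "cmod (iexp (t * Yn n x) - iexp (t * Y x)) \<le> \<bar>T\<bar> * \<bar>Yn n x - Y x\<bar>" .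
      have "cmod (iexp (t * Yn n x) - iexp (t * Y x)) \<le> cmod (iexp (t * Yn n x)) + cmod (iexp (t * Y x))"
        by (rule norm_triangle_ineq4)
      also have "\<dots> = 2" by (simp del: of_real_mult)
      finally show "cmod (iexp (t * Yn n x) - iexp (t * Y x)) \<le> min 2 (\<bar>T\<bar> * \<bar>Yn n x - Y x\<bar>)"
        using 1 by simp
    qed
    finally show ?thesis .
  qed
  show ?thesis
    unfolding uniform_limit_iff
  proof safe
    fix e :: real assume "0 < e"
    from order_tendstoD(2)[OF d0 this]
    show "\<forall>\<^sub>F n in sequentially. \<forall>x\<in>{-T..T}. dist (char (N n) x) (char \<mu> x) < e"
    proof eventually_elim
      case (elim n)
      then show ?case by (auto simp: dist_norm intro!: le_less_trans[OF bound])
    qed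
  qed
qed

context real_distribution
begin

lemma Re_rotated_char:
  "Re (iexp (- \<theta>) * char M s) = (\<integral>x. cos (s * x - \<theta>) \<partial>M)"
proof -
  have "iexp (- \<theta>) * char M s = (CLINT x|M. iexp (- \<theta>) * iexp (s * x))"
    unfolding char_def by (rule integral_mult_right_zero[symmetric])
  also have "\<dots> = (CLINT x|M. iexp (s * x - \<theta>))"
    by (intro Bochner_Integration.integral_cong refl) (simp add: exp_diff exp_minus field_simps)
  also have "Re \<dots> = (\<integral>x. Re (iexp (s * x - \<theta>)) \<partial>M)"
    by (rule integral_Re[symmetric]) (rule integrable_iexp, auto)
  also have "\<dots> = (\<integral>x. cos (s * x - \<theta>) \<partial>M)"
    by (intro Bochner_Integration.integral_cong refl) (simp add: Re_exp)
  finally show ?thesis .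
qed

text \<open>Rotating by the argument of \<open>char M s\<close> makes its modulus the mean of
  \<open>cos (s * x - \<theta>)\<close>; the claim is then the mean of
  \<open>1 - cos (2 * u) \<le> 4 * (1 - cos u)\<close>. It propagates modulus 1 from
  \<open>s\<close> to \<open>2 * s\<close>.\<close>

lemma one_minus_cmod_char_double_le:
  "1 - cmod (char M (2 * s)) \<le> 4 * (1 - cmod (char M s))"
proof -
  define \<theta> where "\<theta> = Arg (char M s)"
  have int: "integrable M (\<lambda>x. cos (a * x - b))" for a b
    by (rule integrable_const_bound[where B = 1]) auto
  have "char M s = of_real (cmod (char M s)) * iexp \<theta>"
    unfolding \<theta>_def by (metis cis_conv_exp rcis_cmod_Arg rcis_def)
  then have "iexp (- \<theta>) * char M s = of_real (cmod (char M s))"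
    by (metis (no_types, lifting) exp_minus_inverse mult.assoc mult.commute mult.left_neutral
        mult_minus_right of_real_minus)
  then have 1: "cmod (char M s) = (\<integral>x. cos (s * x - \<theta>) \<partial>M)"
    using Re_rotated_char[of \<theta> s] by simp
  have "(\<integral>x. cos (2 * s * x - 2 * \<theta>) \<partial>M) = Re (iexp (- (2 * \<theta>)) * char M (2 * s))"
    by (rule Re_rotated_char[symmetric])
  also have "\<dots> \<le> cmod (iexp (- (2 * \<theta>)) * char M (2 * s))" by (rule complex_Re_le_cmod)
  also have "\<dots> = cmod (char M (2 * s))" by (simp add: norm_mult)
  finally have 2: "(\<integral>x. cos (2 * s * x - 2 * \<theta>) \<partial>M) \<le> cmod (char M (2 * s))" .
  have "(\<integral>x. 1 - cos (2 * s * x - 2 * \<theta>) \<partial>M) \<le> (\<integral>x. 4 * (1 - cos (s * x - \<theta>)) \<partial>M)"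
  proof (rule integral_mono)
    fix x
    let ?c = "cos (s * x - \<theta>)"
    have "cos (2 * s * x - 2 * \<theta>) = 2 * ?c\<^sup>2 - 1"
      using cos_double_cos[of "s * x - \<theta>"] by (simp add: algebra_simps)
    moreover have "0 \<le> 2 * (1 - ?c)\<^sup>2" by simp
    ultimately show "1 - cos (2 * s * x - 2 * \<theta>) \<le> 4 * (1 - ?c)"
      by (simp add: power2_eq_square algebra_simps)
  qed (use int in auto)
  then have 3: "1 - (\<integral>x. cos (2 * s * x - 2 * \<theta>) \<partial>M) \<le> 4 * (1 - (\<integral>x. cos (s * x - \<theta>) \<partial>M))"
    using int prob_space by simp
  have "1 - cmod (char M (2 * s)) \<le> 1 - (\<integral>x. cos (2 * s * x - 2 * \<theta>) \<partial>M)"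
    using 2 by simp
  also note 3
  also note 1[symmetric]
  finally show ?thesis .
qed

text \<open>The Cramer condition controls only large \<open>s\<close>. Modulus 1 at some
  \<open>s \<noteq> 0\<close> would persist at every \<open>2 ^ k * s\<close> and reach the
  controlled region, so the modulus is below 1 off the origin, and compactness covers the range
  between \<open>\<delta>\<close> and \<open>T\<close>.\<close>

lemma cramer_bound_away_from_0:
  assumes cramer: "Limsup at_infinity (\<lambda>s. ereal (cmod (char M s))) < 1" and "\<delta> > 0"
  obtains \<rho> where "0 < \<rho>" "\<rho> < 1" "\<And>s. \<bar>s\<bar> \<ge> \<delta> \<Longrightarrow> cmod (char M s) \<le> \<rho>"
proof -
  obtain r where r: "Limsup at_infinity (\<lambda>s. ereal (cmod (char M s))) < ereal r" "r < 1"
    using ereal_dense2[OF cramer] by (auto simp: one_ereal_def)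
  then obtain T where T: "\<And>s. T \<le> norm s \<Longrightarrow> cmod (char M s) < r"
    using Limsup_lessD[OF r(1)] by (auto simp: eventually_at_infinity)
  have lt1: "cmod (char M s) < 1" if "s \<noteq> 0" for s
  proof (rule ccontr)
    assume "\<not> ?thesis"
    then have 0: "cmod (char M s) = 1" using cmod_char_le_1[of s] by simp
    have 1: "cmod (char M (2 ^ k * s)) = 1" for k
    proof (induction k)
      case (Suc k)
      then show ?case
        using one_minus_cmod_char_double_le[of "2 ^ k * s"] cmod_char_le_1[of "2 ^ Suc k * s"]
        by (simp add: mult.assoc)
    qed (use 0 in simp)
    obtain k where "T / \<bar>s\<bar> < 2 ^ k" using real_arch_pow[of 2 "T / \<bar>s\<bar>"] by auto
    then have "T \<le> norm (2 ^ k * s)" using that by (simp add: field_simps abs_mult)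
    from T[OF this] 1[of k] r(2) show False by simp
  qed
  let ?C = "{s. \<delta> \<le> \<bar>s\<bar> \<and> \<bar>s\<bar> \<le> max T \<delta>}"
  have "closed ?C"
    by (intro closed_Collect_conj closed_Collect_le continuous_intros)
  moreover have "bounded ?C" by (auto simp: bounded_iff)
  ultimately have "compact ?C" by (simp add: compact_eq_bounded_closed)
  moreover have "\<delta> \<in> ?C" using \<open>\<delta> > 0\<close> by auto
  moreover have "continuous_on ?C (\<lambda>s. cmod (char M s))"
    by (intro continuous_at_imp_continuous_on ballI continuous_norm isCont_char)
  ultimately obtain m where m: "m \<in> ?C" "\<And>s. s \<in> ?C \<Longrightarrow> cmod (char M s) \<le> cmod (char M m)"
    using continuous_attains_sup[of ?C "\<lambda>s. cmod (char M s)"] by blast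
  show ?thesis
  proof (rule that[of "max (1/2) (max r (cmod (char M m)))"])
    show "max (1/2) (max r (cmod (char M m))) < 1"
      using r(2) lt1[of m] m(1) \<open>\<delta> > 0\<close> by auto
    fix s :: real assume s: "\<bar>s\<bar> \<ge> \<delta>"
    show "cmod (char M s) \<le> max (1/2) (max r (cmod (char M m)))"
    proof (cases "T \<le> \<bar>s\<bar>")
      case True
      then show ?thesis using T[of s] by auto
    next
      case False
      then show ?thesis using m(2)[of s] s by auto
    qed
  qed auto
qed

end

section \<open>A trapezoid kernel and its Fourier representation\<close>

text \<open>Its value is pi. It appears as the same factor in \<open>dens0\<close> and in the
  formula for \<open>f 0\<close>, so it is carried symbolically.\<close>

definition versine_integral :: real where
  "versine_integral = (LBINT s. (1 - cos s) / s\<^sup>2)"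

lemma one_minus_cos_le: "1 - cos u \<le> u\<^sup>2 / 2" for u :: real
proof -
  have "\<bar>sin (u / 2)\<bar>\<^sup>2 \<le> \<bar>u / 2\<bar>\<^sup>2"
    by (intro power_mono abs_sin_x_le_abs_x) simp
  moreover have "1 - cos u = 2 * (sin (u / 2))\<^sup>2"
    using cos_double_sin[of "u / 2"] by simp
  ultimately show ?thesis by (simp add: power_divide)
qed

lemma versine_bounds: "0 \<le> (1 - cos s) / s\<^sup>2" "(1 - cos s) / s\<^sup>2 \<le> 4 * inverse (1 + s\<^sup>2)" for s :: real
proof -
  show "0 \<le> (1 - cos s) / s\<^sup>2" by simp
  show "(1 - cos s) / s\<^sup>2 \<le> 4 * inverse (1 + s\<^sup>2)"
  proof (cases "s = 0")
    case False
    have "1 - cos s \<le> s\<^sup>2 / 2" by (rule one_minus_cos_le)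
    moreover have "1 - cos s \<le> 2" using cos_ge_minus_one[of s] by simp
    then have "(1 - cos s) * s\<^sup>2 \<le> 2 * s\<^sup>2" by (rule mult_right_mono) simp
    ultimately have "(1 - cos s) * 1 + (1 - cos s) * s\<^sup>2 \<le> s\<^sup>2 / 2 + 2 * s\<^sup>2"
      by (intro add_mono) auto
    also have "\<dots> \<le> 4 * s\<^sup>2" by simp
    finally have "(1 - cos s) * (1 + s\<^sup>2) \<le> 4 * s\<^sup>2"
      by (simp only: distrib_left)
    moreover have "0 < s\<^sup>2" "0 < 1 + s\<^sup>2" using False by (auto intro: add_pos_nonneg)
    ultimately show ?thesis by (simp add: field_simps)
  qed simp
qed

lemma integrable_versine: "integrable lborel (\<lambda>s::real. (1 - cos (a * s)) / s\<^sup>2)"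
proof (cases "a = 0")
  case False
  have "integrable lborel (\<lambda>s::real. inverse (1 + s\<^sup>2))"
    using integrable_inverse_1_plus_square by (simp add: set_integrable_def)
  then have "integrable lborel (\<lambda>s::real. 4 * inverse (1 + s\<^sup>2))" by simp
  then have "integrable lborel (\<lambda>s::real. (1 - cos s) / s\<^sup>2)"
    by (rule Bochner_Integration.integrable_bound) (use versine_bounds in auto)
  then have "integrable lborel (\<lambda>s::real. (1 - cos (0 + a * s)) / (0 + a * s)\<^sup>2)"
    using False by (rule lborel_integrable_real_affine)
  then have "integrable lborel (\<lambda>s::real. a\<^sup>2 * ((1 - cos (0 + a * s)) / (0 + a * s)\<^sup>2))"
    by (rule integrable_mult_right)
  moreover have "a\<^sup>2 * ((1 - cos (0 + a * s)) / (0 + a * s)\<^sup>2) = (1 - cos (a * s)) / s\<^sup>2" for s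
    using False by (cases "s = 0") (simp_all add: power_mult_distrib)
  ultimately show ?thesis by (simp only:)
qed simp

text \<open>By scaling, \<open>|a|\<close> becomes a cosine integral with an absolutely integrable
  integrand. Trapezoids are combinations of absolute values, so this one identity yields their
  Fourier representation.\<close>

lemma integral_versine: "(LBINT s. (1 - cos (a * s)) / s\<^sup>2) = \<bar>a\<bar> * versine_integral"
proof (cases "a = 0")
  case False
  have "versine_integral = \<bar>a\<bar> *\<^sub>R (LBINT s. (1 - cos (0 + a * s)) / (0 + a * s)\<^sup>2)"
    unfolding versine_integral_def by (rule lborel_integral_real_affine) fact
  also have "\<dots> = \<bar>a\<bar> * (LBINT s. (1 / a\<^sup>2) * ((1 - cos (a * s)) / s\<^sup>2))"
    by (simp add: power_mult_distrib)
  also have "\<dots> = \<bar>a\<bar> / a\<^sup>2 * (LBINT s. (1 - cos (a * s)) / s\<^sup>2)"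
    by (subst integral_mult_right_zero) simp
  finally have I: "versine_integral = \<bar>a\<bar> / a\<^sup>2 * (LBINT s. (1 - cos (a * s)) / s\<^sup>2)" .
  have "\<bar>a\<bar> * versine_integral = (\<bar>a\<bar> * \<bar>a\<bar> / a\<^sup>2) * (LBINT s. (1 - cos (a * s)) / s\<^sup>2)"
    unfolding I by (simp only: times_divide_eq_right times_divide_eq_left mult.assoc)
  also have "\<bar>a\<bar> * \<bar>a\<bar> / a\<^sup>2 = 1" using False by (simp add: power2_eq_square)
  finally show ?thesis by simp
qed simp

lemma versine_integral_pos: "versine_integral > 0"
proof -
  have "versine_integral \<noteq> 0"
  proof
    assume "versine_integral = 0"
    moreover have "integrable lborel (\<lambda>s::real. (1 - cos s) / s\<^sup>2)"
      using integrable_versine[of 1] by simp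
    ultimately have "AE s::real in lborel. (1 - cos s) / s\<^sup>2 = 0"
      unfolding versine_integral_def by (subst (asm) integral_nonneg_eq_0_iff_AE) auto
    then have "AE s::real in lborel. s \<notin> {1..<2}"
    proof eventually_elim
      case (elim s)
      show ?case
      proof
        assume s: "s \<in> {1..<2}"
        then have "cos s < cos 0" using pi_gt3 by (intro cos_monotone_0_pi) auto
        with elim s show False by auto
      qed
    qed
    then have "{1..<2::real} \<in> null_sets lborel"
      by (subst (asm) AE_iff_null_sets[symmetric]) auto
    then show False by (simp add: null_sets_def)
  qed
  moreover have "versine_integral \<ge> 0"
    unfolding versine_integral_def by (rule Bochner_Integration.integral_nonneg) simp
  ultimately show ?thesis by simp
qed

lemma integrable_cos_diff_kernel: "integrable lborel (\<lambda>s::real. (cos (a * s) - cos (b * s)) / s\<^sup>2)"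
  using Bochner_Integration.integrable_diff[OF integrable_versine[of b] integrable_versine[of a]]
  by (simp add: diff_divide_distrib)

text \<open>For \<open>b \<ge> 0\<close>, \<open>max b |x|\<close> is the mean of
  \<open>|b + x|\<close> and \<open>|b - x|\<close>; product-to-sum formulas split the kernel into
  the four matching versine integrals.\<close>

lemma integral_trapezoid_kernel:
  assumes "0 \<le> a" "a \<le> b"
  shows "(LBINT s. (cos (a * s) - cos (b * s)) / s\<^sup>2 * cos (s * x))
       = versine_integral * (max b \<bar>x\<bar> - max a \<bar>x\<bar>)"
proof -
  define V where "V c s = (1 - cos (c * s)) / s\<^sup>2" for c s :: real
  have V: "integrable lborel (V c)" "(LBINT s. V c s) = \<bar>c\<bar> * versine_integral" for c
    unfolding V_def by (rule integrable_versine, rule integral_versine)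
  have "(cos (a * s) - cos (b * s)) / s\<^sup>2 * cos (s * x) =
      (1/2) * (V (b + x) s + V (b - x) s - V (a + x) s - V (a - x) s)" for s
  proof -
    have *: "cos ((c + x) * s) + cos ((c - x) * s) = 2 * (cos (c * s) * cos (s * x))" for c
      by (simp add: cos_add cos_diff algebra_simps)
    have "(cos (a * s) - cos (b * s)) * cos (s * x) =
      (1/2) * ((cos ((a + x) * s) + cos ((a - x) * s)) - (cos ((b + x) * s) + cos ((b - x) * s)))"
      unfolding * by (simp add: algebra_simps)
    then have "(cos (a * s) - cos (b * s)) / s\<^sup>2 * cos (s * x) =
      ((1/2) * ((cos ((a + x) * s) + cos ((a - x) * s)) - (cos ((b + x) * s) + cos ((b - x) * s)))) / s\<^sup>2"
      by (simp only: times_divide_eq_left)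
    then show ?thesis by (simp only: add_divide_distrib diff_divide_distrib times_divide_eq_right[symmetric] V_def) simp
  qed
  then have "(LBINT s. (cos (a * s) - cos (b * s)) / s\<^sup>2 * cos (s * x))
     = (LBINT s. (1/2) * (V (b + x) s + V (b - x) s - V (a + x) s - V (a - x) s))"
    by (rule Bochner_Integration.integral_cong[OF refl])
  also have "\<dots> = (1/2) * ((\<bar>b + x\<bar> + \<bar>b - x\<bar> - \<bar>a + x\<bar> - \<bar>a - x\<bar>) * versine_integral)"
    using V by (simp add: algebra_simps)
  also have "\<bar>b + x\<bar> + \<bar>b - x\<bar> - \<bar>a + x\<bar> - \<bar>a - x\<bar> = 2 * (max b \<bar>x\<bar> - max a \<bar>x\<bar>)"
    using assms by (auto simp: max_def abs_if)
  finally show ?thesis by (simp only: mult.assoc mult.commute[of versine_integral])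
qed

definition sine_ratio :: "real \<Rightarrow> real" where
  "sine_ratio = sinc"

lemma sine_ratio_measurable[measurable]: "sine_ratio \<in> borel_measurable borel"
  unfolding sine_ratio_def by measurable

lemma abs_sine_ratio_le_1: "\<bar>sine_ratio x\<bar> \<le> 1"
  using abs_sin_x_le_abs_x[of x] by (simp add: sine_ratio_def)

lemma tendsto_sine_ratio_0: "(f \<longlongrightarrow> 0) F \<Longrightarrow> ((\<lambda>x. sine_ratio (f x)) \<longlongrightarrow> 1) F"
  using isCont_tendsto_compose[OF isCont_sinc[of 0], of f F] by (simp add: sine_ratio_def)

text \<open>This separates size from shape: \<open>(b^2 - a^2) / 2\<close> carries the scale, while
  the two sine ratios are bounded by 1 and tend to 1 as their arguments vanish. At
  \<open>s = 0\<close> the left side is 0 through division by zero, so the identity is applied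
  almost everywhere.\<close>

lemma cos_diff_kernel_eq_sine_ratio:
  assumes "s \<noteq> 0"
  shows "(cos (a * s) - cos (b * s)) / s\<^sup>2 =
    (b\<^sup>2 - a\<^sup>2) / 2 * (sine_ratio ((a + b) / 2 * s) * sine_ratio ((b - a) / 2 * s))"
proof -
  have "cos (a * s) - cos (b * s) = 2 * sin ((a + b) / 2 * s) * sin ((b - a) / 2 * s)"
    using cos_diff_cos[of "a * s" "b * s"] by (simp add: algebra_simps add_divide_distrib diff_divide_distrib)
  moreover have "sin x = x * sine_ratio x" for x :: real by (simp add: sine_ratio_def)
  ultimately have "cos (a * s) - cos (b * s) =
      2 * ((a + b) / 2 * s * sine_ratio ((a + b) / 2 * s)) * ((b - a) / 2 * s * sine_ratio ((b - a) / 2 * s))"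
    by metis
  also have "\<dots> = ((b\<^sup>2 - a\<^sup>2) / 2 * (sine_ratio ((a + b) / 2 * s) * sine_ratio ((b - a) / 2 * s))) * s\<^sup>2"
    by (simp add: power2_eq_square field_simps)
  finally show ?thesis using assms by simp
qed

abbreviation trapezoid :: "real \<Rightarrow> real \<Rightarrow> real \<Rightarrow> real \<Rightarrow> real" where
  "trapezoid a b y x \<equiv> max b \<bar>x - y\<bar> - max a \<bar>x - y\<bar>"

text \<open>Parseval's formula for the trapezoid, by Fubini. Its transform decays like
  \<open>1 / s^2\<close> and is integrable, whereas that of a sharp indicator decays only like
  \<open>1 / s\<close>; hence the smoothing.\<close>

lemma (in real_distribution) expectation_trapezoid:
  assumes "0 \<le> a" "a \<le> b"
  shows "versine_integral * (\<integral>x. trapezoid a b y x \<partial>M) =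
    (LBINT s. (cos (a * s) - cos (b * s)) / s\<^sup>2 * Re (iexp (- (s * y)) * char M s))"
proof -
  interpret P: pair_sigma_finite M lborel ..
  let ?k = "\<lambda>s::real. (cos (a * s) - cos (b * s)) / s\<^sup>2"
  have "versine_integral * (\<integral>x. trapezoid a b y x \<partial>M) =
     (\<integral>x. (LBINT s. ?k s * cos (s * (x - y))) \<partial>M)"
    unfolding integral_trapezoid_kernel[OF assms] by (subst integral_mult_right_zero) simp
  also have "\<dots> = (\<integral>s. (\<integral>x. ?k s * cos (s * (x - y)) \<partial>M) \<partial>lborel)"
  proof (rule P.Fubini_integral[symmetric])
    have ineq: "\<bar>?k s * cos (s * (x - y))\<bar> \<le> \<bar>?k s\<bar>" for x s
      unfolding abs_mult by (rule mult_left_le) auto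
    have int: "integrable lborel (\<lambda>s. ?k s * cos (s * (x - y)))" for x
      by (rule Bochner_Integration.integrable_bound[OF integrable_cos_diff_kernel[of a b]])
        (use ineq in auto)
    show "integrable (M \<Otimes>\<^sub>M lborel) (\<lambda>(x, s). ?k s * cos (s * (x - y)))"
    proof (rule P.Fubini_integrable)
      have "(LBINT s. \<bar>?k s * cos (s * (x - y))\<bar>) \<le> (LBINT s. \<bar>?k s\<bar>)" for x
        by (rule integral_mono[OF integrable_abs[OF int] integrable_abs[OF integrable_cos_diff_kernel] ineq])
      moreover have "0 \<le> (LBINT s. \<bar>?k s * cos (s * (x - y))\<bar>)" for x
        by (rule Bochner_Integration.integral_nonneg) simp
      ultimately show "integrable M (\<lambda>x. \<integral>s. norm (case (x, s) of (x, s) \<Rightarrow> ?k s * cos (s * (x - y))) \<partial>lborel)"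
        by (intro integrable_const_bound[where B = "\<integral>s. \<bar>?k s\<bar> \<partial>lborel"]) auto
      show "AE x in M. integrable lborel (\<lambda>s. case (x, s) of (x, s) \<Rightarrow> ?k s * cos (s * (x - y)))"
        using int by simp
    qed measurable
  qed
  also have "\<dots> = (LBINT s. ?k s * Re (iexp (- (s * y)) * char M s))"
    unfolding Re_rotated_char by (simp add: right_diff_distrib)
  finally show ?thesis .
qed

section \<open>Norming constants and decay of the characteristic function\<close>

lemma (in real_distribution) cmod_char_minus: "cmod (char M (- s)) = cmod (char M s)"
proof -
  have "cnj (iexp (s * x)) = iexp (- s * x)" for x
    by (simp add: exp_cnj)
  then have "char M (- s) = (CLINT x|M. cnj (iexp (s * x)))"
    unfolding char_def by presburger
  also have "\<dots> = cnj (char M s)"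
    unfolding char_def by (rule Bochner_Integration.integral_cnj)
  finally have "char M (- s) = cnj (char M s)" .
  then show ?thesis by simp
qed

lemma (in real_distribution) cmod_char_abs: "cmod (char M \<bar>s\<bar>) = cmod (char M s)"
  using cmod_char_minus[of s] by (auto simp: abs_if)

text \<open>Transfers a limit along the exponent \<open>k\<close> to the exponent \<open>m\<close>
  when only the ratio \<open>m / k\<close> is known.\<close>

lemma power_eq_power_powr:
  fixes x :: real
  assumes "0 \<le> x" "1 \<le> k" "1 \<le> m"
  shows "x ^ m = (x ^ k) powr (real m / real k)"
proof (cases "x = 0")
  case False
  then have "(x ^ k) powr (real m / real k) = (x powr real k) powr (real m / real k)"
    using assms by (simp add: powr_realpow)
  also have "\<dots> = x powr real m" using assms by (simp add: powr_powr)
  finally show ?thesis using assms False by (simp add: powr_realpow)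
qed (use assms in \<open>auto simp: power_0_left\<close>)

lemma tendsto_div_2_ratio: "(\<lambda>k. real (k div 2) / real k) \<longlonglongrightarrow> 1 / 2"
proof (rule tendsto_sandwich)
  show "\<forall>\<^sub>F k in sequentially. 1/2 - (1/2) * (1 / real k) \<le> real (k div 2) / real k"
    using eventually_gt_at_top[of 0]
  proof eventually_elim
    case (elim k)
    have "real k \<le> 2 * real (k div 2) + 1" by linarith
    then have "real k / real k \<le> (2 * real (k div 2) + 1) / real k"
      by (rule divide_right_mono) simp
    then show ?case using elim by (simp add: add_divide_distrib)
  qed
  show "\<forall>\<^sub>F k in sequentially. real (k div 2) / real k \<le> 1/2"
    using eventually_gt_at_top[of 0]
  proof eventually_elim
    case (elim k)
    have "2 * real (k div 2) \<le> real k" by linarith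
    then show ?case using elim by (simp add: field_simps)
  qed
  have "(\<lambda>k. 1/2 - (1/2) * (1 / real k)) \<longlonglongrightarrow> 1/2 - (1/2) * 0"
    by (intro tendsto_intros lim_1_over_n)
  then show "(\<lambda>k. 1/2 - (1/2) * (1 / real k)) \<longlonglongrightarrow> 1/2" by simp
qed auto

text \<open>Attraction is recorded through characteristic functions, with convergence uniform on
  bounded sets: arguments substituted below, such as \<open>A n\<close> or
  \<open>A (m k) / A k\<close>, move with the index. The decay arguments use only the modulus of
  \<open>char \<mu>\<close>, in which shift and skewness are invisible.\<close>

locale stable_attraction = real_distribution \<nu> for \<nu> :: "real measure" +
  fixes A :: "nat \<Rightarrow> real" and \<mu> :: "real measure" and \<sigma> :: real
  assumes A_pos: "\<And>n. n \<ge> 1 \<Longrightarrow> A n > 0"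
    and mu: "real_distribution \<mu>"
    and cmod_char_mu: "\<And>t. cmod (char \<mu> t) = exp (- (\<sigma> * \<bar>t\<bar>))"
    and sigma_pos: "\<sigma> > 0"
    and char_unif: "\<And>T. uniform_limit {-T..T} (\<lambda>n t. char \<nu> (t / A n) ^ n) (char \<mu>) sequentially"
    and cramer: "Limsup at_infinity (\<lambda>s. ereal (cmod (char \<nu> s))) < 1"
begin

abbreviation "w s \<equiv> cmod (char \<nu> s)"

lemma cmod_unif:
  assumes "e > 0"
  shows "\<forall>\<^sub>F n in sequentially. \<forall>t\<in>{-T..T}. \<bar>w (t / A n) ^ n - exp (- (\<sigma> * \<bar>t\<bar>))\<bar> < e"
  using uniform_limitD[OF char_unif[of T] assms]
proof eventually_elim
  case (elim n)
  show ?case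
  proof
    fix t assume "t \<in> {-T..T}"
    then have "cmod (char \<nu> (t / A n) ^ n - char \<mu> t) < e"
      using elim by (simp add: dist_norm)
    then show "\<bar>w (t / A n) ^ n - exp (- (\<sigma> * \<bar>t\<bar>))\<bar> < e"
      using norm_triangle_ineq3[of "char \<nu> (t / A n) ^ n" "char \<mu> t"]
      by (simp add: norm_power cmod_char_mu)
  qed
qed

lemma cmod_seq:
  assumes b: "\<And>k. \<bar>b k\<bar> \<le> T" and m: "filterlim m at_top sequentially"
  shows "(\<lambda>k. w (b k / A (m k)) ^ m k - exp (- (\<sigma> * \<bar>b k\<bar>))) \<longlonglongrightarrow> 0"
proof (rule tendstoI)
  fix e :: real assume "0 < e"
  from cmod_unif[OF this, of T]
  have "\<forall>\<^sub>F k in sequentially. \<forall>t\<in>{-T..T}. \<bar>w (t / A (m k)) ^ m k - exp (- (\<sigma> * \<bar>t\<bar>))\<bar> < e"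
    using m unfolding filterlim_iff by blast
  then show "\<forall>\<^sub>F k in sequentially. dist (w (b k / A (m k)) ^ m k - exp (- (\<sigma> * \<bar>b k\<bar>))) 0 < e"
  proof eventually_elim
    case (elim k)
    then show ?case using b[of k] by (auto simp: abs_le_iff)
  qed
qed

text \<open>If \<open>A n < Z\<close> for a large \<open>n\<close>, then \<open>t = A n\<close> lies
  in a fixed bounded range. There \<open>w (t / A n) ^ n = w 1 ^ n\<close> is exponentially small,
  while the limit \<open>exp (- (\<sigma> * A n))\<close> stays bounded away from 0.\<close>

lemma A_at_top: "filterlim A at_top sequentially"
  unfolding filterlim_at_top
proof
  fix Z :: real
  define Z' where "Z' = \<bar>Z\<bar> + 1"
  obtain \<rho> where \<rho>: "0 < \<rho>" "\<rho> < 1" "\<And>s. \<bar>s\<bar> \<ge> 1 \<Longrightarrow> w s \<le> \<rho>"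
    using cramer_bound_away_from_0[OF cramer, of 1] by auto
  define e where "e = exp (- (\<sigma> * Z')) / 2"
  have e: "e > 0" by (simp add: e_def)
  have "(\<lambda>n. \<rho> ^ n) \<longlonglongrightarrow> 0" using \<rho> by (intro LIMSEQ_power_zero) auto
  from order_tendstoD(2)[OF this e] cmod_unif[OF e, of Z'] eventually_ge_at_top[of 1]
  show "\<forall>\<^sub>F n in sequentially. Z \<le> A n"
  proof eventually_elim
    case (elim n)
    show ?case
    proof (rule ccontr)
      assume "\<not> Z \<le> A n"
      then have An: "A n \<in> {-Z'..Z'}" "A n \<le> Z'" and pos: "A n > 0" using A_pos[of n] elim by (auto simp: Z'_def)
      then have "\<bar>w (A n / A n) ^ n - exp (- (\<sigma> * \<bar>A n\<bar>))\<bar> < e" using elim by blast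
      then have "exp (- (\<sigma> * A n)) < w 1 ^ n + e" using pos by simp
      moreover have "w 1 ^ n \<le> \<rho> ^ n" using \<rho>(3)[of 1] by (intro power_mono) auto
      moreover have "exp (- (\<sigma> * Z')) \<le> exp (- (\<sigma> * A n))" using An sigma_pos by simp
      moreover have "\<rho> ^ n < e" using elim by blast
      moreover have "exp (- (\<sigma> * Z')) = 2 * e" by (simp add: e_def)
      ultimately show False by linarith
    qed
  qed
qed

text \<open>Regular variation of \<open>A\<close> with index 1. With
  \<open>r = A (m k) / A k\<close>, the power \<open>w (1 / A k) ^ m k\<close> equals
  \<open>w (r / A (m k)) ^ m k\<close>, which is close to \<open>exp (- (\<sigma> * r))\<close>;
  changing the exponent in \<open>w (1 / A k) ^ k\<close> from \<open>k\<close> to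
  \<open>m k\<close> shows that its limit is \<open>exp (- (\<sigma> * l))\<close>.\<close>

lemma A_ratio_tendsto:
  assumes m: "filterlim m at_top sequentially"
    and ratio: "(\<lambda>k. real (m k) / real k) \<longlonglongrightarrow> l" and "l > 0"
  shows "(\<lambda>k. A (m k) / A k) \<longlonglongrightarrow> l"
proof -
  define r where "r k = A (m k) / A k" for k
  have m1: "\<forall>\<^sub>F k in sequentially. m k \<ge> 1"
    using m unfolding filterlim_at_top by blast
  have k1: "\<forall>\<^sub>F k in sequentially. k \<ge> (1::nat)" by (rule eventually_ge_at_top)
  have rpos: "\<forall>\<^sub>F k in sequentially. r k > 0"
    using m1 k1 by eventually_elim (simp add: r_def A_pos)
  have "(\<lambda>k. w (1 / A k) ^ k - exp (- (\<sigma> * \<bar>1\<bar>))) \<longlonglongrightarrow> 0"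
    by (rule cmod_seq[where m = "\<lambda>k. k"]) (auto simp: filterlim_ident)
  then have L1: "(\<lambda>k. w (1 / A k) ^ k) \<longlonglongrightarrow> exp (- \<sigma>)"
    by (simp add: LIM_zero_iff)
  have "(\<lambda>k. w (1 / A (m k)) ^ m k - exp (- (\<sigma> * \<bar>1\<bar>))) \<longlonglongrightarrow> 0"
    by (rule cmod_seq[OF _ m]) auto
  then have L2: "(\<lambda>k. w (1 / A (m k)) ^ m k) \<longlonglongrightarrow> exp (- \<sigma>)"
    by (simp add: LIM_zero_iff)
  have "(\<lambda>k. (w (1 / A k) ^ k) powr (real (m k) / real k)) \<longlonglongrightarrow> exp (- \<sigma>) powr l"
    by (intro tendsto_powr L1 ratio) simp
  moreover have "\<forall>\<^sub>F k in sequentially. (w (1 / A k) ^ k) powr (real (m k) / real k) = w (1 / A k) ^ m k"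
    using m1 k1 by eventually_elim (rule power_eq_power_powr[symmetric], auto)
  ultimately have L3: "(\<lambda>k. w (1 / A k) ^ m k) \<longlonglongrightarrow> exp (- (\<sigma> * l))"
    by (simp add: tendsto_cong exp_powr_real)
  have "(\<lambda>k. inverse (real (m k) / real k)) \<longlonglongrightarrow> inverse l"
    using \<open>l > 0\<close> by (intro tendsto_inverse ratio) auto
  then have ratio': "(\<lambda>k. real k / real (m k)) \<longlonglongrightarrow> inverse l" by simp
  have "(\<lambda>k. (w (1 / A (m k)) ^ m k) powr (real k / real (m k))) \<longlonglongrightarrow> exp (- \<sigma>) powr inverse l"
    by (intro tendsto_powr L2 ratio') simp
  moreover have "\<forall>\<^sub>F k in sequentially. (w (1 / A (m k)) ^ m k) powr (real k / real (m k)) = w (1 / A (m k)) ^ k"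
    using m1 k1 by eventually_elim (rule power_eq_power_powr[symmetric], auto)
  ultimately have L4: "(\<lambda>k. w (1 / A (m k)) ^ k) \<longlonglongrightarrow> exp (- (\<sigma> / l))"
    by (simp add: tendsto_cong exp_powr_real divide_inverse)
  \<comment> \<open>Uniform convergence is available only for bounded \<open>r\<close>. If
    \<open>r > 2 * l\<close>, then \<open>q = 1 / r\<close> is an admissible argument at time
    \<open>k\<close>, and \<open>w (q / A k) ^ k = w (1 / A (m k)) ^ k\<close> would be close both
    to a value above \<open>exp (- (\<sigma> / (2 * l)))\<close> and to
    \<open>exp (- (\<sigma> / l))\<close>. Here \<open>e\<close> is half the gap.\<close>
  define e where "e = (exp (- (\<sigma> / (2 * l))) - exp (- (\<sigma> / l))) / 2"
  have "\<sigma> / (2 * l) < \<sigma> / l" using sigma_pos \<open>l > 0\<close> by (simp add: field_simps)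
  then have e: "e > 0" by (simp add: e_def)
  have "exp (- (\<sigma> / l)) < exp (- (\<sigma> / l)) + e" using e by simp
  from order_tendstoD(2)[OF L4 this] cmod_unif[OF e, of "1 / (2 * l)"] rpos k1 m1
  have bd: "\<forall>\<^sub>F k in sequentially. r k \<le> 2 * l"
  proof eventually_elim
    case (elim k)
    show ?case
    proof (rule ccontr)
      assume c: "\<not> r k \<le> 2 * l"
      define q where "q = 1 / r k"
      have q: "q > 0" "q \<le> 1 / (2 * l)" using c elim \<open>l > 0\<close> by (auto simp: q_def field_simps)
      then have "q \<in> {- (1 / (2 * l))..1 / (2 * l)}" by auto
      then have "\<bar>w (q / A k) ^ k - exp (- (\<sigma> * \<bar>q\<bar>))\<bar> < e" using elim by blast
      moreover have "q / A k = 1 / A (m k)" using elim A_pos[of k] by (simp add: q_def r_def)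
      moreover have "\<sigma> * q \<le> \<sigma> / (2 * l)" using mult_left_mono[OF q(2), of \<sigma>] sigma_pos by simp
      ultimately have "exp (- (\<sigma> / (2 * l))) < w (1 / A (m k)) ^ k + e"
        using q by (smt (verit) exp_le_cancel_iff)
      then show False using elim by (simp add: e_def field_simps)
    qed
  qed
  \<comment> \<open>Truncation bounds the argument for every \<open>k\<close>, as
    \<open>cmod_seq\<close> demands; eventually \<open>r' k = r k\<close>.\<close>
  define r' where "r' k = min \<bar>r k\<bar> (2 * l)" for k
  have "(\<lambda>k. w (r' k / A (m k)) ^ m k - exp (- (\<sigma> * \<bar>r' k\<bar>))) \<longlonglongrightarrow> 0"
    by (rule cmod_seq[OF _ m, where T = "2 * l"]) (use \<open>l > 0\<close> in \<open>auto simp: r'_def\<close>)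
  then have "(\<lambda>k. w (1 / A k) ^ m k - (w (r' k / A (m k)) ^ m k - exp (- (\<sigma> * \<bar>r' k\<bar>)))) \<longlonglongrightarrow> exp (- (\<sigma> * l)) - 0"
    by (intro tendsto_diff L3)
  moreover have ev: "\<forall>\<^sub>F k in sequentially. w (1 / A k) ^ m k - (w (r' k / A (m k)) ^ m k - exp (- (\<sigma> * \<bar>r' k\<bar>)))
      = exp (- (\<sigma> * r k))"
    using rpos bd k1 m1
  proof eventually_elim
    case (elim k)
    then have "r' k = r k" "\<bar>r' k\<bar> = r k" by (auto simp: r'_def)
    moreover have "r k / A (m k) = 1 / A k" using elim A_pos[of "m k"] by (simp add: r_def)
    ultimately show ?case by simp
  qed
  ultimately have "(\<lambda>k. exp (- (\<sigma> * r k))) \<longlonglongrightarrow> exp (- (\<sigma> * l))"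
    by (simp add: tendsto_cong[OF ev])
  then have "(\<lambda>k. ln (exp (- (\<sigma> * r k)))) \<longlonglongrightarrow> ln (exp (- (\<sigma> * l)))"
    by (rule tendsto_ln) simp
  then have "(\<lambda>k. (-1 / \<sigma>) * (- (\<sigma> * r k))) \<longlonglongrightarrow> (-1 / \<sigma>) * (- (\<sigma> * l))"
    by (intro tendsto_mult tendsto_const) simp
  then show ?thesis using sigma_pos by (simp add: r_def)
qed

lemma A_le_4_half: "\<forall>\<^sub>F n in sequentially. A n \<le> 4 * A (n div 2)"
proof -
  have "(\<lambda>k. A (k div 2) / A k) \<longlonglongrightarrow> 1/2"
  proof (rule A_ratio_tendsto[OF _ tendsto_div_2_ratio])
    show "filterlim (\<lambda>k::nat. k div 2) at_top sequentially"
      unfolding filterlim_at_top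
    proof
      fix Z :: nat
      show "\<forall>\<^sub>F k in sequentially. Z \<le> k div 2"
        using eventually_ge_at_top[of "2 * Z"] by eventually_elim auto
    qed
  qed simp
  then have "\<forall>\<^sub>F k in sequentially. 1/4 < A (k div 2) / A k"
    by (rule order_tendstoD) simp
  then show ?thesis
    using eventually_ge_at_top[of 1]
  proof eventually_elim
    case (elim n)
    then show ?case using A_pos[of n] by (simp add: field_simps)
  qed
qed

text \<open>Halving the time squares the bound, while \<open>A n \<le> 4 * A (n div 2)\<close> costs a factor
  of at most two inside the square root.\<close>
lemma cmod_char_decay:
  obtains \<delta> c N where "\<delta> > 0" "c > 0" "N \<ge> 1"
    "\<And>n s. N \<le> n \<Longrightarrow> \<bar>s\<bar> \<le> \<delta> \<Longrightarrow> 1/4 \<le> \<bar>s\<bar> * A n \<Longrightarrow> w s ^ n \<le> exp (- (c * sqrt (\<bar>s\<bar> * A n)))"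
proof -
  \<comment> \<open>On the base range \<open>1/4 \<le> s * A n \<le> 1\<close> the limit is at most
    \<open>exp (- (\<sigma> / 4)) = exp (- (2 * c))\<close>. The tolerance \<open>e\<close> is the
    gap to \<open>exp (- c)\<close>, which suffices there because the square root is at most
    1.\<close>
  define c where "c = \<sigma> / 8"
  have c: "c > 0" using sigma_pos by (simp add: c_def)
  define e where "e = exp (- c) - exp (- (2 * c))"
  have e: "e > 0" using c by (simp add: e_def)
  have "\<forall>\<^sub>F n in sequentially. 1 \<le> n \<and> A n \<le> 4 * A (n div 2) \<and>
      (\<forall>t\<in>{-1..1}. \<bar>w (t / A n) ^ n - exp (- (\<sigma> * \<bar>t\<bar>))\<bar> < e)"
    using A_le_4_half cmod_unif[OF e, of 1] eventually_ge_at_top[of 1]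
    by eventually_elim simp
  then obtain N where N: "\<And>n. n \<ge> N \<Longrightarrow> 1 \<le> n \<and> A n \<le> 4 * A (n div 2) \<and>
      (\<forall>t\<in>{-1..1}. \<bar>w (t / A n) ^ n - exp (- (\<sigma> * \<bar>t\<bar>))\<bar> < e)"
    unfolding eventually_sequentially by blast
  have N1: "N \<ge> 1" using N[of N] by simp
  \<comment> \<open>With \<open>s \<le> 1 / D\<close>, the inequality \<open>s * A n > 1\<close>
    forces \<open>n > 2 * N\<close>, so halving never leaves the range
    \<open>n \<ge> N\<close>.\<close>
  define D where "D = 1 + (\<Sum>n=1..2*N. A n)"
  have sum_ge: "A n \<le> (\<Sum>n=1..2*N. A n)" if "1 \<le> n" "n \<le> 2 * N" for n
    by (rule member_le_sum) (use that A_pos in \<open>auto intro: less_imp_le\<close>)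
  have "0 \<le> (\<Sum>n=1..2*N. A n)" by (rule sum_nonneg) (rule less_imp_le, rule A_pos, simp)
  then have D: "D > 0" by (simp add: D_def)
  have main: "w s ^ n \<le> exp (- (c * sqrt (s * A n)))"
    if "N \<le> n" "0 < s" "s \<le> 1 / D" "1/4 \<le> s * A n" for n s
    using that
  proof (induction n rule: less_induct)
    case (less n)
    have An: "A n > 0" using less N1 by (intro A_pos) auto
    show ?case
    proof (cases "s * A n \<le> 1")
      case True
      have "s * A n \<in> {-1..1}" using True less.prems by auto
      then have "\<bar>w (s * A n / A n) ^ n - exp (- (\<sigma> * \<bar>s * A n\<bar>))\<bar> < e"
        using N[OF less.prems(1)] by blast
      then have "w s ^ n < exp (- (\<sigma> * (s * A n))) + e" using An less.prems by (simp add: abs_mult)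
      also have "exp (- (\<sigma> * (s * A n))) \<le> exp (- (2 * c))"
        using mult_left_mono[OF less.prems(4), of \<sigma>] sigma_pos by (simp add: c_def)
      finally have "w s ^ n \<le> exp (- c)" by (simp add: e_def)
      also have "\<dots> \<le> exp (- (c * sqrt (s * A n)))"
        using True c by (simp add: mult_left_le)
      finally show ?thesis .
    next
      case False
      have "2 * N < n"
      proof (rule ccontr)
        assume "\<not> 2 * N < n"
        then have "A n \<le> D" using sum_ge[of n] less.prems N1 by (auto simp: D_def)
        then have "s * A n \<le> 1 / D * D" using less.prems An D by (intro mult_mono) auto
        then show False using False D by simp
      qed
      then have n2: "N \<le> n div 2" "n div 2 < n" by auto
      have half: "s * A n / 4 \<le> s * A (n div 2)"
        using mult_left_mono[of "A n" "4 * A (n div 2)" s] N[of n] less.prems by simp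
      have "w s ^ (n div 2) \<le> exp (- (c * sqrt (s * A (n div 2))))"
        using less.IH[OF n2(2) n2(1)] less.prems half False by simp
      also have "\<dots> \<le> exp (- (c * sqrt (s * A n / 4)))"
        using half c by simp
      finally have "(w s ^ (n div 2))\<^sup>2 \<le> (exp (- (c * sqrt (s * A n / 4))))\<^sup>2"
        by (rule power_mono) simp
      also have "\<dots> = exp (- (c * sqrt (s * A n)))"
        by (simp add: real_sqrt_divide flip: exp_double)
      finally have "w s ^ (n div 2 * 2) \<le> exp (- (c * sqrt (s * A n)))"
        by (simp add: power_mult)
      \<comment> \<open>For odd \<open>n\<close> one factor, at most 1, is dropped.\<close>
      moreover have "w s ^ n \<le> w s ^ (n div 2 * 2)"
        by (rule power_decreasing) (auto simp: cmod_char_le_1)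
      ultimately show ?thesis by simp
    qed
  qed
  show ?thesis
  proof (rule that[of "1 / D" c N])
    fix n s assume *: "N \<le> n" "\<bar>s\<bar> \<le> 1 / D" "1/4 \<le> \<bar>s\<bar> * A n"
    then have "0 < \<bar>s\<bar>" by (cases "s = 0") auto
    from main[OF *(1) this *(2,3)] show "w s ^ n \<le> exp (- (c * sqrt (\<bar>s\<bar> * A n)))"
      by (simp only: cmod_char_abs)
  qed (use c D N1 in auto)
qed

end

section \<open>Uniform local limit theorem\<close>

text \<open>\<open>x / 4 \<le> exp (x / 4)\<close> is raised to the fourth power with
  \<open>x = c * sqrt |t|\<close>, so that \<open>x ^ 4\<close> is a multiple of \<open>t^2\<close>;
  hence \<open>256 = 4 ^ 4\<close>.\<close>

lemma sub_exponential_le: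
  fixes t c :: real
  assumes "c > 0"
  shows "exp (- (c * sqrt \<bar>t\<bar>)) \<le> (1 + 256 / c ^ 4) * inverse (1 + t\<^sup>2)"
proof -
  define x where "x = c * sqrt \<bar>t\<bar>"
  have x: "x \<ge> 0" using assms by (simp add: x_def)
  have "x / 4 \<le> exp (x / 4)" using exp_ge_add_one_self[of "x / 4"] by linarith
  then have "(x / 4) ^ 4 \<le> exp (x / 4) ^ 4" using x by (intro power_mono) auto
  also have "\<dots> = exp x" by (simp flip: exp_of_nat_mult)
  finally have "x ^ 4 \<le> 256 * exp x" by (simp add: power_divide)
  moreover have "x ^ 4 = c ^ 4 * t\<^sup>2"
  proof -
    have "sqrt \<bar>t\<bar> ^ 4 = ((sqrt \<bar>t\<bar>)\<^sup>2)\<^sup>2" by (subst power_mult[symmetric]) simp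
    then show ?thesis by (simp add: x_def power_mult_distrib)
  qed
  ultimately have "t\<^sup>2 \<le> 256 / c ^ 4 * exp x" using assms by (simp add: field_simps)
  moreover have "1 \<le> exp x" using x by simp
  ultimately have "1 + t\<^sup>2 \<le> exp x + 256 / c ^ 4 * exp x" by (intro add_mono)
  then have "1 + t\<^sup>2 \<le> (1 + 256 / c ^ 4) * exp x" by (simp add: distrib_right)
  moreover have "0 < 1 + t\<^sup>2" by (intro add_pos_nonneg) auto
  ultimately have "1 / exp x \<le> (1 + 256 / c ^ 4) / (1 + t\<^sup>2)"
    by (simp add: field_simps)
  then show ?thesis by (simp add: x_def exp_minus divide_inverse)
qed

lemma integrable_inverse_1_plus_square_lborel: "integrable lborel (\<lambda>s::real. inverse (1 + s\<^sup>2))"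
  using integrable_inverse_1_plus_square by (simp add: set_integrable_def)

context stable_attraction
begin

definition decay_bound :: "real \<Rightarrow> real \<Rightarrow> nat \<Rightarrow> bool" where
  "decay_bound \<delta> C N \<longleftrightarrow> \<delta> > 0 \<and> C > 0 \<and> N \<ge> 1 \<and>
    (\<forall>n s. N \<le> n \<longrightarrow> \<bar>s\<bar> \<le> \<delta> \<longrightarrow> 1/4 \<le> \<bar>s\<bar> * A n \<longrightarrow> w s ^ n \<le> exp (- (C * sqrt (\<bar>s\<bar> * A n))))"

text \<open>By Fourier inversion this is \<open>2 * pi\<close> times the value at 0 of a continuous
  density of \<open>\<mu>\<close>.\<close>

definition char_int :: real where "char_int = (LBINT t. Re (char \<mu> t))"

definition kern :: "nat \<Rightarrow> real \<Rightarrow> real \<Rightarrow> real \<Rightarrow> real \<Rightarrow> real" where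
  "kern k c d y s = sine_ratio (c * s) * sine_ratio (d * s) * Re (iexp (- (s * y)) * char \<nu> s ^ k)"

lemma kern_measurable[measurable]: "kern k c d y \<in> borel_measurable borel"
  unfolding kern_def by measurable

lemma abs_kern_le: "\<bar>kern k c d y s\<bar> \<le> w s ^ k"
proof -
  have "\<bar>sine_ratio (c * s) * sine_ratio (d * s)\<bar> \<le> 1 * 1"
    unfolding abs_mult by (intro mult_mono abs_sine_ratio_le_1) auto
  moreover have "\<bar>Re (iexp (- (s * y)) * char \<nu> s ^ k)\<bar> \<le> w s ^ k"
    using abs_Re_le_cmod[of "iexp (- (s * y)) * char \<nu> s ^ k"]
    by (simp add: norm_mult norm_power)
  ultimately have "\<bar>sine_ratio (c * s) * sine_ratio (d * s)\<bar> * \<bar>Re (iexp (- (s * y)) * char \<nu> s ^ k)\<bar> \<le> 1 * 1 * w s ^ k"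
    by (rule mult_mono) auto
  then show ?thesis by (simp add: kern_def abs_mult)
qed

text \<open>After substituting \<open>s = t / A k\<close>, the sine ratios and the rotation tend to
  1 and the power of \<open>char \<nu>\<close> tends to \<open>char \<mu> t\<close>. The parameters
  are arbitrary bounded sequences, so that uniformity can be deduced afterwards.\<close>

lemma kern_integral_tendsto:
  assumes dec: "decay_bound \<delta> C N"
    and bounds: "\<And>k. \<bar>c k\<bar> \<le> 1" "\<And>k. \<bar>d k\<bar> \<le> 1" "\<And>k. \<bar>y k\<bar> \<le> 1"
  shows "(\<lambda>k. A k * (LBINT s. indicator {-\<delta>..\<delta>} s * kern k (c k) (d k) (y k) s)) \<longlonglongrightarrow> char_int"
proof -
  have "\<delta> > 0" and "C > 0" and "N \<ge> 1"
    and decay: "\<And>n s. N \<le> n \<Longrightarrow> \<bar>s\<bar> \<le> \<delta> \<Longrightarrow> 1/4 \<le> \<bar>s\<bar> * A n \<Longrightarrow> w s ^ n \<le> exp (- (C * sqrt (\<bar>s\<bar> * A n)))"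
    using dec unfolding decay_bound_def by auto
  \<comment> \<open>The 2 serves \<open>|t| < 1/4\<close>, where the integrand is merely bounded by
    1; the rest is the constant of \<open>sub_exponential_le\<close> for the other
    \<open>t\<close>.\<close>
  define B where "B = 2 + (1 + 256 / C ^ 4)"
  interpret mu: real_distribution \<mu> by (rule mu)
  define I where "I k t = indicator {-\<delta>..\<delta>} (t / A k) * kern k (c k) (d k) (y k) (t / A k)" for k t
  \<comment> \<open>The majorant is available only from time \<open>N\<close> on, hence the shift of
    the index.\<close>
  have "(\<lambda>k. \<integral>t. I (k + N) t \<partial>lborel) \<longlonglongrightarrow> char_int"
    unfolding char_int_def
  proof (rule integral_dominated_convergence[where w = "\<lambda>t. B * inverse (1 + t\<^sup>2)"])
    show "integrable lborel (\<lambda>t::real. B * inverse (1 + t\<^sup>2))"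
      using integrable_inverse_1_plus_square_lborel by simp
    show "AE t in lborel. (\<lambda>k. I (k + N) t) \<longlonglongrightarrow> Re (char \<mu> t)"
    proof (rule AE_I2)
      fix t :: real
      have t0: "(\<lambda>k. t / A k) \<longlonglongrightarrow> 0"
        by (intro tendsto_divide_0[OF tendsto_const] filterlim_at_top_imp_at_infinity A_at_top)
      have bt: "(\<lambda>k. x k * (t / A k)) \<longlonglongrightarrow> 0" if "\<And>k. \<bar>x k\<bar> \<le> 1" for x :: "nat \<Rightarrow> real"
      proof (rule Lim_null_comparison[OF _ tendsto_rabs_zero[OF t0]])
        have "\<bar>x k\<bar> * \<bar>t / A k\<bar> \<le> \<bar>t / A k\<bar>" for k
          using that by (intro mult_left_le_one_le) auto
        then show "\<forall>\<^sub>F k in sequentially. norm (x k * (t / A k)) \<le> \<bar>t / A k\<bar>"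
          by (simp add: abs_mult always_eventually)
      qed
      have 1: "\<forall>\<^sub>F k in sequentially. indicator {-\<delta>..\<delta>} (t / A k) = (1::real)"
      proof -
        have "\<forall>\<^sub>F k in sequentially. - \<delta> < t / A k" "\<forall>\<^sub>F k in sequentially. t / A k < \<delta>"
          using \<open>\<delta> > 0\<close> by (auto intro!: order_tendstoD[OF t0])
        then show ?thesis by eventually_elim simp
      qed
      have 2: "(\<lambda>k. char \<nu> (t / A k) ^ k) \<longlonglongrightarrow> char \<mu> t"
        by (rule tendsto_uniform_limitI[OF char_unif[of "\<bar>t\<bar>"]]) auto
      have "(\<lambda>k. iexp (- (y k * (t / A k)))) \<longlonglongrightarrow> iexp (- 0)"
        by (intro tendsto_intros bt bounds)
      then have 3: "(\<lambda>k. iexp (- (t / A k * y k))) \<longlonglongrightarrow> 1" by (simp add: mult.commute)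
      have "(\<lambda>k. kern k (c k) (d k) (y k) (t / A k)) \<longlonglongrightarrow> 1 * 1 * Re (1 * char \<mu> t)"
        unfolding kern_def
        by (intro tendsto_mult tendsto_Re tendsto_sine_ratio_0 bt bounds 2 3)
      then have "(\<lambda>k. 1 * kern k (c k) (d k) (y k) (t / A k)) \<longlonglongrightarrow> Re (char \<mu> t)" by simp
      moreover have "\<forall>\<^sub>F k in sequentially. I k t = 1 * kern k (c k) (d k) (y k) (t / A k)"
        using 1 by eventually_elim (simp only: I_def)
      ultimately have "(\<lambda>k. I k t) \<longlonglongrightarrow> Re (char \<mu> t)"
        by (simp add: tendsto_cong)
      then show "(\<lambda>k. I (k + N) t) \<longlonglongrightarrow> Re (char \<mu> t)"
        by (rule LIMSEQ_ignore_initial_segment)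
    qed
    fix k
    show "AE t in lborel. norm (I (k + N) t) \<le> B * inverse (1 + t\<^sup>2)"
    proof (rule AE_I2)
      fix t :: real
      let ?n = "k + N"
      have An: "A ?n > 0" using \<open>N \<ge> 1\<close> by (intro A_pos) auto
      have Bpos: "0 \<le> B * inverse (1 + t\<^sup>2)" using \<open>C > 0\<close> by (simp add: B_def)
      show "norm (I ?n t) \<le> B * inverse (1 + t\<^sup>2)"
      proof (cases "t / A ?n \<in> {-\<delta>..\<delta>}")
        case True
        then have "norm (I ?n t) \<le> w (t / A ?n) ^ ?n" by (simp add: I_def abs_kern_le)
        also have "\<dots> \<le> B * inverse (1 + t\<^sup>2)"
        proof (cases "1/4 \<le> \<bar>t\<bar>")
          case True
          have "w (t / A ?n) ^ ?n \<le> exp (- (C * sqrt (\<bar>t / A ?n\<bar> * A ?n)))"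
            by (rule decay) (use True An \<open>t / A ?n \<in> {-\<delta>..\<delta>}\<close> in auto)
          also have "\<bar>t / A ?n\<bar> * A ?n = \<bar>t\<bar>" using An by simp
          also have "exp (- (C * sqrt \<bar>t\<bar>)) \<le> (1 + 256 / C ^ 4) * inverse (1 + t\<^sup>2)"
            by (rule sub_exponential_le) fact
          also have "\<dots> \<le> B * inverse (1 + t\<^sup>2)"
            by (intro mult_right_mono) (auto simp: B_def)
          finally show ?thesis .
        next
          case False
          have "w (t / A ?n) ^ ?n \<le> 1" by (simp add: power_le_one cmod_char_le_1)
          also have "1 \<le> 2 * inverse (1 + t\<^sup>2)"
          proof -
            have "\<bar>t\<bar>\<^sup>2 \<le> 1" using False by (intro power_le_one) auto
            moreover have "0 < 1 + t\<^sup>2" by (intro add_pos_nonneg) auto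
            ultimately show ?thesis by (simp add: field_simps)
          qed
          also have "\<dots> \<le> B * inverse (1 + t\<^sup>2)"
            using \<open>C > 0\<close> by (intro mult_right_mono) (auto simp: B_def)
          finally show ?thesis .
        qed
        finally show ?thesis .
      next
        case False
        then have "norm (I ?n t) = 0" by (simp add: I_def)
        then show ?thesis using Bpos by simp
      qed
    qed
  qed (auto simp: I_def)
  then have lim: "(\<lambda>k. \<integral>t. I k t \<partial>lborel) \<longlonglongrightarrow> char_int" by (rule LIMSEQ_offset)
  have "\<forall>\<^sub>F k in sequentially. A k * (LBINT s. indicator {-\<delta>..\<delta>} s * kern k (c k) (d k) (y k) s) = (LBINT t. I k t)"
    using eventually_ge_at_top[of 1]
  proof eventually_elim
    case (elim k)
    then have Ak: "A k > 0" by (rule A_pos)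
    have "(LBINT s. indicator {-\<delta>..\<delta>} s * kern k (c k) (d k) (y k) s)
      = \<bar>1 / A k\<bar> *\<^sub>R (LBINT t. indicator {-\<delta>..\<delta>} (0 + 1 / A k * t) * kern k (c k) (d k) (y k) (0 + 1 / A k * t))"
      using Ak by (intro lborel_integral_real_affine) simp
    also have "\<dots> = 1 / A k * (LBINT t. I k t)"
      using Ak by (simp add: I_def)
    finally show ?case using Ak by simp
  qed
  then show ?thesis using lim by (simp add: tendsto_cong)
qed

text \<open>Convergence along all bounded parameter sequences implies uniform convergence: at each
  \<open>k\<close> a violating triple is selected if there is one, and the admissible default
  \<open>(0, 0, 0)\<close> otherwise.\<close>

lemma kern_integral_uniform:
  assumes dec: "decay_bound \<delta> C N"
    and "\<eta> > 0"
  shows "\<forall>\<^sub>F k in sequentially. \<forall>c d y. \<bar>c\<bar> \<le> 1 \<longrightarrow> \<bar>d\<bar> \<le> 1 \<longrightarrow> \<bar>y\<bar> \<le> 1 \<longrightarrow>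
    \<bar>A k * (LBINT s. indicator {-\<delta>..\<delta>} s * kern k c d y s) - char_int\<bar> < \<eta>"
proof -
  define bad where "bad k = (\<lambda>(c, d, y). \<bar>c\<bar> \<le> 1 \<and> \<bar>d\<bar> \<le> 1 \<and> \<bar>y\<bar> \<le> 1 \<and>
    \<not> \<bar>A k * (LBINT s. indicator {-\<delta>..\<delta>} s * kern k c d y s) - char_int\<bar> < \<eta>)" for k
  define p where "p k = (if \<exists>x. bad k x then SOME x. bad k x else (0, 0, 0))" for k
  have p: "bad k (p k)" if "bad k x" for k x
  proof -
    have ex: "\<exists>x. bad k x" using that by blast
    then show ?thesis using someI_ex[OF ex] by (simp only: p_def if_True)
  qed
  have pb: "\<bar>fst (p k)\<bar> \<le> 1" "\<bar>fst (snd (p k))\<bar> \<le> 1" "\<bar>snd (snd (p k))\<bar> \<le> 1" for k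
  proof -
    have "\<bar>fst (p k)\<bar> \<le> 1 \<and> \<bar>fst (snd (p k))\<bar> \<le> 1 \<and> \<bar>snd (snd (p k))\<bar> \<le> 1"
    proof (cases "\<exists>x. bad k x")
      case True
      then have "bad k (p k)" using p by blast
      then show ?thesis by (cases "p k") (simp add: bad_def)
    next
      case False
      then have "p k = (0, 0, 0)" by (simp only: p_def if_False)
      then show ?thesis by simp
    qed
    then show "\<bar>fst (p k)\<bar> \<le> 1" "\<bar>fst (snd (p k))\<bar> \<le> 1" "\<bar>snd (snd (p k))\<bar> \<le> 1" by auto
  qed
  have "(\<lambda>k. A k * (LBINT s. indicator {-\<delta>..\<delta>} s * kern k (fst (p k)) (fst (snd (p k))) (snd (snd (p k))) s)) \<longlonglongrightarrow> char_int"
    by (rule kern_integral_tendsto[OF dec pb])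
  then have "\<forall>\<^sub>F k in sequentially. \<bar>A k * (LBINT s. indicator {-\<delta>..\<delta>} s * kern k (fst (p k)) (fst (snd (p k))) (snd (snd (p k))) s) - char_int\<bar> < \<eta>"
    using \<open>\<eta> > 0\<close> by (simp add: tendsto_iff dist_real_def)
  then show ?thesis
  proof eventually_elim
    case (elim k)
    then have "\<not> bad k (p k)" by (auto simp: bad_def split: prod.splits)
    then have "\<not> bad k x" for x using p by blast
    then show ?case by (auto simp: bad_def)
  qed
qed

definition dens0 :: real where "dens0 = char_int / (2 * versine_integral)"

text \<open>\<open>N\<close> is any law with the characteristic function of the \<open>k\<close>-th
  partial sum, which frees the estimate from a particular probability space. Division by
  \<open>b - a\<close> normalises the height to 1. The remainder \<open>r\<close> is multiplied only
  by a ratio that is invariant under rescaling of the window.\<close>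

definition trap_error :: "nat \<Rightarrow> real \<Rightarrow> real \<Rightarrow> bool" where
  "trap_error k \<eta> r \<longleftrightarrow> (\<forall>N a b y. real_distribution N \<longrightarrow> (\<forall>s. char N s = char \<nu> s ^ k) \<longrightarrow>
      0 \<le> a \<longrightarrow> a < b \<longrightarrow> b \<le> 1 \<longrightarrow> \<bar>y\<bar> \<le> 1 \<longrightarrow>
      \<bar>(\<integral>x. (trapezoid a b y x) / (b - a) \<partial>N) - (a + b) * dens0 / A k\<bar>
        \<le> (a + b) * \<eta> / A k + r * ((a + b) / (b - a)))"

text \<open>The remainder \<open>r\<close> does not depend on \<open>e\<close>, which allows
  summation over \<open>k\<close> before \<open>e\<close> tends to 0. The bound
  \<open>e \<le> 1/2\<close> leaves room for a slightly wider trapezoid with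
  \<open>b \<le> 1\<close>.\<close>

definition window_error :: "nat \<Rightarrow> real \<Rightarrow> real \<Rightarrow> bool" where
  "window_error k \<eta> r \<longleftrightarrow> (\<forall>N e y. real_distribution N \<longrightarrow> (\<forall>s. char N s = char \<nu> s ^ k) \<longrightarrow>
      0 < e \<longrightarrow> e \<le> 1/2 \<longrightarrow> \<bar>y\<bar> \<le> 1 \<longrightarrow>
      \<bar>measure N {y - e<..<y + e} - 2 * e * dens0 / A k\<bar> \<le> e * \<eta> / A k + r)"

text \<open>The trapezoid that is 1 on \<open>[y - a, y + a]\<close> and 0 outside \<open>(y - b, y + b)\<close> has mass \<open>a + b\<close>;
  its Fourier transform splits into \<open>\<bar>s\<bar> \<le> \<delta>\<close>, giving the main term, and the rest, where the
  Cramer condition gives exponential decay.\<close>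
lemma trapezoid_local_limit:
  obtains \<rho> where "0 < \<rho>" "\<rho> < 1"
    "\<And>\<eta>. \<eta> > 0 \<Longrightarrow> \<forall>\<^sub>F k in sequentially. trap_error k \<eta> (\<rho> ^ k)"
proof -
  obtain \<delta> C N where dec: "decay_bound \<delta> C N"
    using cmod_char_decay unfolding decay_bound_def by metis
  then have "\<delta> > 0" by (simp add: decay_bound_def)
  obtain \<rho> where \<rho>: "0 < \<rho>" "\<rho> < 1" "\<And>s. \<bar>s\<bar> \<ge> \<delta> \<Longrightarrow> w s \<le> \<rho>"
    using cramer_bound_away_from_0[OF cramer \<open>\<delta> > 0\<close>] by metis
  define J where "J = versine_integral"
  have J: "J > 0" using versine_integral_pos by (simp add: J_def)
  show ?thesis
  proof (rule that[OF \<rho>(1,2)])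
    fix \<eta> :: real assume "\<eta> > 0"
    \<comment> \<open>The main term carries the factor \<open>1 / (2 * J)\<close>, which this
      tolerance compensates.\<close>
    then have "2 * J * \<eta> > 0" using J by simp
    from kern_integral_uniform[OF dec this] eventually_ge_at_top[of 1]
    show "\<forall>\<^sub>F k in sequentially. trap_error k \<eta> (\<rho> ^ k)"
    proof (eventually_elim, unfold trap_error_def, intro allI impI)
      fix k :: nat and N and a b y :: real
      assume core: "\<forall>c d y. \<bar>c\<bar> \<le> 1 \<longrightarrow> \<bar>d\<bar> \<le> 1 \<longrightarrow> \<bar>y\<bar> \<le> 1 \<longrightarrow>
        \<bar>A k * (LBINT s. indicator {-\<delta>..\<delta>} s * kern k c d y s) - char_int\<bar> < 2 * J * \<eta>"
        and k: "1 \<le> k"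
        and N: "real_distribution N" and chN: "\<forall>s. char N s = char \<nu> s ^ k"
        and ab: "0 \<le> a" "a < b" "b \<le> 1" and y: "\<bar>y\<bar> \<le> 1"
      interpret N: real_distribution N by fact
      have Ak: "A k > 0" using k by (rule A_pos)
      define F where "F s = (cos (a * s) - cos (b * s)) / s\<^sup>2 * Re (iexp (- (s * y)) * char \<nu> s ^ k)" for s
      define c d where "c = (a + b) / 2" and "d = (b - a) / 2"
      define K where "K = (LBINT s. indicator {-\<delta>..\<delta>} s * kern k c d y s)"
      define R where "R = (LBINT s. indicator (- {-\<delta>..\<delta>}) s * F s)"
      have ReB: "\<bar>Re (iexp (- (s * y)) * char \<nu> s ^ k)\<bar> \<le> w s ^ k" for s
        using abs_Re_le_cmod[of "iexp (- (s * y)) * char \<nu> s ^ k"]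
        by (simp add: norm_mult norm_power)
      have w1: "w s ^ k \<le> 1" for s by (simp add: power_le_one cmod_char_le_1)
      have intF: "integrable lborel F"
      proof (rule Bochner_Integration.integrable_bound[OF integrable_cos_diff_kernel[of a b]])
        show "F \<in> borel_measurable lborel" unfolding F_def by measurable
        show "AE s in lborel. norm (F s) \<le> norm ((cos (a * s) - cos (b * s)) / s\<^sup>2)"
        proof (rule AE_I2)
          fix s
          show "norm (F s) \<le> norm ((cos (a * s) - cos (b * s)) / s\<^sup>2)"
            unfolding F_def norm_mult
            using order_trans[OF ReB[of s] w1[of s]] by (intro mult_left_le) auto
        qed
      qed
      have [measurable]: "F \<in> borel_measurable borel" using borel_measurable_integrable[OF intF] by simp
      have intI: "integrable lborel (\<lambda>s. indicator X s * F s)" if "X \<in> sets borel" for X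
        using that by (intro Bochner_Integration.integrable_bound[OF intF]) (auto split: split_indicator)
      have "J * (\<integral>x. trapezoid a b y x \<partial>N) = (LBINT s. F s)"
        unfolding J_def F_def using N.expectation_trapezoid[of a b y] ab chN by simp
      also have "\<dots> = (LBINT s. indicator {-\<delta>..\<delta>} s * F s + indicator (- {-\<delta>..\<delta>}) s * F s)"
        by (intro Bochner_Integration.integral_cong refl) (auto split: split_indicator)
      also have "\<dots> = (LBINT s. indicator {-\<delta>..\<delta>} s * F s) + R"
        unfolding R_def by (intro Bochner_Integration.integral_add intI) auto
      also have "(LBINT s. indicator {-\<delta>..\<delta>} s * F s) = (LBINT s. (b\<^sup>2 - a\<^sup>2) / 2 * (indicator {-\<delta>..\<delta>} s * kern k c d y s))"
      proof (rule integral_cong_AE)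
        show "AE s in lborel. indicator {-\<delta>..\<delta>} s * F s = (b\<^sup>2 - a\<^sup>2) / 2 * (indicator {-\<delta>..\<delta>} s * kern k c d y s)"
          using AE_lborel_singleton[of 0]
        proof eventually_elim
          case (elim s)
          then have "F s = (b\<^sup>2 - a\<^sup>2) / 2 * kern k c d y s"
            unfolding F_def kern_def c_def d_def by (subst cos_diff_kernel_eq_sine_ratio) (auto simp: mult.assoc)
          then show ?case by simp
        qed
      qed measurable
      also have "\<dots> = (b\<^sup>2 - a\<^sup>2) / 2 * K" by (simp add: K_def)
      also have "b\<^sup>2 - a\<^sup>2 = (a + b) * (b - a)" by (simp add: power2_eq_square algebra_simps)
      finally have main: "J * (\<integral>x. trapezoid a b y x \<partial>N) = (a + b) * (b - a) / 2 * K + R" .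
      \<comment> \<open>Away from the origin the kernel is dominated by two versine kernels of total
        integral \<open>(a + b) * J\<close>. This bound has no factor \<open>b - a\<close>, so
        normalising the height costs \<open>1 / (b - a)\<close>.\<close>
      have "\<bar>R\<bar> \<le> (LBINT s. \<bar>indicator (- {-\<delta>..\<delta>}) s * F s\<bar>)"
        unfolding R_def by (rule integral_abs_bound)
      also have "\<dots> \<le> (LBINT s. \<rho> ^ k * ((1 - cos (a * s)) / s\<^sup>2 + (1 - cos (b * s)) / s\<^sup>2))"
      proof (rule integral_mono)
        show "integrable lborel (\<lambda>s. \<bar>indicator (- {-\<delta>..\<delta>}) s * F s\<bar>)"
          by (intro integrable_abs intI) auto
        show "integrable lborel (\<lambda>s. \<rho> ^ k * ((1 - cos (a * s)) / s\<^sup>2 + (1 - cos (b * s)) / s\<^sup>2))"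
          using integrable_versine by simp
        fix s :: real
        have nn: "0 \<le> (1 - cos (a * s)) / s\<^sup>2" "0 \<le> (1 - cos (b * s)) / s\<^sup>2" by simp_all
        show "\<bar>indicator (- {-\<delta>..\<delta>}) s * F s\<bar> \<le> \<rho> ^ k * ((1 - cos (a * s)) / s\<^sup>2 + (1 - cos (b * s)) / s\<^sup>2)"
        proof (cases "s \<in> {-\<delta>..\<delta>}")
          case True
          then show ?thesis using nn \<rho> by simp
        next
          case False
          then have "w s \<le> \<rho>" by (intro \<rho>(3)) auto
          then have "w s ^ k \<le> \<rho> ^ k" by (intro power_mono) auto
          then have 1: "\<bar>Re (iexp (- (s * y)) * char \<nu> s ^ k)\<bar> \<le> \<rho> ^ k" using ReB[of s] by simp
          have "(cos (a * s) - cos (b * s)) / s\<^sup>2 = (1 - cos (b * s)) / s\<^sup>2 - (1 - cos (a * s)) / s\<^sup>2"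
            by (simp add: diff_divide_distrib)
          then have 2: "\<bar>(cos (a * s) - cos (b * s)) / s\<^sup>2\<bar> \<le> (1 - cos (a * s)) / s\<^sup>2 + (1 - cos (b * s)) / s\<^sup>2"
            using nn by linarith
          have "\<bar>F s\<bar> \<le> ((1 - cos (a * s)) / s\<^sup>2 + (1 - cos (b * s)) / s\<^sup>2) * \<rho> ^ k"
            unfolding F_def abs_mult by (rule mult_mono[OF 2 1]) (use nn in auto)
          then show ?thesis using False by (simp add: mult.commute)
        qed
      qed
      also have "\<dots> = \<rho> ^ k * (\<bar>a\<bar> * J + \<bar>b\<bar> * J)"
        unfolding integral_mult_right_zero J_def integral_versine[symmetric]
        by (subst Bochner_Integration.integral_add[OF integrable_versine integrable_versine]) simp
      also have "\<dots> = \<rho> ^ k * ((a + b) * J)"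
        using ab by (simp add: distrib_right)
      finally have R: "\<bar>R\<bar> \<le> \<rho> ^ k * ((a + b) * J)" .
      have "\<bar>A k * K - char_int\<bar> < 2 * J * \<eta>"
        unfolding K_def using core ab y by (simp add: c_def d_def)
      then have K: "\<bar>K - char_int / A k\<bar> \<le> 2 * J * \<eta> / A k"
      proof -
        assume a: "\<bar>A k * K - char_int\<bar> < 2 * J * \<eta>"
        have "K - char_int / A k = (A k * K - char_int) / A k" using Ak by (simp add: field_simps)
        then have "\<bar>K - char_int / A k\<bar> = \<bar>A k * K - char_int\<bar> / A k" using Ak by simp
        also have "\<dots> \<le> 2 * J * \<eta> / A k" using a Ak by (intro divide_right_mono) auto
        finally show ?thesis .
      qed
      have "(\<integral>x. (trapezoid a b y x) / (b - a) \<partial>N) = (\<integral>x. trapezoid a b y x \<partial>N) / (b - a)"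
        by simp
      also have "\<dots> = ((a + b) * (b - a) / 2 * K + R) / (J * (b - a))"
        unfolding main[symmetric] using J by simp
      also have "\<dots> = (a + b) / (2 * J) * K + R / (J * (b - a))"
        using J ab by (simp add: field_simps)
      finally have E: "(\<integral>x. (trapezoid a b y x) / (b - a) \<partial>N) - (a + b) * dens0 / A k
         = (a + b) / (2 * J) * (K - char_int / A k) + R / (J * (b - a))"
        using J Ak by (simp add: dens0_def J_def[symmetric] right_diff_distrib)
      have "\<bar>(a + b) / (2 * J) * (K - char_int / A k)\<bar> \<le> (a + b) / (2 * J) * (2 * J * \<eta> / A k)"
        unfolding abs_mult using K J ab by (intro mult_mono) auto
      also have "\<dots> = (a + b) * \<eta> / A k" using J by simp
      finally have 1: "\<bar>(a + b) / (2 * J) * (K - char_int / A k)\<bar> \<le> (a + b) * \<eta> / A k" .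
      have "\<bar>R / (J * (b - a))\<bar> = \<bar>R\<bar> / (J * (b - a))" using J ab by (simp add: abs_mult)
      also have "\<dots> \<le> \<rho> ^ k * ((a + b) * J) / (J * (b - a))"
        using J ab R by (intro divide_right_mono) auto
      also have "\<dots> = \<rho> ^ k * ((a + b) / (b - a))" using J by simp
      finally have 2: "\<bar>R / (J * (b - a))\<bar> \<le> \<rho> ^ k * ((a + b) / (b - a))" .
      show "\<bar>(\<integral>x. (trapezoid a b y x) / (b - a) \<partial>N) - (a + b) * dens0 / A k\<bar>
        \<le> (a + b) * \<eta> / A k + \<rho> ^ k * ((a + b) / (b - a))"
        unfolding E using order_trans[OF abs_triangle_ineq add_mono[OF 1 2]] .
    qed
  qed
qed

text \<open>The indicator lies between the trapezoids with parameters
  \<open>((1 - \<theta>) * e, e)\<close> and \<open>(e, (1 + \<theta>) * e)\<close>. Their ratios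
  \<open>(a + b) / (b - a)\<close> are at most \<open>3 / \<theta>\<close> for every
  \<open>e\<close>, and their masses differ from \<open>2 * e\<close> only by
  \<open>\<theta> * e\<close>, which \<open>\<eta>\<close> absorbs.\<close>

lemma window_local_limit:
  obtains \<rho> where "0 < \<rho>" "\<rho> < 1"
    "\<And>\<eta>. \<eta> > 0 \<Longrightarrow> \<exists>C\<ge>0. \<forall>\<^sub>F k in sequentially. window_error k \<eta> (C * \<rho> ^ k)"
proof -
  obtain \<rho> where \<rho>: "0 < \<rho>" "\<rho> < 1" and trap:
    "\<And>\<eta>. \<eta> > 0 \<Longrightarrow> \<forall>\<^sub>F k in sequentially. trap_error k \<eta> (\<rho> ^ k)"
    using trapezoid_local_limit by blast
  show ?thesis
  proof (rule that[OF \<rho>])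
    fix \<eta> :: real assume "\<eta> > 0"
    \<comment> \<open>\<open>\<theta>\<close> is chosen so small that the excess mass costs at most
      half of \<open>\<eta>\<close>; the added 1 avoids a zero denominator.\<close>
    define q where "q = \<bar>dens0\<bar> + 1"
    have q: "q > 0" by (simp add: q_def)
    define \<theta> where "\<theta> = min (1/2) (\<eta> / (2 * q))"
    have "\<theta> > 0" using \<open>\<eta> > 0\<close> q by (simp add: \<theta>_def)
    moreover have "\<theta> \<le> 1/2" unfolding \<theta>_def by (rule min.cobounded1)
    ultimately have \<theta>: "\<theta> > 0" "\<theta> \<le> 1/2" .
    have "\<theta> * q \<le> \<eta> / (2 * q) * q"
      using q by (intro mult_right_mono) (auto simp: \<theta>_def)
    also have "\<dots> = \<eta> / 2" using q by simp
    finally have \<theta>d: "\<theta> * \<bar>dens0\<bar> \<le> \<eta> / 2" using \<theta> by (simp add: q_def distrib_left)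
    \<comment> \<open>The factors \<open>2 + \<theta>\<close> and \<open>2 - \<theta>\<close> are at
      most 4, so precision \<open>\<eta> / 8\<close> uses at most the other half.\<close>
    have "\<eta> / 8 > 0" using \<open>\<eta> > 0\<close> by simp
    from trap[OF this] eventually_ge_at_top[of 1]
    have "\<forall>\<^sub>F k in sequentially. window_error k \<eta> (3 / \<theta> * \<rho> ^ k)"
    proof (eventually_elim, unfold window_error_def, intro allI impI)
      fix k :: nat and N and e y :: real
      assume T: "trap_error k (\<eta> / 8) (\<rho> ^ k)"
        and k: "1 \<le> k" and N: "real_distribution N" and chN: "\<forall>s. char N s = char \<nu> s ^ k"
        and e: "0 < e" "e \<le> 1/2" and y: "\<bar>y\<bar> \<le> 1"
      interpret N: real_distribution N by fact
      have Ak: "A k > 0" using k by (rule A_pos)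
      define I where "I a b = (\<integral>x. (trapezoid a b y x) / (b - a) \<partial>N)" for a b
      have trap01: "0 \<le> (trapezoid a b y x) / (b - a)"
          "(trapezoid a b y x) / (b - a) \<le> 1" if "a < b" for a b x
        using that by (auto simp: max_def field_simps)
      have int: "integrable N (\<lambda>x. (trapezoid a b y x) / (b - a))" if "a < b" for a b
      proof (rule N.integrable_const_bound[where B = 1])
        show "AE x in N. norm ((trapezoid a b y x) / (b - a)) \<le> 1"
          using trap01[OF that] by (simp only: real_norm_def abs_of_nonneg AE_I2)
      qed simp
      have meas: "measure N {y - e<..<y + e} = (\<integral>x. indicator {y - e<..<y + e} x \<partial>N)" by simp
      have indint: "integrable N (indicator {y - e<..<y + e} :: real \<Rightarrow> real)"
        by (rule N.integrable_const_bound[where B = 1]) (auto simp: indicator_def)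
      have up: "measure N {y - e<..<y + e} \<le> I e ((1 + \<theta>) * e)"
        unfolding meas I_def
      proof (rule integral_mono)
        show "integrable N (\<lambda>x. (trapezoid e ((1 + \<theta>) * e) y x) / ((1 + \<theta>) * e - e))"
          using e \<theta> by (intro int) simp
        fix x
        show "indicator {y - e<..<y + e} x \<le> (trapezoid e ((1 + \<theta>) * e) y x) / ((1 + \<theta>) * e - e)"
        proof (cases "x \<in> {y - e<..<y + e}")
          case True
          then have "\<bar>x - y\<bar> < e" by auto
          moreover have "e < (1 + \<theta>) * e" using e \<theta> by simp
          ultimately show ?thesis using True by (simp add: max_def)
        next
          case False
          then show ?thesis using trap01(1)[of e "(1 + \<theta>) * e" x] e \<theta> by simp
        qed
      qed (rule indint)
      have lo: "I ((1 - \<theta>) * e) e \<le> measure N {y - e<..<y + e}"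
        unfolding meas I_def
      proof (rule integral_mono)
        have lt: "(1 - \<theta>) * e < e" using e \<theta> by simp
        then show "integrable N (\<lambda>x. (trapezoid ((1 - \<theta>) * e) e y x) / (e - (1 - \<theta>) * e))"
          by (intro int)
        fix x
        show "(trapezoid ((1 - \<theta>) * e) e y x) / (e - (1 - \<theta>) * e) \<le> indicator {y - e<..<y + e} x"
        proof (cases "x \<in> {y - e<..<y + e}")
          case True
          then show ?thesis using trap01(2)[OF lt, of x] by simp
        next
          case False
          then have "e \<le> \<bar>x - y\<bar>" by auto
          then show ?thesis using lt by (simp add: max_def)
        qed
      qed (rule indint)
      have frac: "(2 + \<theta>) / \<theta> \<le> 3 / \<theta>" "(2 - \<theta>) / \<theta> \<le> 3 / \<theta>"
        using \<theta> by (auto intro!: divide_right_mono)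
      have sum3: "(2 + \<theta>) * e * (\<eta> / 8) / A k \<le> e * \<eta> / 2 / A k" "(2 - \<theta>) * e * (\<eta> / 8) / A k \<le> e * \<eta> / 2 / A k"
      proof -
        have "(2 + \<theta>) * (e * \<eta>) \<le> 4 * (e * \<eta>)" "(2 - \<theta>) * (e * \<eta>) \<le> 4 * (e * \<eta>)"
          using \<theta> e \<open>\<eta> > 0\<close> by (auto intro!: mult_right_mono)
        then have "((2 + \<theta>) * (e * \<eta>)) / 8 \<le> (e * \<eta>) / 2" "((2 - \<theta>) * (e * \<eta>)) / 8 \<le> (e * \<eta>) / 2"
          by linarith+
        then have "(2 + \<theta>) * e * (\<eta> / 8) \<le> e * \<eta> / 2" "(2 - \<theta>) * e * (\<eta> / 8) \<le> e * \<eta> / 2"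
          by (simp_all only: mult.assoc times_divide_eq_right)
        then show "(2 + \<theta>) * e * (\<eta> / 8) / A k \<le> e * \<eta> / 2 / A k" "(2 - \<theta>) * e * (\<eta> / 8) / A k \<le> e * \<eta> / 2 / A k"
          using Ak by (intro divide_right_mono, simp, simp)+
      qed
      have D: "\<theta> * e * \<bar>dens0\<bar> / A k \<le> e * \<eta> / 2 / A k"
        using mult_left_mono[OF \<theta>d, of e] e Ak by (intro divide_right_mono) (auto simp: algebra_simps)
      have dens_abs: "\<bar>\<theta> * e * dens0 / A k\<bar> = \<theta> * e * \<bar>dens0\<bar> / A k"
        using \<theta> e Ak by (simp add: abs_mult)
      have hh: "e * \<eta> / 2 / A k + e * \<eta> / 2 / A k = e * \<eta> / A k" by simp
      have arith1: "p - x \<le> s + c" if "p \<le> i" "\<bar>i - (x + z)\<bar> \<le> a + b" "b \<le> c" "a \<le> h" "d \<le> h" "\<bar>z\<bar> = d" "h + h = s"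
        for p i x z a b c h d s :: real using that by linarith
      have arith2: "x - p \<le> s + c" if "i \<le> p" "\<bar>i - (x - z)\<bar> \<le> a + b" "b \<le> c" "a \<le> h" "d \<le> h" "\<bar>z\<bar> = d" "h + h = s"
        for p i x z a b c h d s :: real using that by linarith
      have abs_diff_le_both: "\<bar>p - x\<bar> \<le> s" if "p - x \<le> s" "x - p \<le> s" for p x s :: real
        using that by linarith
      have \<rho>k: "0 < \<rho> ^ k" using \<rho> by simp
      have "(1 + \<theta>) * e \<le> 3/2 * (1/2)" using \<theta> e by (intro mult_mono) auto
      then have le1: "(1 + \<theta>) * e \<le> 1" by simp
      have 1: "\<bar>I e ((1 + \<theta>) * e) - (e + (1 + \<theta>) * e) * dens0 / A k\<bar>
          \<le> (e + (1 + \<theta>) * e) * (\<eta> / 8) / A k + \<rho> ^ k * ((e + (1 + \<theta>) * e) / ((1 + \<theta>) * e - e))"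
        unfolding I_def by (intro T[unfolded trap_error_def, rule_format]) (use N chN e \<theta> y le1 in auto)
      have 11: "e + (1 + \<theta>) * e = (2 + \<theta>) * e" "(1 + \<theta>) * e - e = \<theta> * e" by (auto simp: algebra_simps)
      have 12: "(2 + \<theta>) * e / (\<theta> * e) = (2 + \<theta>) / \<theta>" using e by simp
      have 13: "\<rho> ^ k * ((2 + \<theta>) / \<theta>) \<le> 3 / \<theta> * \<rho> ^ k"
        using mult_left_mono[OF frac(1), of "\<rho> ^ k"] \<rho>k by (simp add: mult.commute)
      have 14: "(2 + \<theta>) * e * dens0 / A k = 2 * e * dens0 / A k + \<theta> * e * dens0 / A k"
        by (simp add: distrib_right add_divide_distrib)
      have "measure N {y - e<..<y + e} - 2 * e * dens0 / A k \<le> e * \<eta> / A k + 3 / \<theta> * \<rho> ^ k"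
        by (rule arith1[OF up 1[unfolded 11 12 14] 13 sum3(1) D dens_abs hh])
      moreover have 2: "\<bar>I ((1 - \<theta>) * e) e - ((1 - \<theta>) * e + e) * dens0 / A k\<bar>
          \<le> ((1 - \<theta>) * e + e) * (\<eta> / 8) / A k + \<rho> ^ k * (((1 - \<theta>) * e + e) / (e - (1 - \<theta>) * e))"
        unfolding I_def by (intro T[unfolded trap_error_def, rule_format]) (use N chN e \<theta> y in auto)
      have 21: "(1 - \<theta>) * e + e = (2 - \<theta>) * e" "e - (1 - \<theta>) * e = \<theta> * e" by (auto simp: algebra_simps)
      have 22: "(2 - \<theta>) * e / (\<theta> * e) = (2 - \<theta>) / \<theta>" using e by simp
      have 23: "\<rho> ^ k * ((2 - \<theta>) / \<theta>) \<le> 3 / \<theta> * \<rho> ^ k"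
        using mult_left_mono[OF frac(2), of "\<rho> ^ k"] \<rho>k by (simp add: mult.commute)
      have 24: "(2 - \<theta>) * e * dens0 / A k = 2 * e * dens0 / A k - \<theta> * e * dens0 / A k"
        by (simp add: left_diff_distrib diff_divide_distrib)
      have "2 * e * dens0 / A k - measure N {y - e<..<y + e} \<le> e * \<eta> / A k + 3 / \<theta> * \<rho> ^ k"
        by (rule arith2[OF lo 2[unfolded 21 22 24] 23 sum3(2) D dens_abs hh])
      ultimately show "\<bar>measure N {y - e<..<y + e} - 2 * e * dens0 / A k\<bar> \<le> e * \<eta> / A k + 3 / \<theta> * \<rho> ^ k"
        by (rule abs_diff_le_both)
    qed
    then show "\<exists>C\<ge>0. \<forall>\<^sub>F k in sequentially. window_error k \<eta> (C * \<rho> ^ k)"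
      using \<theta> by (intro exI[of _ "3 / \<theta>"]) auto
  qed
qed

end

section \<open>The density of the limit law at the origin\<close>

lemma integrable_exp_minus_abs:
  assumes "\<sigma> > 0"
  shows "integrable lborel (\<lambda>t::real. exp (- (\<sigma> * \<bar>t\<bar>)))"
proof (rule Bochner_Integration.integrable_bound)
  let ?B = "2 + (1 + 256 / \<sigma> ^ 4)"
  show "integrable lborel (\<lambda>t::real. ?B * inverse (1 + t\<^sup>2))"
    using integrable_inverse_1_plus_square_lborel by simp
  show "AE t in lborel. norm (exp (- (\<sigma> * \<bar>t\<bar>))) \<le> norm (?B * inverse (1 + t\<^sup>2))"
  proof (rule AE_I2)
    fix t :: real
    have pos: "0 < 1 + t\<^sup>2" by (intro add_pos_nonneg) auto
    have B: "0 \<le> 256 / \<sigma> ^ 4" by simp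
    have "exp (- (\<sigma> * \<bar>t\<bar>)) \<le> ?B * inverse (1 + t\<^sup>2)"
    proof (cases "\<bar>t\<bar> \<le> 1")
      case True
      have "exp (- (\<sigma> * \<bar>t\<bar>)) \<le> 1" using assms by simp
      also have "1 \<le> 2 * inverse (1 + t\<^sup>2)"
        using True pos by (simp add: field_simps abs_square_le_1)
      also have "\<dots> \<le> ?B * inverse (1 + t\<^sup>2)" using B pos by (intro mult_right_mono) auto
      finally show ?thesis .
    next
      case False
      then have "1 * \<bar>t\<bar> \<le> \<bar>t\<bar> * \<bar>t\<bar>" by (intro mult_right_mono) auto
      then have "sqrt \<bar>t\<bar> \<le> \<bar>t\<bar>" by (intro real_le_lsqrt) (auto simp: power2_eq_square)
      then have "exp (- (\<sigma> * \<bar>t\<bar>)) \<le> exp (- (\<sigma> * sqrt \<bar>t\<bar>))" using assms by simp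
      also have "\<dots> \<le> (1 + 256 / \<sigma> ^ 4) * inverse (1 + t\<^sup>2)" by (rule sub_exponential_le) fact
      also have "\<dots> \<le> ?B * inverse (1 + t\<^sup>2)" using B pos by (intro mult_right_mono) auto
      finally show ?thesis .
    qed
    then show "norm (exp (- (\<sigma> * \<bar>t\<bar>))) \<le> norm (?B * inverse (1 + t\<^sup>2))"
      using pos B by simp
  qed
qed simp

lemma has_real_derivative_mult_abs: "((\<lambda>v::real. v * \<bar>v\<bar>) has_real_derivative 2 * \<bar>v\<bar>) (at v)"
proof -
  consider "v > 0" | "v < 0" | "v = 0" by linarith
  then show ?thesis
  proof cases
    case 1
    have "((\<lambda>v::real. v * v) has_real_derivative 2 * \<bar>v\<bar>) (at v)"
      using 1 by (auto intro!: derivative_eq_intros)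
    then show ?thesis
      by (rule has_field_derivative_transform_within_open[where S = "{0<..}"]) (use 1 in auto)
  next
    case 2
    have "((\<lambda>v::real. - (v * v)) has_real_derivative 2 * \<bar>v\<bar>) (at v)"
      using 2 by (auto intro!: derivative_eq_intros)
    then show ?thesis
      by (rule has_field_derivative_transform_within_open[where S = "{..<0}"]) (use 2 in auto)
  next
    case 3
    have "((\<lambda>h::real. \<bar>h\<bar>) \<longlongrightarrow> \<bar>0\<bar>) (at 0)" by (intro tendsto_intros)
    moreover have "\<forall>\<^sub>F h::real in at 0. \<bar>h\<bar> = (h * \<bar>h\<bar>) / h"
      by (auto simp: eventually_at_filter)
    ultimately have "((\<lambda>h::real. (h * \<bar>h\<bar>) / h) \<longlongrightarrow> 0) (at 0)"
      by (simp add: tendsto_cong)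
    then show ?thesis using 3 by (simp add: DERIV_def)
  qed
qed

text \<open>The trapezoid with \<open>a = 1\<close>, \<open>b = 2\<close>, \<open>y = 0\<close>, to
  which the shrinking ones are rescaled.\<close>

definition trap :: "real \<Rightarrow> real" where "trap u = max 2 \<bar>u\<bar> - max 1 \<bar>u\<bar>"

lemma trap_eq_0: "2 \<le> \<bar>u\<bar> \<Longrightarrow> trap u = 0" by (simp add: trap_def)

lemma trap_bounds: "0 \<le> trap u" "trap u \<le> 1" by (auto simp: trap_def max_def)

lemma trap_measurable[measurable]: "trap \<in> borel_measurable borel"
  unfolding trap_def by measurable

lemma integral_trap: "(LBINT u. trap u) = 3"
proof -
  \<comment> \<open>An antiderivative of \<open>trap\<close>, built from
    \<open>max c |u| = (|c + u| + |c - u|) / 2\<close> and the antiderivative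
    \<open>v * |v| / 2\<close> of \<open>|v|\<close>.\<close>
  define F where "F u = ((2 + u) * \<bar>2 + u\<bar> - (2 - u) * \<bar>2 - u\<bar> - (1 + u) * \<bar>1 + u\<bar> + (1 - u) * \<bar>1 - u\<bar>) / 4" for u :: real
  have comp: "((\<lambda>u. (c + d * u) * \<bar>c + d * u\<bar>) has_real_derivative 2 * \<bar>c + d * u\<bar> * d) (at u)" for c d u :: real
    by (rule DERIV_chain2[where f = "\<lambda>v. v * \<bar>v\<bar>", OF has_real_derivative_mult_abs]) (auto intro!: derivative_eq_intros)
  have dF: "(F has_real_derivative trap u) (at u)" for u
  proof -
    have "(F has_real_derivative (2 * \<bar>2 + u\<bar> - - (2 * \<bar>2 - u\<bar>) - 2 * \<bar>1 + u\<bar> + - (2 * \<bar>1 - u\<bar>)) / 4) (at u)"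
      unfolding F_def
      using comp[of 2 1 u] comp[of 2 "-1" u] comp[of 1 1 u] comp[of 1 "-1" u]
      by (intro DERIV_cdivide DERIV_add DERIV_diff) simp_all
    moreover have "(2 * \<bar>2 + u\<bar> - - (2 * \<bar>2 - u\<bar>) - 2 * \<bar>1 + u\<bar> + - (2 * \<bar>1 - u\<bar>)) / 4 = trap u"
      by (auto simp: trap_def max_def abs_if)
    ultimately show ?thesis by simp
  qed
  have "(LBINT u. trap u * indicator {-2..2} u) = F 2 - F (-2)"
  proof (rule integral_FTC_Icc_real)
    show "(F has_real_derivative trap u) (at u)" for u by (rule dF)
    show "isCont trap u" for u unfolding trap_def by (intro continuous_intros)
  qed simp
  also have "\<dots> = 3" by (simp add: F_def)
  also have "(\<lambda>u. trap u * indicator {-2..2} u) = trap"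
    by (rule ext) (use trap_eq_0 in \<open>auto split: split_indicator\<close>)
  finally show ?thesis by simp
qed

text \<open>Fourier inversion at one point. The mean of a trapezoid shrinking to 0 is computed both
  from the density and from the kernel; the common factor \<open>h^2\<close> cancels before the
  limit. Using the kernel of the local limit theorem gives exactly the expression defining
  \<open>dens0\<close>.\<close>

lemma density_at_0_eq_char_integral:
  fixes f :: "real \<Rightarrow> real"
  assumes mu: "real_distribution \<mu>" and dens: "\<mu> = density lborel f"
    and f0: "\<And>x. f x \<ge> 0" and cont: "continuous_on UNIV f"
    and chm: "\<And>t. cmod (char \<mu> t) = exp (- (\<sigma> * \<bar>t\<bar>))" and "\<sigma> > 0"
  shows "f 0 = (LBINT t. Re (char \<mu> t)) / (2 * versine_integral)"
proof -
  interpret real_distribution \<mu> by fact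
  have [measurable]: "f \<in> borel_measurable borel"
    using cont by (rule borel_measurable_continuous_onI)
  have isC: "isCont f x" for x using cont by (simp add: continuous_on_eq_continuous_at)
  define h where "h n = 1 / real (Suc n)" for n
  have h: "h n > 0" "h n \<le> 1" for n by (auto simp: h_def)
  have hlim: "h \<longlonglongrightarrow> 0" unfolding h_def by (rule LIMSEQ_Suc[OF lim_1_over_n])
  define F where "F n s = sine_ratio (3 / 2 * h n * s) * sine_ratio (h n / 2 * s) * Re (char \<mu> s)" for n s
  have Fm[measurable]: "F n \<in> borel_measurable borel" for n unfolding F_def by measurable
  obtain B where B: "\<And>x. x \<in> {-2..2} \<Longrightarrow> \<bar>f x\<bar> \<le> B"
    using compact_imp_bounded[OF compact_continuous_image[OF continuous_on_subset[OF cont subset_UNIV] compact_Icc[of "-2::real" 2]]]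
    unfolding bounded_iff by (metis imageI real_norm_def)
  have B0: "B \<ge> 0" using B[of 0] by auto
  have 1: "(\<integral>x. trapezoid (h n) (2 * h n) 0 x \<partial>\<mu>) = (h n)\<^sup>2 * (LBINT u. trap u * f (h n * u))" for n
  proof -
    have "(\<integral>x. trapezoid (h n) (2 * h n) 0 x \<partial>\<mu>) = (LBINT x. f x * (max (2 * h n) \<bar>x\<bar> - max (h n) \<bar>x\<bar>))"
      unfolding dens by (subst integral_real_density) (auto simp: f0)
    also have "\<dots> = \<bar>h n\<bar> *\<^sub>R (LBINT u. f (0 + h n * u) * (max (2 * h n) \<bar>0 + h n * u\<bar> - max (h n) \<bar>0 + h n * u\<bar>))"
      using h[of n] by (intro lborel_integral_real_affine) auto
    also have "\<dots> = h n * (LBINT u. h n * (trap u * f (h n * u)))"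
    proof -
      have "max (2 * h n) \<bar>h n * u\<bar> = h n * max 2 \<bar>u\<bar>" "max (h n) \<bar>h n * u\<bar> = h n * max 1 \<bar>u\<bar>" for u
        using h[of n] by (auto simp: max_def abs_mult)
      then have "f (0 + h n * u) * (max (2 * h n) \<bar>0 + h n * u\<bar> - max (h n) \<bar>0 + h n * u\<bar>) = h n * (trap u * f (h n * u))" for u
        by (simp add: trap_def algebra_simps)
      then show ?thesis using h[of n] by (simp only: real_scaleR_def abs_of_pos)
    qed
    also have "\<dots> = (h n)\<^sup>2 * (LBINT u. trap u * f (h n * u))"
      by (simp add: power2_eq_square)
    finally show ?thesis .
  qed
  have 2: "versine_integral * (\<integral>x. trapezoid (h n) (2 * h n) 0 x \<partial>\<mu>) =
     (h n)\<^sup>2 * (3 / 2 * (LBINT s. F n s))" for n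
  proof -
    have "versine_integral * (\<integral>x. trapezoid (h n) (2 * h n) 0 x \<partial>\<mu>) =
      (LBINT s. (cos (h n * s) - cos (2 * h n * s)) / s\<^sup>2 * Re (iexp (- (s * 0)) * char \<mu> s))"
      using h[of n] by (intro expectation_trapezoid) auto
    also have "\<dots> = (LBINT s. ((h n)\<^sup>2 * (3 / 2)) * (F n s))"
    proof (rule integral_cong_AE)
      show "AE s in lborel. (cos (h n * s) - cos (2 * h n * s)) / s\<^sup>2 * Re (iexp (- (s * 0)) * char \<mu> s) =
         ((h n)\<^sup>2 * (3 / 2)) * (F n s)"
        using AE_lborel_singleton[of 0]
      proof eventually_elim
        case (elim s)
        have calc: "((2 * h n)\<^sup>2 - (h n)\<^sup>2) / 2 = (h n)\<^sup>2 * (3 / 2)" by (simp add: power2_eq_square)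
        have calc2: "(h n + 2 * h n) / 2 = 3 / 2 * h n" "(2 * h n - h n) / 2 = h n / 2" by simp_all
        show ?case
          unfolding cos_diff_kernel_eq_sine_ratio[OF elim, of "h n" "2 * h n"] calc calc2 F_def by simp
      qed
    qed measurable
    finally show ?thesis by simp
  qed
  have "(\<lambda>n. \<integral>u. trap u * f (h n * u) \<partial>lborel) \<longlonglongrightarrow> (LBINT u. trap u * f 0)"
  proof (rule integral_dominated_convergence[where w = "\<lambda>u. B * indicator {-2..2} u"])
    show "AE u in lborel. (\<lambda>n. trap u * f (h n * u)) \<longlonglongrightarrow> trap u * f 0"
    proof (rule AE_I2)
      fix u
      have "(\<lambda>n. h n * u) \<longlonglongrightarrow> 0 * u" by (intro tendsto_intros hlim)
      then have "(\<lambda>n. f (h n * u)) \<longlonglongrightarrow> f 0"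
        using isCont_tendsto_compose[OF isC[of 0]] by simp
      then show "(\<lambda>n. trap u * f (h n * u)) \<longlonglongrightarrow> trap u * f 0" by (intro tendsto_intros)
    qed
    fix n
    show "AE u in lborel. norm (trap u * f (h n * u)) \<le> B * indicator {-2..2} u"
    proof (rule AE_I2)
      fix u :: real
      show "norm (trap u * f (h n * u)) \<le> B * indicator {-2..2} u"
      proof (cases "\<bar>u\<bar> \<le> 2")
        case True
        have "\<bar>h n * u\<bar> \<le> 1 * 2" unfolding abs_mult using h[of n] True by (intro mult_mono) auto
        then have "\<bar>f (h n * u)\<bar> \<le> B" by (intro B) auto
        then have "\<bar>trap u\<bar> * \<bar>f (h n * u)\<bar> \<le> 1 * B" using trap_bounds[of u] by (intro mult_mono) auto
        then show ?thesis using True by (simp add: abs_mult abs_le_iff)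
      next
        case False
        then show ?thesis using trap_eq_0[of u] B0 by simp
      qed
    qed
  qed auto
  then have L1: "(\<lambda>n. \<integral>u. trap u * f (h n * u) \<partial>lborel) \<longlonglongrightarrow> 3 * f 0"
    by (simp add: integral_trap)
  have L2: "(\<lambda>n. \<integral>s. F n s \<partial>lborel)
      \<longlonglongrightarrow> (LBINT s. Re (char \<mu> s))"
  proof (rule integral_dominated_convergence[where w = "\<lambda>t. exp (- (\<sigma> * \<bar>t\<bar>))"])
    show "AE s in lborel. (\<lambda>n. F n s) \<longlonglongrightarrow> Re (char \<mu> s)"
    proof (rule AE_I2)
      fix s
      have "(\<lambda>n. 3 / 2 * h n * s) \<longlonglongrightarrow> 3 / 2 * 0 * s" "(\<lambda>n. h n / 2 * s) \<longlonglongrightarrow> 0 / 2 * s"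
        by (intro tendsto_intros hlim; simp)+
      then have "(\<lambda>n. F n s) \<longlonglongrightarrow> 1 * 1 * Re (char \<mu> s)"
        unfolding F_def by (intro tendsto_mult tendsto_const tendsto_sine_ratio_0) simp_all
      then show "(\<lambda>n. F n s) \<longlonglongrightarrow> Re (char \<mu> s)" by simp
    qed
    fix n
    show "AE s in lborel. norm (F n s) \<le> exp (- (\<sigma> * \<bar>s\<bar>))"
    proof (rule AE_I2)
      fix s
      have "\<bar>sine_ratio (3 / 2 * h n * s)\<bar> * \<bar>sine_ratio (h n / 2 * s)\<bar> * \<bar>Re (char \<mu> s)\<bar> \<le> 1 * 1 * cmod (char \<mu> s)"
        by (intro mult_mono abs_sine_ratio_le_1 abs_Re_le_cmod) auto
      then show "norm (F n s) \<le> exp (- (\<sigma> * \<bar>s\<bar>))"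
        by (simp add: F_def abs_mult chm)
    qed
  qed (use integrable_exp_minus_abs[OF \<open>\<sigma> > 0\<close>] in auto)
  have eq: "versine_integral * (LBINT u. trap u * f (h n * u)) =
     3 / 2 * (LBINT s. F n s)" for n
    using 2[of n] h[of n] unfolding 1 by simp
  have "versine_integral * (3 * f 0) = 3 / 2 * (LBINT s. Re (char \<mu> s))"
    by (rule LIMSEQ_unique[OF tendsto_mult[OF tendsto_const L1]]) (unfold eq, intro tendsto_intros L2)
  then show ?thesis using versine_integral_pos by (simp add: field_simps)
qed

section \<open>Positivity of stable densities of index one\<close>

lemma tendsto_x_ln_x_at_right_0: "((\<lambda>x::real. x * ln x) \<longlongrightarrow> 0) (at_right 0)"
proof (rule Lim_null_comparison)
  have "((\<lambda>x::real. 2 * sqrt x) \<longlongrightarrow> 2 * sqrt 0) (at_right 0)"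
    by (intro tendsto_intros)
  then show "((\<lambda>x::real. 2 * sqrt x) \<longlongrightarrow> 0) (at_right 0)" by simp
  have "\<bar>x * ln x\<bar> \<le> 2 * sqrt x" if "0 < x" "x < 1" for x :: real
  proof -
    define y where "y = sqrt x"
    have y: "y > 0" "x = y * y" using that by (auto simp: y_def)
    have "ln (1 / y) \<le> 1 / y - 1" using y by (intro ln_le_minus_one) auto
    then have "- ln y \<le> 1 / y" using y by (simp add: ln_div)
    then have "(2 * (y * y)) * (- ln y) \<le> (2 * (y * y)) * (1 / y)" using y by (intro mult_left_mono) auto
    moreover have "x * ln x = (2 * (y * y)) * ln y" using y by (simp add: ln_mult)
    moreover have "x * ln x \<le> 0" using that by (simp add: mult_nonneg_nonpos)
    ultimately show ?thesis using y by (simp add: y_def[symmetric])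
  qed
  then show "\<forall>\<^sub>F x::real in at_right 0. norm (x * ln x) \<le> 2 * sqrt x"
    by (auto simp: eventually_at_right_field intro!: exI[of _ 1])
qed

text \<open>A form suited to scaling: \<open>\<kappa>\<close> collects
  \<open>\<sigma> * \<beta> * (2 / pi)\<close>, and \<open>t * ln |t|\<close> absorbs the sign. The
  aim is \<open>f 0 > 0\<close>; otherwise \<gamma> would vanish and the rescaling of the hitting
  time would degenerate.\<close>

locale stable_one_density = real_distribution \<mu> for \<mu> :: "real measure" +
  fixes f :: "real \<Rightarrow> real" and \<sigma> m \<kappa> :: real
  assumes dens: "\<mu> = density lborel f"
    and f_nonneg: "\<And>x. f x \<ge> 0" and f_cont: "continuous_on UNIV f"
    and sigma_pos: "\<sigma> > 0"
    and char_eq: "\<And>t. char \<mu> t = exp (of_real (- (\<sigma> * \<bar>t\<bar>)) + \<i> * of_real (m * t - \<kappa> * (t * ln \<bar>t\<bar>)))"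
begin

lemma f_meas[measurable]: "f \<in> borel_measurable borel"
  using f_cont by (rule borel_measurable_continuous_onI)

lemma f_tendsto_nhds: "(f \<longlongrightarrow> f x) (nhds x)"
  using f_cont by (simp add: continuous_on_eq_continuous_at isCont_def tendsto_at_iff_tendsto_nhds)

lemma emeasure_mu: "S \<in> sets borel \<Longrightarrow> emeasure \<mu> S = (\<integral>\<^sup>+x. ennreal (f x) * indicator S x \<partial>lborel)"
  unfolding dens by (subst emeasure_density) auto

lemma interval_measure_ge:
  assumes "u \<le> v" "0 \<le> c" "\<And>x. x \<in> {u<..<v} \<Longrightarrow> c \<le> f x"
  shows "c * (v - u) \<le> measure \<mu> {u<..<v}"
proof -
  have "ennreal (c * (v - u)) = (\<integral>\<^sup>+x. ennreal c * indicator {u<..<v} x \<partial>lborel)"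
    using assms by (simp add: nn_integral_cmult_indicator ennreal_mult)
  also have "\<dots> \<le> (\<integral>\<^sup>+x. ennreal (f x) * indicator {u<..<v} x \<partial>lborel)"
    using assms by (intro nn_integral_mono) (auto split: split_indicator intro!: ennreal_leI)
  also have "\<dots> = ennreal (measure \<mu> {u<..<v})"
    by (simp add: emeasure_mu[symmetric] emeasure_eq_measure)
  finally show ?thesis by simp
qed

lemma interval_measure_le:
  assumes "u \<le> v" "0 \<le> c" "\<And>x. x \<in> {u<..<v} \<Longrightarrow> f x \<le> c"
  shows "measure \<mu> {u<..<v} \<le> c * (v - u)"
proof -
  have "ennreal (measure \<mu> {u<..<v}) = (\<integral>\<^sup>+x. ennreal (f x) * indicator {u<..<v} x \<partial>lborel)"
    by (simp add: emeasure_mu[symmetric] emeasure_eq_measure)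
  also have "\<dots> \<le> (\<integral>\<^sup>+x. ennreal c * indicator {u<..<v} x \<partial>lborel)"
    using assms by (intro nn_integral_mono) (auto split: split_indicator intro!: ennreal_leI)
  also have "\<dots> = ennreal (c * (v - u))"
    using assms by (simp add: nn_integral_cmult_indicator ennreal_mult)
  finally show ?thesis using assms by (simp add: mult_nonneg_nonneg)
qed

lemma measure_eq_0_if_f_0:
  assumes "S \<in> sets borel" "\<And>x. x \<in> S \<Longrightarrow> f x = 0"
  shows "measure \<mu> S = 0"
proof -
  have "emeasure \<mu> S = (\<integral>\<^sup>+x. 0 \<partial>(lborel::real measure))"
    unfolding emeasure_mu[OF assms(1)]
    by (intro nn_integral_cong) (use assms(2) in \<open>auto split: split_indicator\<close>)
  then show ?thesis by (simp add: measure_def)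
qed

lemma f_pos_nhd:
  assumes "f a > 0"
  obtains r c where "r > 0" "c > 0" "\<And>x. \<bar>x - a\<bar> < r \<Longrightarrow> c \<le> f x"
proof -
  have "\<forall>\<^sub>F x in nhds a. f a / 2 < f x"
    using assms by (intro order_tendstoD(1)[OF f_tendsto_nhds]) simp
  then obtain r where "r > 0" "\<And>x. dist x a < r \<Longrightarrow> f a / 2 < f x"
    unfolding eventually_nhds_metric by blast
  then show ?thesis using assms by (intro that[of r "f a / 2"]) (auto simp: dist_real_def intro: less_imp_le)
qed

lemma measure_pos_nhd:
  assumes "f a > 0" "r > 0"
  shows "measure \<mu> {a - r<..<a + r} > 0"
proof -
  obtain r' c where c: "r' > 0" "c > 0" "\<And>x. \<bar>x - a\<bar> < r' \<Longrightarrow> c \<le> f x"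
    using f_pos_nhd[OF assms(1)] by blast
  define q where "q = min r r'"
  have q: "q > 0" "q \<le> r" "q \<le> r'" using c assms by (auto simp: q_def)
  have "c * ((a + q) - (a - q)) \<le> measure \<mu> {a - q<..<a + q}"
    by (rule interval_measure_ge) (use c q in auto)
  also have "\<dots> \<le> measure \<mu> {a - r<..<a + r}"
    using q by (intro finite_measure_mono) auto
  moreover have "0 < c * ((a + q) - (a - q))" using c q by simp
  ultimately show ?thesis by linarith
qed

lemma ex_f_pos: "\<exists>x. f x > 0"
proof (rule ccontr)
  assume "\<not> ?thesis"
  then have "f x = 0" for x using f_nonneg[of x] by (metis antisym_conv2)
  then have "measure \<mu> UNIV = 0" by (intro measure_eq_0_if_f_0) auto
  then show False using prob_space by simp
qed

definition entropy :: "real \<Rightarrow> real" where "entropy l = - (l * ln l + (1 - l) * ln (1 - l))"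

text \<open>Strict stability up to a shift: the shift \<open>\<kappa> * entropy l\<close> is what the logarithm in the
  characteristic function contributes.\<close>
lemma mixture_distr:
  assumes "0 < l" "l < 1"
  shows "distr (\<mu> \<Otimes>\<^sub>M \<mu>) borel (\<lambda>(x, y). l * x + (1 - l) * y) = distr \<mu> borel (\<lambda>x. x + \<kappa> * entropy l)"
proof (rule Levy_uniqueness)
  interpret P: pair_prob_space \<mu> \<mu> ..
  have m[measurable]: "(\<lambda>(x, y). l * x + (1 - l) * y) \<in> borel_measurable (\<mu> \<Otimes>\<^sub>M \<mu>)" by measurable
  show "real_distribution (distr (\<mu> \<Otimes>\<^sub>M \<mu>) borel (\<lambda>(x, y). l * x + (1 - l) * y))"
    by (rule P.real_distribution_distr) measurable
  show "real_distribution (distr \<mu> borel (\<lambda>x. x + \<kappa> * entropy l))"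
    by (rule real_distribution_distr) measurable
  show "char (distr (\<mu> \<Otimes>\<^sub>M \<mu>) borel (\<lambda>(x, y). l * x + (1 - l) * y)) = char (distr \<mu> borel (\<lambda>x. x + \<kappa> * entropy l))"
  proof
    fix t
    have int: "integrable (\<mu> \<Otimes>\<^sub>M \<mu>) (\<lambda>(x, y). iexp ((l * t) * x) * iexp (((1 - l) * t) * y))"
    proof (rule P.integrable_const_bound[where B = 1])
      show "AE p in \<mu> \<Otimes>\<^sub>M \<mu>. norm (case p of (x, y) \<Rightarrow> iexp ((l * t) * x) * iexp (((1 - l) * t) * y)) \<le> 1"
        by (auto simp: norm_mult simp del: of_real_mult)
    qed measurable
    have "char (distr (\<mu> \<Otimes>\<^sub>M \<mu>) borel (\<lambda>(x, y). l * x + (1 - l) * y)) t =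
       (CLINT p|\<mu> \<Otimes>\<^sub>M \<mu>. iexp (t * (case p of (x, y) \<Rightarrow> l * x + (1 - l) * y)))"
      unfolding char_def by (rule integral_distr[OF m]) measurable
    also have "\<dots> = (CLINT p|\<mu> \<Otimes>\<^sub>M \<mu>. (case p of (x, y) \<Rightarrow> iexp ((l * t) * x) * iexp (((1 - l) * t) * y)))"
      by (intro Bochner_Integration.integral_cong refl) (auto simp: algebra_simps simp flip: exp_add)
    also have "\<dots> = (CLINT x|\<mu>. (CLINT y|\<mu>. iexp ((l * t) * x) * iexp (((1 - l) * t) * y)))"
      using P.integral_fst'[OF int] by simp
    also have "\<dots> = char \<mu> (l * t) * char \<mu> ((1 - l) * t)"
      unfolding char_def by (simp only: integral_mult_right_zero integral_mult_left_zero)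
    also have "\<dots> = char \<mu> t * iexp (t * (\<kappa> * entropy l))"
    proof (cases "t = 0")
      case True
      then show ?thesis by (simp add: char_zero)
    next
      case False
      have ln: "ln \<bar>l * t\<bar> = ln l + ln \<bar>t\<bar>" "ln \<bar>(1 - l) * t\<bar> = ln (1 - l) + ln \<bar>t\<bar>"
        using assms False by (auto simp: abs_mult ln_mult)
      have ab: "\<sigma> * \<bar>l * t\<bar> + \<sigma> * \<bar>(1 - l) * t\<bar> = \<sigma> * \<bar>t\<bar>"
        unfolding abs_mult using assms by (simp add: algebra_simps)
      have im: "(m * (l * t) - \<kappa> * (l * t * ln \<bar>l * t\<bar>)) + (m * ((1 - l) * t) - \<kappa> * ((1 - l) * t * ln \<bar>(1 - l) * t\<bar>))
        = (m * t - \<kappa> * (t * ln \<bar>t\<bar>)) + t * (\<kappa> * entropy l)"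
        unfolding ln entropy_def by (simp add: algebra_simps)
      have "char \<mu> (l * t) * char \<mu> ((1 - l) * t) =
        exp (of_real (- (\<sigma> * \<bar>l * t\<bar> + \<sigma> * \<bar>(1 - l) * t\<bar>)) + \<i> * of_real ((m * (l * t) - \<kappa> * (l * t * ln \<bar>l * t\<bar>)) + (m * ((1 - l) * t) - \<kappa> * ((1 - l) * t * ln \<bar>(1 - l) * t\<bar>))))"
        unfolding char_eq exp_add[symmetric] by (intro arg_cong[where f = exp]) (simp add: distrib_left)
      also have "\<dots> = char \<mu> t * iexp (t * (\<kappa> * entropy l))"
        unfolding ab im char_eq exp_add[symmetric] by (intro arg_cong[where f = exp]) (simp add: distrib_left)
      finally show ?thesis .
    qed
    also have "\<dots> = (CLINT x|\<mu>. iexp (t * x) * iexp (t * (\<kappa> * entropy l)))"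
      unfolding char_def by (simp only: integral_mult_left_zero)
    also have "\<dots> = (CLINT x|\<mu>. iexp (t * (x + \<kappa> * entropy l)))"
      by (intro Bochner_Integration.integral_cong refl) (simp add: algebra_simps flip: exp_add)
    also have "\<dots> = char (distr \<mu> borel (\<lambda>x. x + \<kappa> * entropy l)) t"
      unfolding char_def by (rule integral_distr[symmetric]) measurable
    finally show "char (distr (\<mu> \<Otimes>\<^sub>M \<mu>) borel (\<lambda>(x, y). l * x + (1 - l) * y)) t = char (distr \<mu> borel (\<lambda>x. x + \<kappa> * entropy l)) t" .
  qed
qed

lemma mixture_slice_integrable:
  assumes [measurable]: "S \<in> sets borel"
  shows "integrable \<mu> (\<lambda>x. measure \<mu> {y. l * x + (1 - l) * y \<in> S})"
proof -
  have "(\<lambda>x. emeasure \<mu> {y \<in> space \<mu>. l * x + (1 - l) * y \<in> S}) \<in> borel_measurable \<mu>"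
    by measurable
  then have "(\<lambda>x. measure \<mu> {y. l * x + (1 - l) * y \<in> S}) \<in> borel_measurable \<mu>"
    unfolding measure_def by simp
  then show ?thesis by (intro integrable_const_bound[where B = 1]) auto
qed

lemma mixture_measure:
  assumes "0 < l" "l < 1" and S[measurable]: "S \<in> sets borel"
  shows "measure \<mu> {x. x + \<kappa> * entropy l \<in> S} = (\<integral>x. measure \<mu> {y. l * x + (1 - l) * y \<in> S} \<partial>\<mu>)"
proof -
  interpret P: pair_prob_space \<mu> \<mu> ..
  have "emeasure \<mu> {x. x + \<kappa> * entropy l \<in> S} = emeasure (distr \<mu> borel (\<lambda>x. x + \<kappa> * entropy l)) S"
    by (subst emeasure_distr) (auto intro!: arg_cong[where f = "emeasure \<mu>"])
  also have "\<dots> = emeasure (distr (\<mu> \<Otimes>\<^sub>M \<mu>) borel (\<lambda>(x, y). l * x + (1 - l) * y)) S"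
    using mixture_distr[OF assms(1,2)] by simp
  also have "\<dots> = emeasure (\<mu> \<Otimes>\<^sub>M \<mu>) ((\<lambda>(x, y). l * x + (1 - l) * y) -` S \<inter> space (\<mu> \<Otimes>\<^sub>M \<mu>))"
    by (rule emeasure_distr) measurable
  also have "\<dots> = (\<integral>\<^sup>+x. emeasure \<mu> (Pair x -` ((\<lambda>(x, y). l * x + (1 - l) * y) -` S \<inter> space (\<mu> \<Otimes>\<^sub>M \<mu>))) \<partial>\<mu>)"
    by (rule emeasure_pair_measure_alt) measurable
  also have "\<dots> = (\<integral>\<^sup>+x. ennreal (measure \<mu> {y. l * x + (1 - l) * y \<in> S}) \<partial>\<mu>)"
    unfolding emeasure_eq_measure[symmetric]
    by (intro nn_integral_cong arg_cong[where f = "emeasure \<mu>"]) (auto simp: space_pair_measure)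
  also have "\<dots> = ennreal (\<integral>x. measure \<mu> {y. l * x + (1 - l) * y \<in> S} \<partial>\<mu>)"
    by (rule nn_integral_eq_integral) (auto intro: mixture_slice_integrable)
  finally show ?thesis
    by (simp add: emeasure_eq_measure integral_nonneg_AE)
qed

text \<open>If \<open>f\<close> vanished at the mixed point, an interval of length \<open>2 h\<close> around it would have mass
  \<open>o(h)\<close> on one side of the mixture identity, but mass of order \<open>h\<close> on the other.\<close>
lemma mixture_pos:
  assumes l: "0 < l" "l < 1" and a: "f a > 0" and b: "f b > 0"
  shows "f (l * a + (1 - l) * b - \<kappa> * entropy l) > 0"
proof (rule ccontr)
  define z where "z = l * a + (1 - l) * b - \<kappa> * entropy l"
  assume "\<not> ?thesis"
  then have fz: "f z = 0" using f_nonneg[of z] by (simp add: z_def)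
  obtain r c where c: "r > 0" "c > 0" "\<And>x. \<bar>x - b\<bar> < r \<Longrightarrow> c \<le> f x"
    using f_pos_nhd[OF b] by blast
  \<comment> \<open>Half of the tolerance \<open>(1 - l) * r\<close> goes to the first component,
    the other half to the radius \<open>h\<close>.\<close>
  define r' where "r' = (1 - l) * r / 2"
  have r': "r' > 0" using l c by (simp add: r'_def)
  define p where "p = measure \<mu> {a - r'<..<a + r'}"
  have p: "p > 0" unfolding p_def using a r' by (rule measure_pos_nhd)
  \<comment> \<open>\<open>K * h\<close> bounds the mixture side from below: for every
    \<open>x\<close> near \<open>a\<close>, the admissible \<open>y\<close> fill an interval of
    length \<open>2 * h / (1 - l)\<close> on which \<open>f \<ge> c\<close>.\<close>
  define K where "K = c * (2 / (1 - l)) * p"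
  have K: "K > 0" using c l p by (simp add: K_def)
  have "\<forall>\<^sub>F x in nhds z. f x < K / 4"
    using fz K by (intro order_tendstoD(2)[OF f_tendsto_nhds]) simp
  then obtain d where d: "d > 0" "\<And>x. dist x z < d \<Longrightarrow> f x < K / 4"
    unfolding eventually_nhds_metric by blast
  define h where "h = min d ((1 - l) * r / 2)"
  have h: "h > 0" "h \<le> d" "h \<le> (1 - l) * r / 2" using d l c by (auto simp: h_def)
  define w where "w = l * a + (1 - l) * b"
  let ?S = "{w - h<..<w + h}"
  have "{x. x + \<kappa> * entropy l \<in> ?S} = {z - h<..<z + h}" by (auto simp: z_def w_def)
  moreover have "measure \<mu> {z - h<..<z + h} \<le> K / 4 * ((z + h) - (z - h))"
  proof (rule interval_measure_le)
    fix x assume "x \<in> {z - h<..<z + h}"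
    then have "dist x z < d" using h by (auto simp: dist_real_def)
    then show "f x \<le> K / 4" using d(2) by (simp add: less_imp_le)
  qed (use h K in auto)
  ultimately have "measure \<mu> {x. x + \<kappa> * entropy l \<in> ?S} \<le> K / 4 * ((z + h) - (z - h))"
    by (simp only:)
  also have "\<dots> < K * h" using K h by simp
  finally have 1: "measure \<mu> {x. x + \<kappa> * entropy l \<in> ?S} < K * h" .
  have "K * h = (\<integral>x. c * (2 / (1 - l)) * h * indicator {a - r'<..<a + r'} x \<partial>\<mu>)"
    by (simp add: K_def p_def)
  also have "\<dots> \<le> (\<integral>x. measure \<mu> {y. l * x + (1 - l) * y \<in> ?S} \<partial>\<mu>)"
  proof (rule integral_mono)
    show "integrable \<mu> (\<lambda>x. c * (2 / (1 - l)) * h * indicator {a - r'<..<a + r'} x)"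
      by (intro integrable_mult_right integrable_const_bound[where B = 1]) (auto simp: indicator_def)
    show "integrable \<mu> (\<lambda>x. measure \<mu> {y. l * x + (1 - l) * y \<in> ?S})"
      by (rule mixture_slice_integrable) simp
    fix x
    show "c * (2 / (1 - l)) * h * indicator {a - r'<..<a + r'} x \<le> measure \<mu> {y. l * x + (1 - l) * y \<in> ?S}"
    proof (cases "x \<in> {a - r'<..<a + r'}")
      case True
      then have xa: "\<bar>x - a\<bar> < r'" by auto
      define y0 where "y0 = (w - l * x) / (1 - l)"
      define q where "q = h / (1 - l)"
      have lq: "(1 - l) * y0 = w - l * x" "(1 - l) * q = h" using l by (auto simp: y0_def q_def)
      have q0: "q > 0" using h l by (simp add: q_def)
      have set: "{y. l * x + (1 - l) * y \<in> ?S} = {y0 - q<..<y0 + q}"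
      proof -
        have "l * x + (1 - l) * y \<in> ?S \<longleftrightarrow> (1 - l) * (y0 - q) < (1 - l) * y \<and> (1 - l) * y < (1 - l) * (y0 + q)" for y
          unfolding right_diff_distrib[of "1 - l" y0] distrib_left[of "1 - l" y0] lq by auto
        also have "\<dots> y \<longleftrightarrow> y \<in> {y0 - q<..<y0 + q}" for y using l by simp
        finally show ?thesis by blast
      qed
      have "c * ((y0 + q) - (y0 - q)) \<le> measure \<mu> {y0 - q<..<y0 + q}"
      proof (rule interval_measure_ge)
        fix y assume y: "y \<in> {y0 - q<..<y0 + q}"
        have "(1 - l) * (y - b) = (1 - l) * (y - y0) - l * (x - a)"
          using lq(1) by (simp add: w_def algebra_simps)
        then have "(1 - l) * \<bar>y - b\<bar> \<le> (1 - l) * \<bar>y - y0\<bar> + l * \<bar>x - a\<bar>"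
          using l abs_triangle_ineq4[of "(1 - l) * (y - y0)" "l * (x - a)"] by (simp add: abs_mult)
        also have "\<dots> < (1 - l) * q + r'"
        proof (rule add_less_le_mono)
          show "(1 - l) * \<bar>y - y0\<bar> < (1 - l) * q" using y l by (intro mult_strict_left_mono) auto
          have "l * \<bar>x - a\<bar> \<le> 1 * \<bar>x - a\<bar>" using l by (intro mult_right_mono) auto
          then show "l * \<bar>x - a\<bar> \<le> r'" using xa by simp
        qed
        also have "\<dots> \<le> (1 - l) * r" using h lq by (simp add: r'_def)
        finally have "\<bar>y - b\<bar> < r" using l by simp
        then show "c \<le> f y" by (rule c(3))
      qed (use q0 c in auto)
      then show ?thesis using True unfolding set by (simp add: q_def)
    qed simp
  qed
  also have "\<dots> = measure \<mu> {x. x + \<kappa> * entropy l \<in> ?S}"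
    by (rule mixture_measure[symmetric]) (use l in auto)
  finally show False using 1 by simp
qed

text \<open>Mixing a point with itself moves positivity left by \<open>\<kappa> * entropy l\<close>,
  which takes all values in \<open>(0, \<kappa> * ln 2]\<close>; iteration reaches everything left
  of a positive point. The positive points are not bounded above: with supremum \<open>r\<close>,
  two independent copies at most \<open>r\<close> mix to at most \<open>r\<close>, yet the even
  mixture has the law of the variable shifted up by \<open>\<kappa> * ln 2\<close>.\<close>

lemma f_pos_of_kappa_pos:
  assumes k: "\<kappa> > 0"
  shows "f x > 0"
proof -
  define c where "c = \<kappa> * ln 2"
  have c: "c > 0" using k by (simp add: c_def)
  have ent: "\<kappa> * entropy (1/2) = c"
    by (simp add: entropy_def c_def ln_div)
  have down1: "f (a - s) > 0" if a: "f a > 0" and s: "0 \<le> s" "s \<le> c" for a s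
  proof (cases "s = 0")
    case False
    have lim: "(entropy \<longlongrightarrow> 0) (at_right 0)"
    proof -
      have "((\<lambda>l::real. l * ln l) \<longlongrightarrow> 0) (at_right 0)" by (rule tendsto_x_ln_x_at_right_0)
      moreover have "((\<lambda>l::real. (1 - l) * ln (1 - l)) \<longlongrightarrow> (1 - 0) * ln (1 - 0)) (at_right 0)"
        by (intro tendsto_intros) auto
      ultimately have "((\<lambda>l::real. - (l * ln l + (1 - l) * ln (1 - l))) \<longlongrightarrow> - (0 + (1 - 0) * ln (1 - 0))) (at_right 0)"
        by (intro tendsto_minus tendsto_add)
      then show ?thesis unfolding entropy_def[abs_def] by simp
    qed
    have "s / \<kappa> > 0" using False s k by simp
    then have "\<forall>\<^sub>F l in at_right 0. entropy l < s / \<kappa>" by (rule order_tendstoD(2)[OF lim])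
    moreover have "\<forall>\<^sub>F l in at_right 0. l < (1/2::real)" "\<forall>\<^sub>F l in at_right 0. 0 < (l::real)"
      by (rule order_tendstoD(2)[OF tendsto_ident_at], simp, rule eventually_at_right_less)
    ultimately have "\<forall>\<^sub>F l in at_right 0. 0 < l \<and> l < (1/2::real) \<and> entropy l < s / \<kappa>"
      by eventually_elim auto
    then obtain l0 where l0: "0 < l0" "l0 < 1/2" "entropy l0 < s / \<kappa>"
      using eventually_happens'[of "at_right (0::real)"] by (auto simp: trivial_limit_at_right_real)
    have "\<exists>l\<ge>l0. l \<le> 1/2 \<and> entropy l = s / \<kappa>"
    proof (rule IVT')
      show "entropy l0 \<le> s / \<kappa>" using l0 by simp
      show "s / \<kappa> \<le> entropy (1/2)" using ent s k by (simp add: field_simps)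
      show "continuous_on {l0..1/2} entropy"
        unfolding entropy_def[abs_def] using l0 by (intro continuous_intros) auto
    qed (use l0 in auto)
    then obtain l where l: "l0 \<le> l" "l \<le> 1/2" "entropy l = s / \<kappa>" by blast
    have "f (l * a + (1 - l) * a - \<kappa> * entropy l) > 0"
      using l l0 a by (intro mixture_pos) auto
    moreover have "l * a + (1 - l) * a - \<kappa> * entropy l = a - s" using l k by (simp add: algebra_simps)
    ultimately show ?thesis by simp
  qed (use a in simp)
  have down2: "f (a - real n * u) > 0" if "f a > 0" "0 \<le> u" "u \<le> c" for a u n
  proof (induction n)
    case (Suc n)
    from down1[OF this that(2,3)] show ?case by (simp add: algebra_simps)
  qed (use that in simp)
  have down: "f y > 0" if "f a > 0" "y \<le> a" for a y
  proof -
    obtain n where n: "(a - y) / c < real n" using reals_Archimedean2 by blast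
    then have n0: "n > 0" using that c by (cases n) (auto simp: field_simps divide_less_0_iff not_less)
    have "f (a - real n * ((a - y) / real n)) > 0"
      using that n n0 c by (intro down2) (auto simp: field_simps)
    then show ?thesis using n0 by simp
  qed
  have "\<exists>a\<ge>x. f a > 0"
  proof (rule ccontr)
    assume no: "\<not> ?thesis"
    define P where "P = {a. f a > 0}"
    have bdd: "bdd_above P"
      unfolding P_def by (rule bdd_aboveI[of _ x]) (use no nle_le in blast)
    have ne: "P \<noteq> {}" using ex_f_pos by (auto simp: P_def)
    define r where "r = Sup P"
    have le_r: "a \<le> r" if "f a > 0" for a
      unfolding r_def by (rule cSup_upper[OF _ bdd]) (use that in \<open>simp add: P_def\<close>)
    obtain a where a: "f a > 0" "r - c < a"
      using less_cSupD[OF ne, of "r - c"] c by (auto simp: r_def P_def)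
    have zero: "measure \<mu> {r<..} = 0"
      by (rule measure_eq_0_if_f_0) (use le_r f_nonneg in \<open>auto simp: not_less antisym\<close>, metis f_nonneg le_r linorder_not_le order_le_less)
    have AEr: "AE x in \<mu>. x \<le> r"
      using zero by (intro AE_I[where N = "{r<..}"]) (auto simp: emeasure_eq_measure)
    \<comment> \<open>The left end of this interval is \<open>r - c\<close>, so the shift by
      \<open>c\<close> carries all its mass beyond \<open>r\<close>.\<close>
    have "measure \<mu> {a - (a - (r - c))<..<a + (a - (r - c))} > 0"
      using a by (intro measure_pos_nhd) auto
    also have "measure \<mu> {a - (a - (r - c))<..<a + (a - (r - c))} \<le> measure \<mu> {x. x + \<kappa> * entropy (1/2) \<in> {r<..}}"
      unfolding ent by (intro finite_measure_mono) auto
    also have "\<dots> = (\<integral>x. measure \<mu> {y. 1/2 * x + (1 - 1/2) * y \<in> {r<..}} \<partial>\<mu>)"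
      by (rule mixture_measure) auto
    also have "\<dots> = (\<integral>x. 0 \<partial>\<mu>)"
    proof (rule integral_cong_AE)
      show "(\<lambda>x. measure \<mu> {y. 1/2 * x + (1 - 1/2) * y \<in> {r<..}}) \<in> borel_measurable \<mu>"
        by (rule borel_measurable_integrable[OF mixture_slice_integrable]) simp
      show "AE x in \<mu>. measure \<mu> {y. 1/2 * x + (1 - 1/2) * y \<in> {r<..}} = 0"
        using AEr
      proof eventually_elim
        case (elim x)
        have "measure \<mu> {y. 1/2 * x + (1 - 1/2) * y \<in> {r<..}} \<le> measure \<mu> {r<..}"
          using elim by (intro finite_measure_mono) auto
        then show ?case using zero measure_nonneg[of \<mu> "{y. 1/2 * x + (1 - 1/2) * y \<in> {r<..}}"] by linarith
      qed
    qed simp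
    finally show False by simp
  qed
  then show ?thesis using down by blast
qed

text \<open>After centring at \<open>m\<close> the characteristic function is
  \<open>exp (- (\<sigma> * |t|))\<close>, with a defect linear in \<open>|t|\<close> at 0, whereas
  a variable bounded by \<open>l\<close> has defect at most \<open>t^2 * l^2 / 2\<close>.\<close>

lemma not_bounded:
  assumes "\<kappa> = 0" and b: "measure \<mu> {x. \<bar>x - m\<bar> > l} = 0" and "l > 0"
  shows False
proof -
  have AEb: "AE x in \<mu>. \<bar>x - m\<bar> \<le> l"
    using b by (intro AE_I[where N = "{x. \<bar>x - m\<bar> > l}"]) (auto simp: emeasure_eq_measure)
  have bound: "1 - exp (- (\<sigma> * t)) \<le> t\<^sup>2 * l\<^sup>2 / 2" if "t > 0" for t
  proof -
    have int: "integrable \<mu> (\<lambda>x. cos (t * x - t * m))"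
      by (rule integrable_const_bound[where B = 1]) auto
    have "iexp (- (t * m)) * char \<mu> t = of_real (exp (- (\<sigma> * t)))"
      unfolding char_eq using that \<open>\<kappa> = 0\<close>
      by (simp add: mult_exp_exp exp_of_real[symmetric] algebra_simps)
    then have "exp (- (\<sigma> * t)) = (\<integral>x. cos (t * x - t * m) \<partial>\<mu>)"
      using Re_rotated_char[of "t * m" t] by (simp only: Re_complex_of_real)
    then have "1 - exp (- (\<sigma> * t)) = (\<integral>x. 1 - cos (t * x - t * m) \<partial>\<mu>)"
      using int prob_space by simp
    also have "\<dots> \<le> (\<integral>x. t\<^sup>2 * l\<^sup>2 / 2 \<partial>\<mu>)"
    proof (rule integral_mono_AE)
      show "AE x in \<mu>. 1 - cos (t * x - t * m) \<le> t\<^sup>2 * l\<^sup>2 / 2"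
        using AEb
      proof eventually_elim
        case (elim x)
        define u where "u = t * x - t * m"
        have "\<bar>u\<bar> = t * \<bar>x - m\<bar>" using that by (simp add: u_def abs_mult flip: right_diff_distrib)
        also have "\<dots> \<le> t * l" using elim that by (intro mult_left_mono) auto
        finally have "\<bar>u\<bar>\<^sup>2 \<le> (t * l)\<^sup>2" by (intro power_mono) auto
        moreover have "1 - cos u \<le> u\<^sup>2 / 2" by (rule one_minus_cos_le)
        ultimately show ?case by (simp add: u_def power_mult_distrib)
      qed
    qed (use int in auto)
    finally show ?thesis using prob_space by simp
  qed
  \<comment> \<open>Small enough for \<open>1 - exp (- x) \<ge> x / 2\<close> at
    \<open>x = \<sigma> * t\<close> and for a quadratic bound of at most
    \<open>\<sigma> * t / 4\<close>.\<close>
  define t where "t = min (1 / \<sigma>) (\<sigma> / (2 * l\<^sup>2))"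
  have t: "t > 0" "\<sigma> * t \<le> 1" "t * l\<^sup>2 \<le> \<sigma> / 2"
  proof -
    show "t > 0" using sigma_pos \<open>l > 0\<close> by (simp add: t_def)
    have "\<sigma> * t \<le> \<sigma> * (1 / \<sigma>)" using sigma_pos by (intro mult_left_mono) (auto simp: t_def)
    then show "\<sigma> * t \<le> 1" using sigma_pos by simp
    have "t * l\<^sup>2 \<le> (\<sigma> / (2 * l\<^sup>2)) * l\<^sup>2" by (intro mult_right_mono) (auto simp: t_def)
    then show "t * l\<^sup>2 \<le> \<sigma> / 2" using \<open>l > 0\<close> by simp
  qed
  have "1 - exp (- x) \<ge> x / 2" if "0 \<le> x" "x \<le> 1" for x :: real
  proof -
    have "1 + x \<le> exp x" by (rule exp_ge_add_one_self)
    then have "exp (- x) \<le> 1 / (1 + x)" using that by (simp add: exp_minus field_simps)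
    also have "\<dots> \<le> 1 - x / 2" using that by (simp add: field_simps mult_left_le)
    finally show ?thesis by simp
  qed
  from this[of "\<sigma> * t"] have "\<sigma> * t / 2 \<le> 1 - exp (- (\<sigma> * t))" using t sigma_pos by simp
  also have "\<dots> \<le> t\<^sup>2 * l\<^sup>2 / 2" using t by (intro bound) auto
  also have "t\<^sup>2 * l\<^sup>2 / 2 = t * (t * l\<^sup>2) / 2" by (simp add: power2_eq_square)
  also have "\<dots> \<le> t * (\<sigma> / 2) / 2" using t by (intro divide_right_mono mult_left_mono) auto
  finally have "\<sigma> * t \<le> \<sigma> * t / 2" by simp
  then show False using t sigma_pos by simp
qed

text \<open>For \<open>\<kappa> = 0\<close> this is the Cauchy law with centre \<open>m\<close>. Its
  symmetry turns one-sided boundedness into the two-sided one that \<open>not_bounded\<close>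
  refutes.\<close>

lemma reflect_measure:
  assumes "\<kappa> = 0" and S[measurable]: "S \<in> sets borel"
  shows "measure \<mu> {x. 2 * m - x \<in> S} = measure \<mu> S"
proof -
  have "distr \<mu> borel (\<lambda>x. 2 * m - x) = \<mu>"
  proof (rule Levy_uniqueness)
    show "real_distribution (distr \<mu> borel (\<lambda>x. 2 * m - x))"
      by (rule real_distribution_distr) measurable
    show "real_distribution \<mu>" ..
    show "char (distr \<mu> borel (\<lambda>x. 2 * m - x)) = char \<mu>"
    proof
      fix t
      have "char (distr \<mu> borel (\<lambda>x. 2 * m - x)) t = (CLINT x|\<mu>. iexp (t * (2 * m - x)))"
        unfolding char_def by (rule integral_distr) measurable
      also have "\<dots> = (CLINT x|\<mu>. iexp (t * (2 * m)) * iexp ((- t) * x))"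
        by (intro Bochner_Integration.integral_cong refl) (simp add: algebra_simps flip: exp_add)
      also have "\<dots> = iexp (t * (2 * m)) * char \<mu> (- t)"
        unfolding char_def by (simp only: integral_mult_right_zero)
      also have "\<dots> = char \<mu> t"
        unfolding char_eq using \<open>\<kappa> = 0\<close> by (simp add: algebra_simps flip: exp_add)
      finally show "char (distr \<mu> borel (\<lambda>x. 2 * m - x)) t = char \<mu> t" .
    qed
  qed
  then have "measure \<mu> S = measure (distr \<mu> borel (\<lambda>x. 2 * m - x)) S" by simp
  also have "\<dots> = measure \<mu> {x. 2 * m - x \<in> S}"
    by (subst measure_distr) (auto intro!: arg_cong[where f = "measure \<mu>"])
  finally show ?thesis by simp
qed

text \<open>Without a shift, \<open>mixture_pos\<close> says that the positivity set is convex. It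
  meets both sides of \<open>x\<close>: emptiness on one side would, by symmetry, confine the law to
  a bounded interval around \<open>m\<close>.\<close>

lemma f_pos_of_kappa_0:
  assumes k: "\<kappa> = 0"
  shows "f x > 0"
proof -
  have zero: "measure \<mu> S = 0" if "S \<in> sets borel" "\<And>a. a \<in> S \<Longrightarrow> \<not> f a > 0" for S
  proof (rule measure_eq_0_if_f_0[OF that(1)])
    fix a assume "a \<in> S"
    then show "f a = 0" using that(2)[of a] f_nonneg[of a] by simp
  qed
  define l where "l = \<bar>x - m\<bar> + 1"
  have subset: "measure \<mu> {y. \<bar>y - m\<bar> > l} = 0" if "measure \<mu> S = 0" "S = {x..} \<or> S = {..x}" for S
  proof -
    have [measurable]: "S \<in> sets borel" using that(2) by auto
    have "measure \<mu> {y. \<bar>y - m\<bar> > l} \<le> measure \<mu> (S \<union> {y. 2 * m - y \<in> S})"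
      by (intro finite_measure_mono) (use that(2) in \<open>auto simp: l_def abs_if split: if_splits\<close>)
    also have "\<dots> \<le> measure \<mu> S + measure \<mu> {y. 2 * m - y \<in> S}"
      by (intro measure_Un_le) auto
    also have "\<dots> = 0" using that(1) reflect_measure[OF k, of S] by simp
    finally show ?thesis using measure_nonneg[of \<mu> "{y. \<bar>y - m\<bar> > l}"] by linarith
  qed
  have l: "l > 0" by (simp add: l_def)
  have "\<exists>a\<ge>x. f a > 0"
  proof (rule ccontr)
    assume "\<not> ?thesis"
    then have "measure \<mu> {x..} = 0" by (intro zero) auto
    from not_bounded[OF k subset[OF this] l] show False by simp
  qed
  then obtain a where a: "a \<ge> x" "f a > 0" by blast
  have "\<exists>b\<le>x. f b > 0"
  proof (rule ccontr)
    assume "\<not> ?thesis"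
    then have "measure \<mu> {..x} = 0" by (intro zero) auto
    from not_bounded[OF k subset[OF this] l] show False by simp
  qed
  then obtain b where b: "b \<le> x" "f b > 0" by blast
  show ?thesis
  proof (cases "a = x \<or> b = x")
    case False
    then have lt: "b < x" "x < a" using a b by auto
    define c where "c = (x - b) / (a - b)"
    have "0 < c" "c < 1" using lt by (auto simp: c_def field_simps)
    then have "f (c * a + (1 - c) * b - \<kappa> * entropy c) > 0" using a b by (intro mixture_pos) auto
    moreover have "c * a + (1 - c) * b = b + c * (a - b)" by (simp add: algebra_simps)
    moreover have "c * (a - b) = x - b" using lt by (simp add: c_def)
    ultimately show ?thesis using k by simp
  qed (use a b in auto)
qed

lemma reflected: "stable_one_density (distr \<mu> borel uminus) (\<lambda>x. f (- x)) \<sigma> (- m) (- \<kappa>)"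
proof -
  interpret D: real_distribution "distr \<mu> borel uminus"
    by (rule real_distribution_distr) measurable
  show ?thesis
  proof
    show "distr \<mu> borel uminus = density lborel (\<lambda>x. ennreal (f (- x)))"
    proof (rule measure_eqI)
      fix S assume "S \<in> sets (distr \<mu> borel uminus)"
      then have S[measurable]: "S \<in> sets borel" by simp
      have "emeasure (distr \<mu> borel uminus) S = emeasure \<mu> {x. - x \<in> S}"
        by (subst emeasure_distr) (auto intro!: arg_cong[where f = "emeasure \<mu>"])
      also have "\<dots> = (\<integral>\<^sup>+x. ennreal (f x) * indicator {x. - x \<in> S} x \<partial>lborel)"
        by (rule emeasure_mu) measurable
      also have "\<dots> = ennreal \<bar>-1\<bar> * (\<integral>\<^sup>+x. ennreal (f (0 + - 1 * x)) * indicator {x. - x \<in> S} (0 + - 1 * x) \<partial>lborel)"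
        by (rule nn_integral_real_affine) auto
      also have "\<dots> = (\<integral>\<^sup>+x. ennreal (f (- x)) * indicator S x \<partial>lborel)"
        by (simp add: indicator_def)
      also have "\<dots> = emeasure (density lborel (\<lambda>x. ennreal (f (- x)))) S"
        by (subst emeasure_density) auto
      finally show "emeasure (distr \<mu> borel uminus) S = emeasure (density lborel (\<lambda>x. ennreal (f (- x)))) S" .
    qed simp
    show "continuous_on UNIV (\<lambda>x. f (- x))"
      by (intro continuous_on_compose2[OF f_cont] continuous_intros) auto
    fix t
    have "char (distr \<mu> borel uminus) t = (CLINT x|\<mu>. iexp (t * (- x)))"
      unfolding char_def by (rule integral_distr) measurable
    also have "\<dots> = char \<mu> (- t)" unfolding char_def by simp
    also have "\<dots> = exp (of_real (- (\<sigma> * \<bar>t\<bar>)) + \<i> * of_real (- m * t - - \<kappa> * (t * ln \<bar>t\<bar>)))"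
      unfolding char_eq by simp
    finally show "char (distr \<mu> borel uminus) t = exp (of_real (- (\<sigma> * \<bar>t\<bar>)) + \<i> * of_real (- m * t - - \<kappa> * (t * ln \<bar>t\<bar>)))" .
  qed (auto simp: f_nonneg sigma_pos)
qed

lemma f_pos: "f x > 0"
proof -
  consider "\<kappa> > 0" | "\<kappa> = 0" | "\<kappa> < 0" by linarith
  then show ?thesis
  proof cases
    case 3
    interpret R: stable_one_density "distr \<mu> borel uminus" "\<lambda>x. f (- x)" \<sigma> "- m" "- \<kappa>"
      by (rule reflected)
    show ?thesis using R.f_pos_of_kappa_pos[of "- x"] 3 by simp
  qed (use f_pos_of_kappa_pos f_pos_of_kappa_0 in auto)
qed

end

lemma stable_index_one_cases:
  assumes "stable_index_one \<mu>"
  obtains \<sigma> m \<kappa> where "\<sigma> > 0" "real_distribution \<mu>"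
    "\<And>t. char \<mu> t = exp (of_real (- (\<sigma> * \<bar>t\<bar>)) + \<i> * of_real (m * t - \<kappa> * (t * ln \<bar>t\<bar>)))"
    "\<And>t. cmod (char \<mu> t) = exp (- (\<sigma> * \<bar>t\<bar>))"
proof -
  from assms obtain \<sigma> \<beta> m where rd: "real_distribution \<mu>" and "\<sigma> > 0"
    and ch: "\<And>t::real. char \<mu> t = exp (\<i> * complex_of_real (m * t)
          - complex_of_real (\<sigma> * \<bar>t\<bar>) * (1 + \<i> * complex_of_real (\<beta> * (2 / pi) * sgn t * ln \<bar>t\<bar>)))"
    unfolding stable_index_one_def by blast
  have *: "char \<mu> t = exp (of_real (- (\<sigma> * \<bar>t\<bar>)) + \<i> * of_real (m * t - (\<sigma> * \<beta> * (2 / pi)) * (t * ln \<bar>t\<bar>)))" for t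
  proof -
    have "\<bar>t\<bar> * sgn t = t" by (simp add: abs_mult_sgn mult.commute)
    then have "(\<sigma> * \<bar>t\<bar>) * (\<beta> * (2 / pi) * sgn t * ln \<bar>t\<bar>) = (\<sigma> * \<beta> * (2 / pi)) * (t * ln \<bar>t\<bar>)"
      by (metis (no_types, lifting) mult.assoc mult.left_commute)
    then have "complex_of_real (\<sigma> * \<bar>t\<bar>) * complex_of_real (\<beta> * (2 / pi) * sgn t * ln \<bar>t\<bar>)
      = complex_of_real ((\<sigma> * \<beta> * (2 / pi)) * (t * ln \<bar>t\<bar>))"
      by (simp only: of_real_mult[symmetric])
    then show ?thesis unfolding ch
      by (intro arg_cong[where f = exp]) (simp add: distrib_left right_diff_distrib mult.left_commute[of _ \<i>])
  qed
  show ?thesis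
  proof (rule that[OF \<open>\<sigma> > 0\<close> rd *])
    show "cmod (char \<mu> t) = exp (- (\<sigma> * \<bar>t\<bar>))" for t unfolding * by (simp add: norm_exp_eq_Re)
  qed
qed

section \<open>Renewal inequalities for the perturbed walk\<close>

text \<open>Index 0 is reserved for the random starting point, independent of the steps but with a
  law of its own; hence \<open>distr_W\<close> begins at 1 and the sums \<open>S\<close> leave out
  \<open>W 0\<close>.\<close>

locale iid_walk = prob_space M for M :: "'a measure" +
  fixes W :: "nat \<Rightarrow> 'a \<Rightarrow> real" and \<nu> :: "real measure"
  assumes indep: "indep_vars (\<lambda>_. borel) W UNIV"
    and distr_W: "\<And>i. i \<ge> 1 \<Longrightarrow> distr M borel (W i) = \<nu>"
begin

definition S :: "nat \<Rightarrow> 'a \<Rightarrow> real" where "S n \<omega> = (\<Sum>i\<in>{1..n}. W i \<omega>)"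

lemma W_measurable[measurable]: "W i \<in> borel_measurable M"
  using indep by (simp add: indep_vars_def)

lemma S_measurable[measurable]: "S n \<in> borel_measurable M"
  unfolding S_def by measurable

lemma S_0[simp]: "S 0 \<omega> = 0" by (simp add: S_def)

lemma S_add: "S (k + j) \<omega> = S k \<omega> + (\<Sum>i\<in>{1..j}. W (k + i) \<omega>)"
  unfolding S_def by (induction j) (auto simp: add.assoc)

lemma char_S: "char (distr M borel (S n)) s = char \<nu> s ^ n"
proof -
  have "char (distr M borel (\<lambda>\<omega>. \<Sum>i\<in>{1..n}. W i \<omega>)) s = (\<Prod>i\<in>{1..n}. char (distr M borel (W i)) s)"
    by (rule char_distr_sum) (rule indep_vars_subset[OF indep], simp)
  then show ?thesis by (simp add: S_def[abs_def] distr_W)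
qed

lemma indep_vars_shift: "indep_vars (\<lambda>_. borel) (\<lambda>i. W (k + i)) I"
proof -
  have "indep_vars (\<lambda>j. PiM {k + j} (\<lambda>_. borel)) (\<lambda>j \<omega>. restrict (\<lambda>i. W i \<omega>) {k + j}) I"
    by (rule indep_vars_restrict[OF indep]) (auto simp: disjoint_family_on_def)
  then have "indep_vars (\<lambda>_. borel) (\<lambda>j \<omega>. (\<lambda>z. z (k + j)) (restrict (\<lambda>i. W i \<omega>) {k + j})) I"
    by (rule indep_vars_compose2) measurable
  then show ?thesis by simp
qed

lemma distr_shift:
  assumes "I \<noteq> {}" "0 \<notin> I"
  shows "distr M (PiM I (\<lambda>_. borel)) (\<lambda>\<omega>. \<lambda>i\<in>I. W (k + i) \<omega>) = PiM I (\<lambda>_. \<nu>)"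
proof -
  have "distr M (PiM I (\<lambda>_. borel)) (\<lambda>\<omega>. \<lambda>i\<in>I. W (k + i) \<omega>) = (\<Pi>\<^sub>M i\<in>I. distr M borel (W (k + i)))"
    using indep_vars_iff_distr_eq_PiM[where I = I and X = "\<lambda>i. W (k + i)" and M' = "\<lambda>_. borel"] assms indep_vars_shift
    by simp
  also have "\<dots> = PiM I (\<lambda>_. \<nu>)"
    using assms by (intro PiM_cong refl distr_W) (metis One_nat_def Suc_leI add_gr_0 gr0I)
  finally show ?thesis .
qed

text \<open>Time 0 is not tested: the start may lie in \<open>B\<close>, and only later visits
  count.\<close>

definition avoid :: "real set \<Rightarrow> nat \<Rightarrow> real \<Rightarrow> real" where
  "avoid B n y = prob {\<omega> \<in> space M. \<forall>j\<in>{1..n}. y + S j \<omega> \<notin> B}"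

lemma avoid_measurable[measurable]:
  assumes [measurable]: "B \<in> sets borel"
  shows "avoid B n \<in> borel_measurable borel"
proof -
  have "(\<lambda>y. emeasure M {\<omega> \<in> space M. \<forall>j\<in>{1..n}. y + S j \<omega> \<notin> B}) \<in> borel_measurable borel"
    by measurable
  then show ?thesis unfolding avoid_def[abs_def] measure_def by simp
qed

lemma avoid_bounds: "0 \<le> avoid B n y" "avoid B n y \<le> 1"
  by (auto simp: avoid_def)

text \<open>The variables indexed by \<open>J\<close> are independent of those after
  \<open>k\<close>, and the later steps have the common law, so the future can be replaced by a
  fresh walk. \<open>J\<close> is left open: \<open>{1..k}\<close> gives the walk from 0,
  \<open>{..k}\<close> includes the random start.\<close>

lemma markov_property:
  assumes J: "J \<subseteq> {..k}" and [measurable]: "B \<in> sets borel"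
  defines "Y \<equiv> (\<lambda>\<omega>. \<Sum>i\<in>J. W i \<omega>)"
  shows "ennreal (prob {\<omega> \<in> space M. Y \<omega> \<in> B \<and> (\<forall>j\<in>{1..n}. Y \<omega> + (\<Sum>i\<in>{1..j}. W (k + i) \<omega>) \<notin> B)})
    = (\<integral>\<^sup>+\<omega>. indicator B (Y \<omega>) * ennreal (avoid B n (Y \<omega>)) \<partial>M)"
proof -
  \<comment> \<open>One index beyond \<open>n\<close> keeps \<open>I\<close> nonempty for
    \<open>n = 0\<close>, as \<open>distr_shift\<close> requires.\<close>
  define I where "I = {1..Suc n}"
  have I: "I \<noteq> {}" "0 \<notin> I" "finite I" by (auto simp: I_def)
  define Z where "Z k = (\<lambda>\<omega>. \<lambda>i\<in>I. W (k + i) \<omega>)" for k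
  have Ym[measurable]: "Y \<in> borel_measurable M" unfolding Y_def by measurable
  have Zm[measurable]: "Z k \<in> measurable M (PiM I (\<lambda>_. borel))" for k
    unfolding Z_def by (rule measurable_restrict) measurable
  define PJ where "PJ = PiM J (\<lambda>_. borel :: real measure)"
  define V where "V = (\<lambda>\<omega>. restrict (\<lambda>i. W i \<omega>) J)"
  have Vm[measurable]: "V \<in> measurable M PJ"
    unfolding V_def PJ_def by (rule measurable_restrict) measurable
  define \<Sigma> where "\<Sigma> v = (\<Sum>i\<in>J. v i :: real)" for v
  have \<Sigma>m[measurable]: "\<Sigma> \<in> borel_measurable PJ" unfolding \<Sigma>_def PJ_def by measurable
  have \<Sigma>V: "\<Sigma> (V \<omega>) = Y \<omega>" for \<omega> by (simp add: \<Sigma>_def V_def Y_def)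
  let ?K = "(\<lambda>i. k + i) ` I"
  have "indep_var (PiM J (\<lambda>_. borel)) (\<lambda>\<omega>. restrict (\<lambda>i. W i \<omega>) J) (PiM ?K (\<lambda>_. borel)) (\<lambda>\<omega>. restrict (\<lambda>i. W i \<omega>) ?K)"
    by (rule indep_var_restrict[OF indep]) (use J in \<open>auto simp: I_def\<close>)
  then have "indep_var PJ ((\<lambda>z. z) \<circ> V) (PiM I (\<lambda>_. borel)) ((\<lambda>z. \<lambda>i\<in>I. z (k + i)) \<circ> (\<lambda>\<omega>. restrict (\<lambda>i. W i \<omega>) ?K))"
    unfolding PJ_def V_def
  proof (rule indep_var_compose)
    show "(\<lambda>z. \<lambda>i\<in>I. z (k + i)) \<in> measurable (PiM ?K (\<lambda>_. borel :: real measure)) (PiM I (\<lambda>_. borel))"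
      by (rule measurable_restrict) (rule measurable_component_singleton, simp)
  qed simp
  moreover have "(\<lambda>z. \<lambda>i\<in>I. z (k + i)) \<circ> (\<lambda>\<omega>. restrict (\<lambda>i. W i \<omega>) ?K) = Z k" by (auto simp: Z_def fun_eq_iff)
  moreover have "(\<lambda>z. z) \<circ> V = V" by auto
  ultimately have "indep_var PJ V (PiM I (\<lambda>_. borel)) (Z k)" by (simp only:)
  then have joint: "distr M PJ V \<Otimes>\<^sub>M distr M (PiM I (\<lambda>_. borel)) (Z k) = distr M (PJ \<Otimes>\<^sub>M PiM I (\<lambda>_. borel)) (\<lambda>\<omega>. (V \<omega>, Z k \<omega>))"
    by (simp add: indep_var_distribution_eq)
  \<comment> \<open>Here identical laws enter: the shifted block is exchanged for the initial one,
    whose partial sums are \<open>S j\<close>.\<close>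
  have same: "distr M (PiM I (\<lambda>_. borel)) (Z k) = distr M (PiM I (\<lambda>_. borel)) (Z 0)"
    unfolding Z_def using distr_shift[OF I(1,2), of k] distr_shift[OF I(1,2), of 0] by simp
  define C where "C = {p \<in> space (PJ \<Otimes>\<^sub>M PiM I (\<lambda>_. borel)). \<Sigma> (fst p) \<in> B \<and> (\<forall>j\<in>{1..n}. \<Sigma> (fst p) + (\<Sum>i\<in>{1..j}. snd p i) \<notin> B)}"
  have \<Sigma>f: "(\<lambda>p. \<Sigma> (fst p)) \<in> borel_measurable (PJ \<Otimes>\<^sub>M PiM I (\<lambda>_. borel :: real measure))"
    by measurable
  have comp: "(\<lambda>p. snd p i) \<in> borel_measurable (PJ \<Otimes>\<^sub>M PiM I (\<lambda>_. borel :: real measure))" if "i \<in> I" for i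
    using that by (intro measurable_compose[OF measurable_snd] measurable_component_singleton)
  let ?Q = "PJ \<Otimes>\<^sub>M PiM I (\<lambda>_. borel :: real measure)"
  have mem: "{p \<in> space ?Q. F p \<in> D} \<in> sets ?Q" if "F \<in> borel_measurable ?Q" "D \<in> sets borel" for F and D :: "real set"
    using measurable_sets[OF that] by (simp add: vimage_def Int_def conj_commute)
  have Fj: "{p \<in> space ?Q. \<Sigma> (fst p) + (\<Sum>i\<in>{1..j}. snd p i) \<in> - B} \<in> sets ?Q" if "j \<in> {1..n}" for j
    using that by (intro mem borel_measurable_add borel_measurable_sum comp \<Sigma>f) (auto simp: I_def)
  have "{p \<in> space ?Q. \<forall>j\<in>{1..n}. \<Sigma> (fst p) + (\<Sum>i\<in>{1..j}. snd p i) \<in> - B} \<in> sets ?Q"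
    by (rule sets.sets_Collect_finite_All[OF Fj]) auto
  then have Cm: "C \<in> sets ?Q"
    unfolding C_def using sets.sets_Collect_conj[OF mem[OF \<Sigma>f \<open>B \<in> sets borel\<close>]] by simp
  interpret Zp: prob_space "distr M (PiM I (\<lambda>_. borel)) (Z k)" by (rule prob_space_distr) measurable
  have sumZ: "(\<Sum>i\<in>{1..j}. Z k' \<omega> i) = (\<Sum>i\<in>{1..j}. W (k' + i) \<omega>)" if "j \<in> {1..n}" for j \<omega> k'
    by (rule sum.cong) (use that in \<open>auto simp: Z_def I_def\<close>)
  have Zsp: "Z k' \<omega> \<in> space (PiM I (\<lambda>_. borel :: real measure))" for k' \<omega>
    by (simp add: Z_def space_PiM)
  have slice: "emeasure (distr M (PiM I (\<lambda>_. borel)) (Z k)) (Pair v -` C) = indicator B (\<Sigma> v) * ennreal (avoid B n (\<Sigma> v))" if v: "v \<in> space PJ" for v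
  proof -
    have "Pair v -` C \<in> sets (PiM I (\<lambda>_. borel))" using Cm by (rule sets_Pair1)
    then have "emeasure (distr M (PiM I (\<lambda>_. borel)) (Z 0)) (Pair v -` C) = emeasure M (Z 0 -` (Pair v -` C) \<inter> space M)"
      by (intro emeasure_distr) auto
    also have "Z 0 -` (Pair v -` C) \<inter> space M = (if \<Sigma> v \<in> B then {\<omega> \<in> space M. \<forall>j\<in>{1..n}. \<Sigma> v + S j \<omega> \<notin> B} else {})"
      using sumZ[of _ 0] Zsp[of 0] v by (auto simp: C_def space_pair_measure S_def)
    also have "emeasure M \<dots> = indicator B (\<Sigma> v) * ennreal (avoid B n (\<Sigma> v))"
      by (auto simp: avoid_def emeasure_eq_measure)
    finally show ?thesis unfolding same .
  qed
  have "ennreal (prob {\<omega> \<in> space M. Y \<omega> \<in> B \<and> (\<forall>j\<in>{1..n}. Y \<omega> + (\<Sum>i\<in>{1..j}. W (k + i) \<omega>) \<notin> B)})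
     = emeasure M ((\<lambda>\<omega>. (V \<omega>, Z k \<omega>)) -` C \<inter> space M)"
    unfolding emeasure_eq_measure
    by (intro arg_cong[where f = "\<lambda>s. ennreal (prob s)"]) (use sumZ Zsp \<Sigma>V measurable_space[OF Vm] in \<open>auto simp: C_def space_pair_measure\<close>)
  also have "\<dots> = emeasure (distr M (PJ \<Otimes>\<^sub>M PiM I (\<lambda>_. borel)) (\<lambda>\<omega>. (V \<omega>, Z k \<omega>))) C"
    by (rule emeasure_distr[symmetric]) (use Cm in auto)
  also have "\<dots> = emeasure (distr M PJ V \<Otimes>\<^sub>M distr M (PiM I (\<lambda>_. borel)) (Z k)) C"
    by (simp add: joint)
  also have "\<dots> = (\<integral>\<^sup>+v. emeasure (distr M (PiM I (\<lambda>_. borel)) (Z k)) (Pair v -` C) \<partial>distr M PJ V)"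
    using Cm by (intro Zp.emeasure_pair_measure_alt) (simp cong: sets_pair_measure_cong)
  also have "\<dots> = (\<integral>\<^sup>+v. indicator B (\<Sigma> v) * ennreal (avoid B n (\<Sigma> v)) \<partial>distr M PJ V)"
    by (intro nn_integral_cong slice) simp
  also have "\<dots> = (\<integral>\<^sup>+\<omega>. indicator B (Y \<omega>) * ennreal (avoid B n (Y \<omega>)) \<partial>M)"
    by (subst nn_integral_distr) (auto simp: \<Sigma>V)
  finally show ?thesis .
qed

text \<open>Time 0 is almost surely a visit, so exactly one \<open>k \<le> N\<close> is the last
  visit up to time \<open>N\<close>.\<close>

lemma last_visit_sum:
  fixes N :: nat
  assumes Y[measurable]: "\<And>k. Y k \<in> borel_measurable M" and B[measurable]: "B \<in> sets borel"
    and start: "AE \<omega> in M. Y 0 \<omega> \<in> B"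
  shows "(\<Sum>k\<le>N. prob {\<omega> \<in> space M. Y k \<omega> \<in> B \<and> (\<forall>j\<in>{1..N - k}. Y (k + j) \<omega> \<notin> B)}) = 1"
proof -
  let ?E = "\<lambda>k. {\<omega> \<in> space M. Y k \<omega> \<in> B \<and> (\<forall>j\<in>{1..N - k}. Y (k + j) \<omega> \<notin> B)}"
  have "(\<Sum>k\<le>N. prob (?E k)) = prob (\<Union>k\<in>{..N}. ?E k)"
  proof (rule finite_measure_finite_Union[symmetric])
    have disj: "?E a \<inter> ?E b = {}" if "a < b" "b \<le> N" for a b :: nat
    proof -
      have "b - a \<in> {1..N - a}" "a + (b - a) = b" using that by auto
      then have "Y b \<omega> \<notin> B" if "\<omega> \<in> ?E a" for \<omega>
        using that by (metis (mono_tags, lifting) mem_Collect_eq)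
      then show ?thesis by blast
    qed
    then show "disjoint_family_on ?E {..N}"
      unfolding disjoint_family_on_def
    proof (intro ballI impI)
      fix a b assume ab: "a \<in> {..N}" "b \<in> {..N}" "a \<noteq> b"
      then consider "a < b" | "b < a" by linarith
      then show "?E a \<inter> ?E b = {}"
        using disj[of a b] disj[of b a] ab by cases (auto simp only: atMost_iff Int_commute)
    qed
  qed auto
  also have "\<dots> = 1"
  proof (subst prob_eq_1)
    show "AE \<omega> in M. \<omega> \<in> (\<Union>k\<in>{..N}. ?E k)"
      using start AE_space
    proof eventually_elim
      case (elim \<omega>)
      let ?P = "{k. k \<le> N \<and> Y k \<omega> \<in> B}"
      define k where "k = Max ?P"
      have fin: "finite ?P" by simp
      have ne: "?P \<noteq> {}" using elim by auto
      have k: "k \<in> ?P" unfolding k_def using fin ne by (rule Max_in)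
      have "\<forall>j\<in>{1..N - k}. Y (k + j) \<omega> \<notin> B"
      proof (rule ballI, rule notI)
        fix j assume j: "j \<in> {1..N - k}" "Y (k + j) \<omega> \<in> B"
        then have "k + j \<in> ?P" using k by auto
        then have "k + j \<le> k" unfolding k_def using fin by (rule Max_ge[rotated])
        then show False using j by simp
      qed
      then show ?case using k elim by auto
    qed
  qed measurable
  finally show ?thesis .
qed

text \<open>The position at a visit to 0 is deterministic, so the last-visit probabilities factor
  exactly.\<close>

lemma zero_renewal:
  "(\<Sum>k\<le>N. prob {\<omega> \<in> space M. S k \<omega> = 0} * avoid {0} (N - k) 0) = 1"
proof -
  have "prob {\<omega> \<in> space M. S k \<omega> = 0} * avoid {0} (N - k) 0 =
      prob {\<omega> \<in> space M. S k \<omega> \<in> {0} \<and> (\<forall>j\<in>{1..N - k}. S (k + j) \<omega> \<notin> {0})}" for k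
  proof -
    have "ennreal (prob {\<omega> \<in> space M. S k \<omega> \<in> {0} \<and> (\<forall>j\<in>{1..N - k}. S (k + j) \<omega> \<notin> {0})})
      = (\<integral>\<^sup>+\<omega>. indicator {0} (S k \<omega>) * ennreal (avoid {0} (N - k) (S k \<omega>)) \<partial>M)"
      using markov_property[of "{1..k}" k "{0}" "N - k"] unfolding S_add S_def[symmetric] by auto
    also have "\<dots> = (\<integral>\<^sup>+\<omega>. ennreal (avoid {0} (N - k) 0) * indicator {\<omega> \<in> space M. S k \<omega> = 0} \<omega> \<partial>M)"
      by (intro nn_integral_cong) (auto split: split_indicator)
    also have "\<dots> = ennreal (avoid {0} (N - k) 0) * emeasure M {\<omega> \<in> space M. S k \<omega> = 0}"
      by (rule nn_integral_cmult_indicator) measurable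
    also have "\<dots> = ennreal (prob {\<omega> \<in> space M. S k \<omega> = 0} * avoid {0} (N - k) 0)"
      by (simp add: emeasure_eq_measure ennreal_mult avoid_bounds mult.commute)
    finally show ?thesis by (simp add: avoid_bounds)
  qed
  then show ?thesis using last_visit_sum[of S "{0}" N] by simp
qed

lemma indep_var_start: "indep_var borel (W 0) borel (S k)"
proof -
  have "indep_var borel (W 0) borel (\<lambda>\<omega>. \<Sum>i\<in>{1..k}. W i \<omega>)"
    by (rule indep_vars_sum) (auto intro: indep_vars_subset[OF indep])
  then show ?thesis by (simp add: S_def[abs_def])
qed

text \<open>Seen from the landing point \<open>y\<close>, the density of \<open>W 0 + S k\<close> is
  \<open>P (|S k - y| < e) / (2 * e)\<close>. The uniform start thus turns the law of the position
  into window probabilities of \<open>S k\<close>.\<close>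

lemma nn_integral_uniform_start:
  assumes e: "e > 0" and unif: "distr M borel (W 0) = uniform_measure lborel {-e<..<e}"
    and g[measurable]: "g \<in> borel_measurable borel"
  shows "(\<integral>\<^sup>+\<omega>. g (W 0 \<omega> + S k \<omega>) \<partial>M) =
    (\<integral>\<^sup>+y. g y * emeasure (distr M borel (S k)) {y - e<..<y + e} \<partial>lborel) / ennreal (2 * e)"
proof -
  let ?B = "{-e<..<e}"
  let ?L = "distr M borel (W 0)" and ?N = "distr M borel (S k)"
  interpret L: prob_space ?L by (rule prob_space_distr) measurable
  interpret N: prob_space ?N by (rule prob_space_distr) measurable
  interpret P: pair_sigma_finite ?L ?N ..
  interpret Q: pair_sigma_finite ?N "lborel :: real measure" ..
  have B: "emeasure lborel ?B = ennreal (2 * e)" using e by simp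
  have "(\<integral>\<^sup>+\<omega>. g (W 0 \<omega> + S k \<omega>) \<partial>M) = (\<integral>\<^sup>+p. g (fst p + snd p) \<partial>distr M (borel \<Otimes>\<^sub>M borel) (\<lambda>\<omega>. (W 0 \<omega>, S k \<omega>)))"
    by (subst nn_integral_distr) auto
  also have "distr M (borel \<Otimes>\<^sub>M borel) (\<lambda>\<omega>. (W 0 \<omega>, S k \<omega>)) = ?L \<Otimes>\<^sub>M ?N"
    using indep_var_start[of k] by (simp add: indep_var_distribution_eq)
  also have "(\<integral>\<^sup>+p. g (fst p + snd p) \<partial>(?L \<Otimes>\<^sub>M ?N)) = (\<integral>\<^sup>+s. (\<integral>\<^sup>+x. g (x + s) \<partial>?L) \<partial>?N)"
    by (subst P.nn_integral_snd[symmetric]) auto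
  also have "\<dots> = (\<integral>\<^sup>+s. (\<integral>\<^sup>+y. g y * indicator ?B (y - s) \<partial>lborel) / ennreal (2 * e) \<partial>?N)"
  proof (intro nn_integral_cong)
    fix s
    have "(\<integral>\<^sup>+x. g (x + s) \<partial>?L) = (\<integral>\<^sup>+x. g (x + s) * indicator ?B x \<partial>lborel) / ennreal (2 * e)"
      unfolding unif by (subst nn_integral_uniform_measure) (auto simp: B)
    also have "(\<integral>\<^sup>+x. g (x + s) * indicator ?B x \<partial>lborel) =
        ennreal \<bar>1\<bar> * (\<integral>\<^sup>+y. g (- s + 1 * y + s) * indicator ?B (- s + 1 * y) \<partial>lborel)"
      by (rule nn_integral_real_affine) auto
    also have "\<dots> = (\<integral>\<^sup>+y. g y * indicator ?B (y - s) \<partial>lborel)" by simp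
    finally show "(\<integral>\<^sup>+x. g (x + s) \<partial>?L) = (\<integral>\<^sup>+y. g y * indicator ?B (y - s) \<partial>lborel) / ennreal (2 * e)" .
  qed
  also have "\<dots> = (\<integral>\<^sup>+s. (\<integral>\<^sup>+y. g y * indicator ?B (y - s) \<partial>lborel) \<partial>?N) / ennreal (2 * e)"
    by (rule nn_integral_divide) measurable
  also have "(\<integral>\<^sup>+s. (\<integral>\<^sup>+y. g y * indicator ?B (y - s) \<partial>lborel) \<partial>?N) = (\<integral>\<^sup>+y. (\<integral>\<^sup>+s. g y * indicator ?B (y - s) \<partial>?N) \<partial>lborel)"
    by (rule Q.Fubini'[symmetric]) measurable
  also have "\<dots> = (\<integral>\<^sup>+y. g y * emeasure ?N {y - e<..<y + e} \<partial>lborel)"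
  proof (intro nn_integral_cong)
    fix y
    have "(\<integral>\<^sup>+s. g y * indicator ?B (y - s) \<partial>?N) = (\<integral>\<^sup>+s. g y * indicator {y - e<..<y + e} s \<partial>?N)"
      by (intro nn_integral_cong) (auto split: split_indicator)
    also have "\<dots> = g y * emeasure ?N {y - e<..<y + e}" by (rule nn_integral_cmult_indicator) simp
    finally show "(\<integral>\<^sup>+s. g y * indicator ?B (y - s) \<partial>?N) = g y * emeasure ?N {y - e<..<y + e}" .
  qed
  finally show ?thesis .
qed

definition survive :: "real \<Rightarrow> nat \<Rightarrow> real" where
  "survive e n = prob {\<omega> \<in> space M. \<forall>j\<in>{1..n}. W 0 \<omega> + S j \<omega> \<notin> {-e<..<e}}"

lemma AE_uniform_start:
  assumes "e > 0" "distr M borel (W 0) = uniform_measure lborel {-e<..<e}"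
  shows "AE \<omega> in M. W 0 \<omega> \<in> {-e<..<e}"
proof -
  have "AE x in distr M borel (W 0). x \<in> {-e<..<e}"
    unfolding assms(2) by (rule AE_uniform_measureI) auto
  then show ?thesis by (subst (asm) AE_distr_iff) auto
qed

text \<open>With \<open>g y\<close> the survival probability from a point \<open>y\<close> of the
  window, \<open>survive\<close> is the integral of \<open>g\<close> against the uniform density,
  and \<open>P\<close> is the same integral with the window probability of \<open>S k\<close> at
  \<open>y\<close> as extra weight. Bounding the weight leaves \<open>survive\<close> as a factor,
  whatever the shape of \<open>g\<close>.\<close>

lemma visit_bounds:
  fixes n :: nat
  assumes e: "e > 0" and unif: "distr M borel (W 0) = uniform_measure lborel {-e<..<e}"
    and bounds: "\<And>y. \<bar>y\<bar> < e \<Longrightarrow> lo \<le> measure (distr M borel (S k)) {y - e<..<y + e}"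
      "\<And>y. \<bar>y\<bar> < e \<Longrightarrow> measure (distr M borel (S k)) {y - e<..<y + e} \<le> hi"
  defines "P \<equiv> prob {\<omega> \<in> space M. W 0 \<omega> + S k \<omega> \<in> {-e<..<e} \<and> (\<forall>j\<in>{1..n}. W 0 \<omega> + S (k + j) \<omega> \<notin> {-e<..<e})}"
  shows "lo * survive e n \<le> P" "P \<le> hi * survive e n"
proof -
  let ?B = "{-e<..<e}"
  let ?N = "distr M borel (S k)"
  interpret N: prob_space ?N by (rule prob_space_distr) measurable
  define g where "g y = indicator ?B y * ennreal (avoid ?B n y)" for y
  have g[measurable]: "g \<in> borel_measurable borel" unfolding g_def by measurable
  have split: "(\<Sum>i\<in>{..k}. W i \<omega>) = W 0 \<omega> + S k \<omega>" for k \<omega>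
  proof -
    have "{..k} = insert 0 {1..k}" by auto
    then show ?thesis by (simp add: S_def)
  qed
  have P_eq: "ennreal (prob {\<omega> \<in> space M. W 0 \<omega> + S k \<omega> \<in> ?B \<and> (\<forall>j\<in>{1..n}. W 0 \<omega> + S (k + j) \<omega> \<notin> ?B)})
     = (\<integral>\<^sup>+\<omega>. g (W 0 \<omega> + S k \<omega>) \<partial>M)" for k
    using markov_property[of "{..k}" k ?B n] unfolding split S_add g_def by (simp add: add.assoc)
  \<comment> \<open>The start lies in the window almost surely, so survival is the last-visit
    probability for \<open>k = 0\<close>.\<close>
  have "survive e n = prob {\<omega> \<in> space M. W 0 \<omega> + S 0 \<omega> \<in> ?B \<and> (\<forall>j\<in>{1..n}. W 0 \<omega> + S (0 + j) \<omega> \<notin> ?B)}"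
    unfolding survive_def
  proof (rule measure_eq_AE)
    show "AE \<omega> in M. (\<omega> \<in> {\<omega> \<in> space M. \<forall>j\<in>{1..n}. W 0 \<omega> + S j \<omega> \<notin> ?B}) =
        (\<omega> \<in> {\<omega> \<in> space M. W 0 \<omega> + S 0 \<omega> \<in> ?B \<and> (\<forall>j\<in>{1..n}. W 0 \<omega> + S (0 + j) \<omega> \<notin> ?B)})"
      using AE_uniform_start[OF e unif] by eventually_elim auto
  qed measurable
  then have "ennreal (survive e n) = (\<integral>\<^sup>+\<omega>. g (W 0 \<omega> + S 0 \<omega>) \<partial>M)"
    using P_eq[of 0] by simp
  also have "\<dots> = (\<integral>\<^sup>+x. g x \<partial>distr M borel (W 0))" by (subst nn_integral_distr) auto
  also have "\<dots> = (\<integral>\<^sup>+x. g x * indicator ?B x \<partial>lborel) / ennreal (2 * e)"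
    unfolding unif using e by (subst nn_integral_uniform_measure) auto
  also have "(\<integral>\<^sup>+x. g x * indicator ?B x \<partial>lborel) = (\<integral>\<^sup>+x. g x \<partial>lborel)"
    by (intro nn_integral_cong) (auto simp: g_def split: split_indicator)
  finally have V: "ennreal (survive e n) = (\<integral>\<^sup>+x. g x \<partial>lborel) / ennreal (2 * e)" .
  have P: "ennreal P = (\<integral>\<^sup>+y. g y * emeasure ?N {y - e<..<y + e} \<partial>lborel) / ennreal (2 * e)"
    unfolding P_def P_eq by (rule nn_integral_uniform_start[OF e unif g])
  have scale: "(\<integral>\<^sup>+y. g y * ennreal c \<partial>lborel) / ennreal (2 * e) = ennreal (c * survive e n)" if "c \<ge> 0" for c
  proof -
    have "(\<integral>\<^sup>+y. g y * ennreal c \<partial>lborel) = (\<integral>\<^sup>+y. g y \<partial>lborel) * ennreal c"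
      by (rule nn_integral_multc) measurable
    then have "(\<integral>\<^sup>+y. g y * ennreal c \<partial>lborel) / ennreal (2 * e) = ennreal (survive e n) * ennreal c"
      unfolding V by (simp add: ennreal_times_divide mult.commute divide_ennreal_def mult.assoc mult.left_commute)
    then show ?thesis using that by (simp add: ennreal_mult survive_def mult.commute)
  qed
  have V0: "0 \<le> survive e n" by (simp add: survive_def)
  have P0: "0 \<le> P" by (simp add: P_def)
  have hi0: "0 \<le> hi" using order_trans[OF measure_nonneg bounds(2)[of 0]] e by simp
  have "ennreal P \<le> (\<integral>\<^sup>+y. g y * ennreal hi \<partial>lborel) / ennreal (2 * e)"
    unfolding P
  proof (intro divide_right_mono_ennreal nn_integral_mono)
    fix y
    show "g y * emeasure ?N {y - e<..<y + e} \<le> g y * ennreal hi"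
    proof (cases "y \<in> ?B")
      case True
      then have "measure ?N {y - e<..<y + e} \<le> hi" by (intro bounds) auto
      then show ?thesis by (intro mult_left_mono) (auto simp: N.emeasure_eq_measure intro: ennreal_leI)
    qed (simp add: g_def)
  qed
  then show "P \<le> hi * survive e n" using hi0 V0 by (simp add: scale)
  show "lo * survive e n \<le> P"
  proof (cases "lo \<ge> 0")
    case True
    have "(\<integral>\<^sup>+y. g y * ennreal lo \<partial>lborel) / ennreal (2 * e) \<le> ennreal P"
      unfolding P
    proof (intro divide_right_mono_ennreal nn_integral_mono)
      fix y
      show "g y * ennreal lo \<le> g y * emeasure ?N {y - e<..<y + e}"
      proof (cases "y \<in> ?B")
        case True
        then have "lo \<le> measure ?N {y - e<..<y + e}" by (intro bounds) auto
        then show ?thesis by (intro mult_left_mono) (auto simp: N.emeasure_eq_measure intro: ennreal_leI)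
      qed (simp add: g_def)
    qed
    then show ?thesis using True V0 P0 by (simp add: scale)
  next
    case False
    then have "lo * survive e n \<le> 0" using V0 by (simp add: mult_nonpos_nonneg)
    then show ?thesis using P0 by simp
  qed
qed

lemma renewal_bounds:
  assumes e: "e > 0" and unif: "distr M borel (W 0) = uniform_measure lborel {-e<..<e}"
    and bounds: "\<And>k y. \<bar>y\<bar> < e \<Longrightarrow> lo k \<le> measure (distr M borel (S k)) {y - e<..<y + e}"
      "\<And>k y. \<bar>y\<bar> < e \<Longrightarrow> measure (distr M borel (S k)) {y - e<..<y + e} \<le> hi k"
  shows "(\<Sum>k\<le>N. lo k * survive e (N - k)) \<le> 1" "1 \<le> (\<Sum>k\<le>N. hi k * survive e (N - k))"
proof -
  let ?P = "\<lambda>k. prob {\<omega> \<in> space M. W 0 \<omega> + S k \<omega> \<in> {-e<..<e} \<and> (\<forall>j\<in>{1..N - k}. W 0 \<omega> + S (k + j) \<omega> \<notin> {-e<..<e})}"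
  have one: "(\<Sum>k\<le>N. ?P k) = 1"
    using last_visit_sum[of "\<lambda>k \<omega>. W 0 \<omega> + S k \<omega>" "{-e<..<e}" N] AE_uniform_start[OF e unif] by simp
  have "(\<Sum>k\<le>N. lo k * survive e (N - k)) \<le> (\<Sum>k\<le>N. ?P k)"
    by (intro sum_mono visit_bounds(1)[OF e unif bounds])
  then show "(\<Sum>k\<le>N. lo k * survive e (N - k)) \<le> 1" using one by simp
  have "(\<Sum>k\<le>N. ?P k) \<le> (\<Sum>k\<le>N. hi k * survive e (N - k))"
    by (intro sum_mono visit_bounds(2)[OF e unif bounds])
  then show "1 \<le> (\<Sum>k\<le>N. hi k * survive e (N - k))" using one by simp
qed

lemma survive_antimono: "m \<le> n \<Longrightarrow> survive e n \<le> survive e m"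
  unfolding survive_def by (intro finite_measure_mono) auto

end

section \<open>Asymptotics of the survival probability\<close>

lemma Gsum_0[simp]: "Gsum A 0 = 0" by (simp add: Gsum_def)

lemma Gsum_Suc[simp]: "Gsum A (Suc n) = Gsum A n + 1 / A (Suc n)" by (simp add: Gsum_def)

lemma Ginterp_of_nat: "Ginterp A (real n) = Gsum A n"
  by (simp add: Ginterp_def Let_def)

lemma Gsum_mono:
  assumes "\<And>n. n \<ge> 1 \<Longrightarrow> A n > 0"
  shows "mono (Gsum A)"
proof (rule monoI)
  fix m n :: nat assume "m \<le> n"
  then show "Gsum A m \<le> Gsum A n"
  proof (induction rule: dec_induct)
    case (step n)
    have "0 \<le> 1 / A (Suc n)" using assms[of "Suc n"] by simp
    then have "Gsum A n \<le> Gsum A (Suc n)" unfolding Gsum_Suc by (rule le_add_same_cancel1[THEN iffD2])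
    with step show ?case by (meson order_trans)
  qed simp
qed

lemma sum_inverse_eq_Gsum_diff:
  assumes "1 \<le> K" "K \<le> Suc N"
  shows "(\<Sum>k=K..N. 1 / A k) = Gsum A N - Gsum A (K - 1)"
  using assms(2)
proof (induction N)
  case 0
  then have "K = 1" using assms by simp
  then show ?case by simp
next
  case (Suc N)
  show ?case
  proof (cases "K = Suc (Suc N)")
    case False
    then show ?thesis using Suc by simp
  qed simp
qed

lemma sum_power_tail_le:
  fixes \<rho> :: real
  assumes "0 < \<rho>" "\<rho> < 1"
  shows "(\<Sum>k=K..N. \<rho> ^ k) \<le> \<rho> ^ K / (1 - \<rho>)"
proof (cases "K \<le> N")
  case True
  have "(\<Sum>k=K..N. \<rho> ^ k) = (\<rho> ^ K - \<rho> ^ Suc N) / (1 - \<rho>)"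
    using assms True by (subst sum_gp) (auto simp: not_less)
  also have "\<dots> \<le> \<rho> ^ K / (1 - \<rho>)"
    using assms by (intro divide_right_mono) auto
  finally show ?thesis .
qed (use assms in auto)

lemma (in real_distribution) tendsto_measure_shrinking_interval:
  "((\<lambda>e. measure M {-e<..<e}) \<longlongrightarrow> measure M {0}) (at_right 0)"
proof (rule tendstoI)
  fix d :: real assume "d > 0"
  have "(\<lambda>n. measure M {- (1 / real (Suc n))<..<1 / real (Suc n)}) \<longlonglongrightarrow> measure M (\<Inter>n. {- (1 / real (Suc n))<..<1 / real (Suc n)})"
  proof (rule finite_Lim_measure_decseq)
    show "decseq (\<lambda>n. {- (1 / real (Suc n))<..<1 / real (Suc n)})"
    proof (rule decseq_SucI)
      fix n
      have "1 / real (Suc (Suc n)) \<le> 1 / real (Suc n)" by (simp add: field_simps)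
      then show "{- (1 / real (Suc (Suc n)))<..<1 / real (Suc (Suc n))} \<subseteq> {- (1 / real (Suc n))<..<1 / real (Suc n)}"
        by auto
    qed
  qed auto
  also have "(\<Inter>n. {- (1 / real (Suc n))<..<1 / real (Suc n)}) = {0}"
  proof -
    have "x = 0" if "\<forall>n. \<bar>x\<bar> < 1 / real (Suc n)" for x
    proof (rule ccontr)
      assume "x \<noteq> 0"
      then obtain n where "inverse (real (Suc n)) < \<bar>x\<bar>" using reals_Archimedean[of "\<bar>x\<bar>"] by auto
      moreover have "\<bar>x\<bar> < inverse (real (Suc n))" using that[rule_format, of n] by (simp only: inverse_eq_divide)
      ultimately show False by (rule less_asym)
    qed
    moreover have "\<bar>x\<bar> < 1 / real (Suc n) \<longleftrightarrow> x \<in> {- (1 / real (Suc n))<..<1 / real (Suc n)}" for x n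
      by (auto simp only: abs_less_iff greaterThanLessThan_iff)
    moreover have "0 \<in> {- (1 / real (Suc n))<..<1 / real (Suc n)}" for n by simp
    ultimately show ?thesis by (intro equalityI subsetI) (simp_all only: INT_iff singleton_iff, simp, blast)
  qed
  finally have "\<forall>\<^sub>F n in sequentially. measure M {- (1 / real (Suc n))<..<1 / real (Suc n)} < measure M {0} + d"
    using \<open>d > 0\<close> by (intro order_tendstoD(2)) auto
  then obtain n where n: "measure M {- (1 / real (Suc n))<..<1 / real (Suc n)} < measure M {0} + d"
    by (auto simp: eventually_sequentially)
  have "\<forall>\<^sub>F e in at_right 0. e < 1 / real (Suc n)"
    by (rule order_tendstoD(2)[OF tendsto_ident_at]) simp
  moreover have "\<forall>\<^sub>F e in at_right 0. (0::real) < e" by (rule eventually_at_right_less)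
  ultimately show "\<forall>\<^sub>F e in at_right 0. dist (measure M {-e<..<e}) (measure M {0}) < d"
  proof eventually_elim
    case (elim e)
    have "measure M {-e<..<e} \<le> measure M {- (1 / real (Suc n))<..<1 / real (Suc n)}"
      using elim by (intro finite_measure_mono) auto
    moreover have "measure M {0} \<le> measure M {-e<..<e}"
      using elim by (intro finite_measure_mono) auto
    ultimately show ?case using n by (simp add: dist_real_def)
  qed
qed

context stable_attraction
begin

text \<open>Slow variation of \<open>G\<close>, where index 1 enters. Grouping the terms of
  \<open>G (2 * n)\<close> in pairs, \<open>1 / A (2 * j) + 1 / A (2 * j - 1)\<close> is asymptotic
  to \<open>1 / A j\<close>, as both ratios to \<open>A j\<close> tend to 2. The finitely many early
  pairs are absorbed by the divergence of \<open>G\<close>.\<close>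

lemma Gsum_double_le:
  assumes Ginf: "filterlim (Gsum A) at_top sequentially" and "\<eta> > 0"
  shows "\<forall>\<^sub>F n in sequentially. Gsum A (2 * n) - Gsum A n \<le> \<eta> * Gsum A n"
proof -
  define a where "a j = 1 / A j" for j
  define b where "b j = 1 / A (2 * j) + 1 / A (2 * j - 1)" for j
  have r1: "(\<lambda>k. A (2 * k) / A k) \<longlonglongrightarrow> 2"
  proof (rule A_ratio_tendsto)
    show "filterlim (\<lambda>k::nat. 2 * k) at_top sequentially"
      by (rule filterlim_subseq) (simp add: strict_mono_def)
    have "\<forall>\<^sub>F k in sequentially. real (2 * k) / real k = 2"
      using eventually_gt_at_top[of 0] by eventually_elim simp
    then show "(\<lambda>k. real (2 * k) / real k) \<longlonglongrightarrow> 2" by (rule tendsto_eventually)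
  qed simp
  have r2: "(\<lambda>k. A (2 * k - 1) / A k) \<longlonglongrightarrow> 2"
  proof (rule A_ratio_tendsto)
    show "filterlim (\<lambda>k::nat. 2 * k - 1) at_top sequentially"
      unfolding filterlim_at_top
    proof
      fix Z :: nat
      show "\<forall>\<^sub>F k in sequentially. Z \<le> 2 * k - 1"
        using eventually_ge_at_top[of "Suc Z"] by eventually_elim auto
    qed
    have "(\<lambda>k. 2 - 1 / real k) \<longlonglongrightarrow> 2 - 0" by (intro tendsto_intros lim_1_over_n)
    moreover have "\<forall>\<^sub>F k in sequentially. 2 - 1 / real k = real (2 * k - 1) / real k"
      using eventually_gt_at_top[of 0]
      by eventually_elim (simp add: of_nat_diff diff_divide_distrib)
    ultimately show "(\<lambda>k. real (2 * k - 1) / real k) \<longlonglongrightarrow> 2"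
      by (simp add: tendsto_cong)
  qed simp
  have "(\<lambda>k. inverse (A (2 * k) / A k) + inverse (A (2 * k - 1) / A k)) \<longlonglongrightarrow> inverse 2 + inverse 2"
    by (intro tendsto_intros r1 r2) auto
  then have "(\<lambda>k. inverse (A (2 * k) / A k) + inverse (A (2 * k - 1) / A k)) \<longlonglongrightarrow> 1" by simp
  then have "\<forall>\<^sub>F k in sequentially. inverse (A (2 * k) / A k) + inverse (A (2 * k - 1) / A k) < 1 + \<eta> / 2"
    using \<open>\<eta> > 0\<close> by (intro order_tendstoD(2)) auto
  then have "\<forall>\<^sub>F k in sequentially. b k \<le> (1 + \<eta> / 2) * a k"
    using eventually_ge_at_top[of 1]
  proof eventually_elim
    case (elim k)
    have Ak: "A k > 0" using elim A_pos by simp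
    have "b k = (inverse (A (2 * k) / A k) + inverse (A (2 * k - 1) / A k)) * a k"
      using Ak by (simp add: b_def a_def add_divide_distrib)
    also have "\<dots> \<le> (1 + \<eta> / 2) * a k" using elim Ak by (intro mult_right_mono) (auto simp: a_def)
    finally show ?case .
  qed
  then obtain J where J: "\<And>k. k \<ge> J \<Longrightarrow> b k \<le> (1 + \<eta> / 2) * a k"
    by (auto simp: eventually_sequentially)
  have dbl: "Gsum A (2 * n) = (\<Sum>j=1..n. b j)" for n
    by (induction n) (auto simp: b_def)
  have "Gsum A (2 * (J + n)) \<le> Gsum A (2 * J) + (1 + \<eta> / 2) * (Gsum A (J + n) - Gsum A J)" for n
  proof (induction n)
    case (Suc n)
    have "b (Suc (J + n)) \<le> (1 + \<eta> / 2) * a (Suc (J + n))" by (rule J) simp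
    moreover have "Gsum A (2 * (J + Suc n)) = Gsum A (2 * (J + n)) + b (Suc (J + n))"
      unfolding dbl by simp
    moreover have "(1 + \<eta> / 2) * (Gsum A (J + Suc n) - Gsum A J) = (1 + \<eta> / 2) * (Gsum A (J + n) - Gsum A J) + (1 + \<eta> / 2) * a (Suc (J + n))"
      by (simp add: a_def right_diff_distrib distrib_left)
    ultimately show ?case using Suc by (simp only:)
  qed simp
  then have up: "Gsum A (2 * n) \<le> Gsum A (2 * J) + (1 + \<eta> / 2) * Gsum A n" if "J \<le> n" for n
  proof -
    have "mono (Gsum A)" by (rule Gsum_mono) (rule A_pos)
    then have "0 \<le> Gsum A J" using monoD[of "Gsum A" 0 J] by simp
    then have "0 \<le> (1 + \<eta> / 2) * Gsum A J" using \<open>\<eta> > 0\<close> by simp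
    moreover assume "\<And>n. Gsum A (2 * (J + n)) \<le> Gsum A (2 * J) + (1 + \<eta> / 2) * (Gsum A (J + n) - Gsum A J)"
    from this[of "n - J"] that have "Gsum A (2 * n) \<le> Gsum A (2 * J) + (1 + \<eta> / 2) * (Gsum A n - Gsum A J)" by simp
    ultimately show ?thesis by (simp add: right_diff_distrib)
  qed
  have "\<forall>\<^sub>F n in sequentially. 2 * Gsum A (2 * J) / \<eta> \<le> Gsum A n"
    using Ginf by (simp add: filterlim_at_top)
  then show ?thesis
    using eventually_ge_at_top[of J]
  proof eventually_elim
    case (elim n)
    then have "Gsum A (2 * J) \<le> \<eta> / 2 * Gsum A n" using \<open>\<eta> > 0\<close> by (simp add: field_simps)
    then show ?case using up[OF elim(2)] by (simp add: distrib_right)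
  qed
qed

end

text \<open>The start changes with \<open>e\<close>, so every \<open>e\<close> has its own process.
  Only the laws of the partial sums, common to all, and the numbers \<open>V e n\<close> are
  retained, linked by renewal inequalities for arbitrary bounds \<open>lo\<close> and
  \<open>hi\<close>.\<close>

locale attracted_hitting = stable_attraction +
  fixes L :: "nat \<Rightarrow> real measure" and V :: "real \<Rightarrow> nat \<Rightarrow> real"
  assumes L: "\<And>k. real_distribution (L k)" "\<And>k s. char (L k) s = char \<nu> s ^ k"
    and V_bounds: "\<And>e n. 0 \<le> V e n" "\<And>e n. V e n \<le> 1"
    and V_antimono: "\<And>e m n. e > 0 \<Longrightarrow> m \<le> n \<Longrightarrow> V e n \<le> V e m"
    and renewal: "\<And>e lo hi N. e > 0 \<Longrightarrow>
      (\<And>k y. \<bar>y\<bar> < e \<Longrightarrow> lo k \<le> measure (L k) {y - e<..<y + e}) \<Longrightarrow>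
      (\<And>k y. \<bar>y\<bar> < e \<Longrightarrow> measure (L k) {y - e<..<y + e} \<le> hi k) \<Longrightarrow>
      (\<Sum>k\<le>N. lo k * V e (N - k)) \<le> 1 \<and> 1 \<le> (\<Sum>k\<le>N. hi k * V e (N - k))"
    and Ginf: "filterlim (Gsum A) at_top sequentially"
begin

definition z :: "nat \<Rightarrow> real" where "z k = measure (L k) {0}"

lemma window_errorD:
  assumes "window_error k \<eta> r" "0 < e" "e \<le> 1/2" "\<bar>y\<bar> \<le> 1"
  shows "\<bar>measure (L k) {y - e<..<y + e} - 2 * e * dens0 / A k\<bar> \<le> e * \<eta> / A k + r"
  using assms L by (auto simp: window_error_def)

lemma z_nonneg: "0 \<le> z k" by (simp add: z_def)

text \<open>An atom at 0 lies in every centred window; letting \<open>e\<close> tend to 0 for fixed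
  \<open>k\<close> removes the main term and leaves the geometric error.\<close>

lemma z_summable: "summable z"
proof -
  obtain \<rho> where \<rho>: "0 < \<rho>" "\<rho> < 1" and
    w: "\<And>\<eta>. \<eta> > 0 \<Longrightarrow> \<exists>C\<ge>0. \<forall>\<^sub>F k in sequentially. window_error k \<eta> (C * \<rho> ^ k)"
    using window_local_limit by blast
  obtain C K where C: "C \<ge> 0" and K: "\<And>k. k \<ge> K \<Longrightarrow> window_error k 1 (C * \<rho> ^ k)"
    using w[OF zero_less_one] unfolding eventually_sequentially by blast
  have zle: "z k \<le> C * \<rho> ^ k" if "k \<ge> K" for k
  proof -
    interpret Lk: real_distribution "L k" by (rule L)
    have "((\<lambda>e. e * 1 / A k + C * \<rho> ^ k + 2 * e * dens0 / A k) \<longlongrightarrow> 0 * 1 / A k + C * \<rho> ^ k + 2 * 0 * dens0 / A k) (at_right 0)"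
      by (cases "A k = 0") (auto intro!: tendsto_eq_intros)
    then have lim: "((\<lambda>e. e * 1 / A k + C * \<rho> ^ k + 2 * e * dens0 / A k) \<longlongrightarrow> C * \<rho> ^ k) (at_right 0)" by simp
    have "\<forall>\<^sub>F e in at_right 0. e < (1/2::real)"
      by (rule order_tendstoD(2)[OF tendsto_ident_at]) simp
    moreover have "\<forall>\<^sub>F e in at_right 0. (0::real) < e" by (rule eventually_at_right_less)
    ultimately have "\<forall>\<^sub>F e in at_right 0. z k \<le> e * 1 / A k + C * \<rho> ^ k + 2 * e * dens0 / A k"
    proof eventually_elim
      case (elim e)
      have "z k \<le> measure (L k) {0 - e<..<0 + e}"
        unfolding z_def using elim by (intro Lk.finite_measure_mono) auto
      then show ?case using window_errorD[OF K[OF that], of e 0] elim by (simp add: abs_le_iff)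
    qed
    then show ?thesis by (rule tendsto_lowerbound[OF lim]) simp
  qed
  show ?thesis
  proof (rule summable_comparison_test)
    show "\<exists>N. \<forall>n\<ge>N. norm (z n) \<le> C * \<rho> ^ n"
      using zle z_nonneg by (intro exI[of _ K]) auto
    show "summable (\<lambda>n. C * \<rho> ^ n)" using \<rho> by (intro summable_mult summable_geometric) auto
  qed
qed

text \<open>With horizon \<open>n\<close>, monotonicity \<open>V e (n - k) \<ge> V e n\<close>
  bounds \<open>Q * V e n\<close> above by nearly 1. With horizon \<open>2 * n\<close>,
  \<open>V e (2 * n - k) \<le> V e n\<close> for \<open>k \<le> n\<close>, and the times beyond
  \<open>n\<close> are negligible by slow variation of \<open>G\<close>, which gives the matching
  lower bound.\<close>

lemma V_limit:
  assumes nn: "filterlim nn at_top (at_right 0)" and eG: "((\<lambda>e. e * Gsum A (nn e)) \<longlongrightarrow> c) (at_right 0)"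
    and d0: "dens0 \<ge> 0" and c: "c \<ge> 0"
  shows "((\<lambda>e. V e (nn e) * (suminf z + 2 * dens0 * c)) \<longlongrightarrow> 1) (at_right (0::real))"
proof -
  obtain \<rho> where \<rho>: "0 < \<rho>" "\<rho> < 1" and
    w: "\<And>\<eta>. \<eta> > 0 \<Longrightarrow> \<exists>C\<ge>0. \<forall>\<^sub>F k in sequentially. window_error k \<eta> (C * \<rho> ^ k)"
    using window_local_limit by blast
  define Q where "Q = suminf z + 2 * dens0 * c"
  have small: "\<forall>\<^sub>F e in at_right 0. \<bar>V e (nn e) * Q - 1\<bar> \<le> 2 * d" if "d > 0" for d
  proof -
    \<comment> \<open>Four error sources share \<open>d\<close> equally: the relative error
      \<open>\<eta>\<close>, the truncated sum of \<open>z\<close>, the geometric tail, and the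
      passage to the limit in \<open>e\<close>.\<close>
    define \<eta> where "\<eta> = d / (4 * (c + 1))"
    have \<eta>: "\<eta> > 0" "\<eta> * c \<le> d / 4"
    proof -
      show "\<eta> > 0" using that c by (simp add: \<eta>_def)
      have "\<eta> * c \<le> \<eta> * (c + 1)" using \<open>\<eta> > 0\<close> by simp
      also have "\<dots> = d / 4"
      proof -
        have "c + 1 \<noteq> 0" using c by simp
        then show ?thesis unfolding \<eta>_def by (simp del: distrib_left_numeral)
      qed
      finally show "\<eta> * c \<le> d / 4" .
    qed
    obtain C K0 where C: "C \<ge> 0" and K0: "\<And>k. k \<ge> K0 \<Longrightarrow> window_error k \<eta> (C * \<rho> ^ k)"
      using w[OF \<eta>(1)] unfolding eventually_sequentially by blast
    have "(\<lambda>K. \<Sum>k<K. z k) \<longlonglongrightarrow> suminf z" using z_summable by (rule summable_LIMSEQ)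
    then have ev1: "\<forall>\<^sub>F K in sequentially. suminf z - d / 4 < (\<Sum>k<K. z k)"
      using that by (intro order_tendstoD(1)) auto
    have "(\<lambda>K. C * (\<rho> ^ K / (1 - \<rho>))) \<longlonglongrightarrow> C * (0 / (1 - \<rho>))"
      using \<rho> by (intro tendsto_intros LIMSEQ_power_zero) auto
    then have ev2: "\<forall>\<^sub>F K in sequentially. C * (\<rho> ^ K / (1 - \<rho>)) < d / 4"
      using that by (intro order_tendstoD(2)) auto
    have "\<forall>\<^sub>F K in sequentially. 1 \<le> K \<and> K0 \<le> K \<and> suminf z - d / 4 < (\<Sum>k<K. z k) \<and> C * (\<rho> ^ K / (1 - \<rho>)) < d / 4"
      using ev1 ev2 eventually_ge_at_top[of 1] eventually_ge_at_top[of K0] by eventually_elim simp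
    then obtain K where K: "1 \<le> K" "K0 \<le> K" "suminf z - d / 4 < (\<Sum>k<K. z k)" "C * (\<rho> ^ K / (1 - \<rho>)) < d / 4"
      unfolding eventually_sequentially by blast
    have zK: "(\<Sum>k<K. z k) \<le> suminf z"
      using z_summable z_nonneg by (intro sum_le_suminf) auto
    \<comment> \<open>For \<open>|y| < e\<close> the window around \<open>y\<close> contains 0 and
      lies in \<open>(-2 * e, 2 * e)\<close>; hence \<open>z\<close> as lower and \<open>zz\<close>
      as upper bound at the finitely many times below \<open>K\<close>.\<close>
    define zz where "zz e k = measure (L k) {- (2 * e)<..<2 * e}" for e k
    have zz: "((\<lambda>e. \<Sum>k<K. zz e k) \<longlongrightarrow> (\<Sum>k<K. z k)) (at_right 0)"
    proof (rule tendsto_sum)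
      fix k
      interpret Lk: real_distribution "L k" by (rule L)
      have "filterlim (\<lambda>e::real. 2 * e) (at_right 0) (at_right 0)"
        unfolding filterlim_at
        by (auto intro!: tendsto_eq_intros eventually_mono[OF eventually_at_right_less[of "0::real"]])
      then show "((\<lambda>e. zz e k) \<longlongrightarrow> z k) (at_right 0)"
        unfolding zz_def z_def by (rule filterlim_compose[OF Lk.tendsto_measure_shrinking_interval])
    qed
    have lowlim: "((\<lambda>e. (2 * dens0 - \<eta>) * (e * Gsum A (nn e) - e * Gsum A (K - 1))) \<longlongrightarrow> (2 * dens0 - \<eta>) * (c - 0 * Gsum A (K - 1))) (at_right 0)"
      by (intro tendsto_intros eG)
    have uplim: "((\<lambda>e. (\<Sum>k<K. zz e k) + (2 * dens0 + \<eta>) * (e * Gsum A (nn e) - e * Gsum A (K - 1))) \<longlongrightarrow> (\<Sum>k<K. z k) + (2 * dens0 + \<eta>) * (c - 0 * Gsum A (K - 1))) (at_right 0)"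
      by (intro tendsto_intros eG zz)
    \<comment> \<open>\<open>\<theta>\<close> bounds the relative increase of \<open>G\<close> from
      \<open>n\<close> to \<open>2 * n\<close>; with this choice the main term of the block beyond
      \<open>n\<close> costs at most \<open>d / 4\<close>.\<close>
    define \<theta> where "\<theta> = d / (4 * ((2 * dens0 + \<eta>) * (c + 1)))"
    define r where "r = (2 * dens0 + \<eta>) * (c + 1)"
    have r: "r > 0" unfolding r_def using \<eta> d0 c by (intro mult_pos_pos) auto
    have "\<theta> > 0" unfolding \<theta>_def r_def[symmetric] using r that by simp
    moreover have "(2 * dens0 + \<eta>) * (\<theta> * (c + 1)) = \<theta> * r" by (simp add: r_def)
    moreover have "\<theta> * r = d / 4" unfolding \<theta>_def r_def[symmetric] using r by simp
    ultimately have \<theta>: "\<theta> > 0" "(2 * dens0 + \<eta>) * (\<theta> * (c + 1)) = d / 4" by simp_all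
    have dbl: "\<forall>\<^sub>F e in at_right 0. Gsum A (2 * nn e) - Gsum A (nn e) \<le> \<theta> * Gsum A (nn e)"
      using Gsum_double_le[OF Ginf \<theta>(1)] nn unfolding filterlim_iff by blast
    have nnK: "\<forall>\<^sub>F e in at_right 0. K \<le> nn e" using nn by (simp add: filterlim_at_top)
    have E1: "\<forall>\<^sub>F e in at_right 0. (2 * dens0 - \<eta>) * c - d / 4 < (2 * dens0 - \<eta>) * (e * Gsum A (nn e) - e * Gsum A (K - 1))"
      by (rule order_tendstoD(1)[OF lowlim]) (use that in simp)
    have E2: "\<forall>\<^sub>F e in at_right 0. (\<Sum>k<K. zz e k) + (2 * dens0 + \<eta>) * (e * Gsum A (nn e) - e * Gsum A (K - 1)) < (\<Sum>k<K. z k) + (2 * dens0 + \<eta>) * c + d / 4"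
      by (rule order_tendstoD(2)[OF uplim]) (use that in simp)
    have E3: "\<forall>\<^sub>F e in at_right 0. e * Gsum A (nn e) < c + 1" by (rule order_tendstoD(2)[OF eG]) simp
    have E4: "\<forall>\<^sub>F e in at_right 0. e < (1/2::real)"
      by (rule order_tendstoD(2)[OF tendsto_ident_at]) simp
    have E5: "\<forall>\<^sub>F e in at_right 0. (0::real) < e" by (rule eventually_at_right_less)
    show ?thesis
      using dbl nnK E1 E2 E3 E4 E5
    proof eventually_elim
      case (elim e)
      define n where "n = nn e"
      have e: "0 < e" "e \<le> 1/2" and Kn: "K \<le> n" using elim by (auto simp: n_def)
      define lo where "lo k = (if k < K then z k else (2 * dens0 - \<eta>) * e * (1 / A k) - C * \<rho> ^ k)" for k
      define hi where "hi k = (if k < K then zz e k else (2 * dens0 + \<eta>) * e * (1 / A k) + C * \<rho> ^ k)" for k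
      have bl: "lo k \<le> measure (L k) {y - e<..<y + e}" "measure (L k) {y - e<..<y + e} \<le> hi k" if y: "\<bar>y\<bar> < e" for k y
      proof -
        interpret Lk: real_distribution "L k" by (rule L)
        have s: "2 * e * dens0 / A k - e * \<eta> / A k = (2 * dens0 - \<eta>) * e * (1 / A k)"
            "2 * e * dens0 / A k + e * \<eta> / A k = (2 * dens0 + \<eta>) * e * (1 / A k)"
          by (simp_all add: algebra_simps diff_divide_distrib add_divide_distrib)
        have big: "\<bar>measure (L k) {y - e<..<y + e} - 2 * e * dens0 / A k\<bar> \<le> e * \<eta> / A k + C * \<rho> ^ k" if "\<not> k < K"
          using that K(2) e y by (intro window_errorD K0) auto
        show "lo k \<le> measure (L k) {y - e<..<y + e}"
        proof (cases "k < K")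
          case True
          then show ?thesis unfolding lo_def z_def using y e by (auto intro!: Lk.finite_measure_mono)
        next
          case False
          then show ?thesis unfolding lo_def s[symmetric] using big[OF False] by (simp add: abs_le_iff)
        qed
        show "measure (L k) {y - e<..<y + e} \<le> hi k"
        proof (cases "k < K")
          case True
          then show ?thesis unfolding hi_def zz_def using y e by (auto intro!: Lk.finite_measure_mono)
        next
          case False
          then show ?thesis unfolding hi_def s[symmetric] using big[OF False] by (simp add: abs_le_iff)
        qed
      qed
      \<comment> \<open>\<open>lo k\<close> may be negative beyond \<open>K\<close>, which would
        reverse the comparison of \<open>V e (n - k)\<close> with \<open>V e n\<close>; truncated at
        0 it is still a valid bound.\<close>
      have bl0: "max 0 (lo k) \<le> measure (L k) {y - e<..<y + e}" if "\<bar>y\<bar> < e" for k y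
        using bl(1)[OF that, of k] by simp
      have hi0: "0 \<le> hi k" for k
        using order_trans[OF measure_nonneg bl(2)[of 0 k]] e by simp
      have split_sum: "(\<Sum>k\<le>N. (if k < K then u k else v k)) = (\<Sum>k<K. u k) + (\<Sum>k=K..N. v k)" if "K \<le> N" for u v :: "nat \<Rightarrow> real" and N
      proof -
        have "{..N} = {..<K} \<union> {K..N}" using that by auto
        then have "(\<Sum>k\<le>N. (if k < K then u k else v k)) = (\<Sum>k\<in>{..<K} \<union> {K..N}. (if k < K then u k else v k))"
          by (simp only:)
        also have "\<dots> = (\<Sum>k<K. (if k < K then u k else v k)) + (\<Sum>k=K..N. (if k < K then u k else v k))"
          by (rule sum.union_disjoint) auto
        finally show ?thesis by simp
      qed
      have tail: "(\<Sum>k=K'..N. C * \<rho> ^ k) \<le> C * (\<rho> ^ K' / (1 - \<rho>))" for K' N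
        unfolding sum_distrib_left[symmetric] using C sum_power_tail_le[OF \<rho>] by (intro mult_left_mono) auto
      have Gs: "(\<Sum>k=K'..N. x * e * (1 / A k)) = x * (e * Gsum A N - e * Gsum A (K' - 1))" if "1 \<le> K'" "K' \<le> Suc N" for x K' N
        unfolding sum_distrib_left[symmetric] sum_inverse_eq_Gsum_diff[OF that] by (simp add: algebra_simps)

      have "(\<Sum>k\<le>n. lo k) = (\<Sum>k<K. z k) + ((\<Sum>k=K..n. (2 * dens0 - \<eta>) * e * (1 / A k)) - (\<Sum>k=K..n. C * \<rho> ^ k))"
        unfolding lo_def split_sum[OF Kn] by (simp add: sum_subtractf)
      moreover have "(\<Sum>k=K..n. (2 * dens0 - \<eta>) * e * (1 / A k)) = (2 * dens0 - \<eta>) * (e * Gsum A n - e * Gsum A (K - 1))"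
        using K(1) Kn by (intro Gs) auto
      moreover have "(2 * dens0 - \<eta>) * c = 2 * dens0 * c - \<eta> * c" by (simp add: algebra_simps)
      ultimately have losum: "Q - d \<le> (\<Sum>k\<le>n. lo k)"
        using tail[of K n] K(3,4) elim(3) \<eta>(2) unfolding Q_def n_def by linarith
      have "(\<Sum>k\<le>n. lo k) * V e n \<le> (\<Sum>k\<le>n. max 0 (lo k) * V e (n - k))"
        unfolding sum_distrib_right
      proof (rule sum_mono)
        fix k
        have "lo k * V e n \<le> max 0 (lo k) * V e n" using V_bounds by (intro mult_right_mono) auto
        also have "\<dots> \<le> max 0 (lo k) * V e (n - k)" using V_antimono[OF e(1), of "n - k" n] by (intro mult_left_mono) auto
        finally show "lo k * V e n \<le> max 0 (lo k) * V e (n - k)" .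
      qed
      also have "\<dots> \<le> 1" using renewal[OF e(1) bl0 bl(2), where N = n] by blast
      finally have "(\<Sum>k\<le>n. lo k) * V e n \<le> 1" .
      moreover have "(Q - d) * V e n \<le> (\<Sum>k\<le>n. lo k) * V e n" using losum V_bounds by (intro mult_right_mono) auto
      ultimately have "(Q - d) * V e n \<le> 1" by simp
      then have "Q * V e n \<le> 1 + d * V e n" by (simp add: left_diff_distrib)
      moreover have dV: "d * V e n \<le> d" "0 \<le> d * V e n" using that V_bounds by (auto intro: mult_left_le)
      ultimately have upper: "Q * V e n \<le> 1 + 2 * d" using that by linarith

      have "(\<Sum>k\<le>n. hi k) = (\<Sum>k<K. zz e k) + ((\<Sum>k=K..n. (2 * dens0 + \<eta>) * e * (1 / A k)) + (\<Sum>k=K..n. C * \<rho> ^ k))"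
        unfolding hi_def split_sum[OF Kn] by (simp add: sum.distrib)
      moreover have "(\<Sum>k=K..n. (2 * dens0 + \<eta>) * e * (1 / A k)) = (2 * dens0 + \<eta>) * (e * Gsum A n - e * Gsum A (K - 1))"
        using K(1) Kn by (intro Gs) auto
      moreover have "(2 * dens0 + \<eta>) * c = 2 * dens0 * c + \<eta> * c" by (simp add: algebra_simps)
      ultimately have hisum: "(\<Sum>k\<le>n. hi k) \<le> Q + d"
        using tail[of K n] K(4) zK elim(4) \<eta>(2) that unfolding Q_def n_def by linarith
      have "(\<Sum>k=Suc n..2 * n. hi k) = (\<Sum>k=Suc n..2 * n. (2 * dens0 + \<eta>) * e * (1 / A k) + C * \<rho> ^ k)"
        by (rule sum.cong) (use Kn in \<open>auto simp: hi_def\<close>)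
      also have "\<dots> = (\<Sum>k=Suc n..2 * n. (2 * dens0 + \<eta>) * e * (1 / A k)) + (\<Sum>k=Suc n..2 * n. C * \<rho> ^ k)"
        by (rule sum.distrib)
      also have "(\<Sum>k=Suc n..2 * n. (2 * dens0 + \<eta>) * e * (1 / A k)) = (2 * dens0 + \<eta>) * (e * Gsum A (2 * n) - e * Gsum A n)"
        by (subst Gs) auto
      also have "e * Gsum A (2 * n) - e * Gsum A n \<le> \<theta> * (c + 1)"
      proof -
        have "e * Gsum A (2 * n) - e * Gsum A n = e * (Gsum A (2 * n) - Gsum A n)" by (simp add: right_diff_distrib)
        also have "\<dots> \<le> e * (\<theta> * Gsum A n)" using elim(1) e by (intro mult_left_mono) (auto simp: n_def)
        also have "\<dots> = \<theta> * (e * Gsum A n)" by simp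
        also have "\<dots> \<le> \<theta> * (c + 1)" using elim(5) \<theta> by (intro mult_left_mono) (auto simp: n_def)
        finally show ?thesis .
      qed
      also have "(\<Sum>k=Suc n..2 * n. C * \<rho> ^ k) \<le> C * (\<rho> ^ Suc n / (1 - \<rho>))" by (rule tail)
      also have "C * (\<rho> ^ Suc n / (1 - \<rho>)) \<le> C * (\<rho> ^ K / (1 - \<rho>))"
        using C \<rho> Kn by (intro mult_left_mono divide_right_mono power_decreasing) auto
      finally have "(\<Sum>k=Suc n..2 * n. hi k) \<le> (2 * dens0 + \<eta>) * (\<theta> * (c + 1)) + C * (\<rho> ^ K / (1 - \<rho>))"
        using \<eta>(1) d0 by simp
      then have tail2: "(\<Sum>k=Suc n..2 * n. hi k) \<le> d"
        unfolding \<theta>(2) using K(4) that by linarith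
      have "1 \<le> (\<Sum>k\<le>2 * n. hi k * V e (2 * n - k))"
        using renewal[OF e(1) bl, where N = "2 * n"] by blast
      also have "{..2 * n} = {..n} \<union> {Suc n..2 * n}" by auto
      also have "(\<Sum>k\<in>{..n} \<union> {Suc n..2 * n}. hi k * V e (2 * n - k)) = (\<Sum>k\<le>n. hi k * V e (2 * n - k)) + (\<Sum>k=Suc n..2 * n. hi k * V e (2 * n - k))"
        by (rule sum.union_disjoint) auto
      also have "(\<Sum>k\<le>n. hi k * V e (2 * n - k)) \<le> (\<Sum>k\<le>n. hi k * V e n)"
        using hi0 V_antimono[OF e(1)] by (intro sum_mono mult_left_mono) auto
      also have "(\<Sum>k\<le>n. hi k * V e n) = (\<Sum>k\<le>n. hi k) * V e n" by (simp add: sum_distrib_right)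
      also have "(\<Sum>k\<le>n. hi k) * V e n \<le> (Q + d) * V e n" using hisum V_bounds by (intro mult_right_mono) auto
      also have "(\<Sum>k=Suc n..2 * n. hi k * V e (2 * n - k)) \<le> (\<Sum>k=Suc n..2 * n. hi k)"
        using hi0 V_bounds by (intro sum_mono mult_left_le) auto
      also note tail2
      finally have "1 \<le> (Q + d) * V e n + d" by simp
      then have "1 \<le> Q * V e n + d * V e n + d" by (simp add: distrib_right)
      then have lower: "1 - 2 * d \<le> Q * V e n" using dV by linarith
      show ?case using upper lower by (simp add: n_def[symmetric] abs_le_iff mult.commute)
    qed
  qed
  show ?thesis
    unfolding Q_def[symmetric]
  proof (rule tendstoI)
    fix d :: real assume "d > 0"
    then have "\<forall>\<^sub>F e in at_right 0. \<bar>V e (nn e) * Q - 1\<bar> \<le> 2 * (d / 4)" by (intro small) simp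
    then show "\<forall>\<^sub>F e in at_right 0. dist (V e (nn e) * Q) 1 < d"
    proof eventually_elim
      case (elim e)
      then show ?case using \<open>d > 0\<close> by (simp add: dist_real_def)
    qed
  qed
qed

end

section \<open>Recurrence, escape probability and the limit law\<close>

text \<open>If the monotone \<open>G\<close> were bounded, \<open>1 / A k\<close> would be summable,
  and so would the visit probabilities, by the local limit theorem with \<open>e = 1/2\<close>.
  Recurrence will exclude that.\<close>

lemma (in stable_attraction) Gsum_at_top:
  assumes L: "\<And>k. real_distribution (L k)" "\<And>k s. char (L k) s = char \<nu> s ^ k"
    and div: "\<not> summable (\<lambda>k. measure (L k) {- (1/2)<..<1/2})"
  shows "filterlim (Gsum A) at_top sequentially"
proof (rule ccontr)
  assume "\<not> ?thesis"
  then obtain Z where Z: "\<not> (\<forall>\<^sub>F n in sequentially. Z \<le> Gsum A n)"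
    by (auto simp: filterlim_at_top)
  have mono: "mono (Gsum A)" by (rule Gsum_mono) (rule A_pos)
  have GZ: "Gsum A n \<le> Z" for n
  proof (rule ccontr)
    assume "\<not> ?thesis"
    then have "\<forall>m\<ge>n. Z \<le> Gsum A m" using monoD[OF mono, of n] by (meson dual_order.trans less_imp_le not_le)
    then show False using Z by (auto simp: eventually_sequentially)
  qed
  have "(\<Sum>k<n. 1 / A (Suc k)) = Gsum A n" for n
    by (induction n) auto
  then have "summable (\<lambda>k. 1 / A (Suc k))"
    using GZ A_pos by (intro summableI_nonneg_bounded[where x = Z]) (auto intro: less_imp_le)
  then have sA: "summable (\<lambda>k. 1 / A k)" by (subst (asm) summable_Suc_iff)
  obtain \<rho> where \<rho>: "0 < \<rho>" "\<rho> < 1" and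
    w: "\<And>\<eta>. \<eta> > 0 \<Longrightarrow> \<exists>C\<ge>0. \<forall>\<^sub>F k in sequentially. window_error k \<eta> (C * \<rho> ^ k)"
    using window_local_limit by blast
  obtain C K where K: "\<And>k. k \<ge> K \<Longrightarrow> window_error k 1 (C * \<rho> ^ k)"
    using w[OF zero_less_one] unfolding eventually_sequentially by blast
  have "summable (\<lambda>k. measure (L k) {- (1/2)<..<1/2})"
  proof (rule summable_comparison_test)
    show "summable (\<lambda>k. (dens0 + 1/2) * (1 / A k) + C * \<rho> ^ k)"
      using \<rho> by (intro summable_add summable_mult sA summable_geometric) auto
    have "norm (measure (L k) {- (1/2)<..<1/2}) \<le> (dens0 + 1/2) * (1 / A k) + C * \<rho> ^ k" if "k \<ge> K" for k
    proof -
      have "\<bar>measure (L k) {0 - 1/2<..<0 + 1/2} - 2 * (1/2) * dens0 / A k\<bar> \<le> 1/2 * 1 / A k + C * \<rho> ^ k"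
        by (intro K[OF that, unfolded window_error_def, rule_format] L) auto
      then have "measure (L k) {- (1/2)<..<1/2} \<le> dens0 / A k + 1/2 / A k + C * \<rho> ^ k" by simp
      then show ?thesis by (simp add: add_divide_distrib)
    qed
    then show "\<exists>N. \<forall>k\<ge>N. norm (measure (L k) {- (1/2)<..<1/2}) \<le> (dens0 + 1/2) * (1 / A k) + C * \<rho> ^ k" by blast
  qed
  with div show False by contradiction
qed

context iid_walk
begin

definition escape :: real where "escape = prob {\<omega> \<in> space M. \<forall>m\<ge>1. S m \<omega> \<noteq> 0}"

lemma avoid_zero_eq: "avoid {0} n 0 = prob {\<omega> \<in> space M. \<forall>j\<in>{1..n}. S j \<omega> \<noteq> 0}"
  by (simp add: avoid_def)

lemma avoid_zero_tendsto: "(\<lambda>n. avoid {0} n 0) \<longlonglongrightarrow> escape"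
proof -
  have "(\<lambda>n. prob {\<omega> \<in> space M. \<forall>j\<in>{1..n}. S j \<omega> \<noteq> 0}) \<longlonglongrightarrow> prob (\<Inter>n. {\<omega> \<in> space M. \<forall>j\<in>{1..n}. S j \<omega> \<noteq> 0})"
    by (rule finite_Lim_measure_decseq) (auto simp: decseq_def)
  also have "(\<Inter>n. {\<omega> \<in> space M. \<forall>j\<in>{1..n}. S j \<omega> \<noteq> 0}) = {\<omega> \<in> space M. \<forall>m\<ge>1. S m \<omega> \<noteq> 0}"
    by (auto, metis atLeastAtMost_iff le_refl One_nat_def)
  finally show ?thesis unfolding avoid_zero_eq escape_def .
qed

lemma avoid_antimono: "m \<le> n \<Longrightarrow> avoid {0} n y \<le> avoid {0} m y"
  unfolding avoid_def by (intro finite_measure_mono) auto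

lemma escape_le_avoid: "escape \<le> avoid {0} n 0"
  unfolding avoid_zero_eq escape_def by (intro finite_measure_mono) auto

text \<open>The two-horizon argument in exact form: \<open>escape\<close> lies below every
  \<open>avoid\<close>, and with horizon \<open>2 * n\<close> the times beyond \<open>n\<close> form
  a vanishing tail of a convergent series. The identity also yields \<open>escape > 0\<close>, so
  the conditioning is nondegenerate.\<close>

lemma escape_mult_suminf:
  assumes sum: "summable (\<lambda>k. prob {\<omega> \<in> space M. S k \<omega> = 0})"
  shows "escape * (\<Sum>k. prob {\<omega> \<in> space M. S k \<omega> = 0}) = 1"
proof -
  define z where "z k = prob {\<omega> \<in> space M. S k \<omega> = 0}" for k
  define q where "q n = avoid {0} n 0" for n
  have z0: "0 \<le> z k" for k by (simp add: z_def)
  have q0: "0 \<le> q n" "q n \<le> 1" for n by (auto simp: q_def avoid_bounds)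
  have ren: "(\<Sum>k\<le>N. z k * q (N - k)) = 1" for N
    unfolding z_def q_def by (rule zero_renewal)
  have T: "(\<lambda>n. \<Sum>k\<le>n. z k) \<longlonglongrightarrow> suminf z"
    using sum unfolding z_def by (rule summable_LIMSEQ')
  have "(\<Sum>k\<le>N. z k) * escape \<le> 1" for N
  proof -
    have "(\<Sum>k\<le>N. z k) * escape \<le> (\<Sum>k\<le>N. z k * q (N - k))"
      unfolding sum_distrib_right q_def by (intro sum_mono mult_left_mono escape_le_avoid z0)
    then show ?thesis using ren by simp
  qed
  then have 1: "suminf z * escape \<le> 1"
    by (intro LIMSEQ_le_const2[OF tendsto_mult[OF T tendsto_const]]) auto
  have "1 \<le> (\<Sum>k\<le>n. z k) * q n + ((\<Sum>k\<le>2 * n. z k) - (\<Sum>k\<le>n. z k))" for n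
  proof -
    have un: "{..2 * n} = {..n} \<union> {Suc n..2 * n}" by auto
    have spl: "(\<Sum>k\<le>2 * n. g k) = (\<Sum>k\<le>n. g k) + (\<Sum>k=Suc n..2 * n. g k)" for g :: "nat \<Rightarrow> real"
      unfolding un by (rule sum.union_disjoint) auto
    have "1 = (\<Sum>k\<le>n. z k * q (2 * n - k)) + (\<Sum>k=Suc n..2 * n. z k * q (2 * n - k))"
      unfolding ren[of "2 * n", symmetric] by (rule spl)
    also have "\<dots> \<le> (\<Sum>k\<le>n. z k * q n) + (\<Sum>k=Suc n..2 * n. z k)"
      using z0 q0 by (intro add_mono sum_mono mult_left_mono mult_left_le) (auto simp: q_def intro!: avoid_antimono)
    also have "(\<Sum>k\<le>n. z k * q n) = (\<Sum>k\<le>n. z k) * q n" by (simp add: sum_distrib_right)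
    finally show ?thesis unfolding spl[of z] by simp
  qed
  moreover have "(\<lambda>n. (\<Sum>k\<le>n. z k) * q n + ((\<Sum>k\<le>2 * n. z k) - (\<Sum>k\<le>n. z k))) \<longlonglongrightarrow> suminf z * escape + (suminf z - suminf z)"
    unfolding q_def
  proof (intro tendsto_intros T avoid_zero_tendsto)
    have "strict_mono (\<lambda>n::nat. 2 * n)" by (simp add: strict_mono_def)
    from LIMSEQ_subseq_LIMSEQ[OF T this] show "(\<lambda>n. \<Sum>k\<le>2 * n. z k) \<longlonglongrightarrow> suminf z" by (simp add: o_def)
  qed
  ultimately have 2: "1 \<le> suminf z * escape + (suminf z - suminf z)"
    by (intro LIMSEQ_le_const) auto
  have "suminf z * escape = 1" using 1 2 by simp
  then show ?thesis unfolding z_def[abs_def] by (simp add: mult.commute)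
qed

end

text \<open>\<open>nn\<close> is the generalised inverse of \<open>G\<close> at level
  \<open>t / (\<gamma> * e)\<close>; it turns the condition on \<open>G\<close> at the hitting time
  into a bound on that time. Bounded increments keep \<open>G (nn e)\<close> within \<open>b\<close>
  of the level, which is negligible after multiplication by \<open>e\<close>.\<close>

lemma level_index:
  fixes G :: "nat \<Rightarrow> real"
  assumes mono: "mono G" and G0: "G 0 = 0" and Ginf: "filterlim G at_top sequentially"
    and step: "\<And>n. G (Suc n) \<le> G n + b" and g: "\<gamma> > 0" and t: "t > 0"
  obtains nn :: "real \<Rightarrow> nat" where
    "\<And>e n. e > 0 \<Longrightarrow> \<gamma> * e * G n \<le> t \<longleftrightarrow> n \<le> nn e"
    "filterlim nn at_top (at_right 0)"
    "((\<lambda>e. e * G (nn e)) \<longlongrightarrow> t / \<gamma>) (at_right 0)"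
proof -
  define nn where "nn e = Max {n. \<gamma> * e * G n \<le> t}" for e
  have key: "\<gamma> * e * G n \<le> t \<longleftrightarrow> n \<le> nn e" if e: "e > 0" for e n
  proof -
    let ?P = "{n. \<gamma> * e * G n \<le> t}"
    have ge: "\<gamma> * e > 0" using g e by simp
    have "\<forall>\<^sub>F n in sequentially. t / (\<gamma> * e) + 1 \<le> G n" using Ginf by (simp add: filterlim_at_top)
    then obtain m where m: "\<And>n. n \<ge> m \<Longrightarrow> t / (\<gamma> * e) + 1 \<le> G n" by (auto simp: eventually_sequentially)
    have "n < m" if "n \<in> ?P" for n
    proof (rule ccontr)
      assume "\<not> n < m"
      then have "t / (\<gamma> * e) < G n" using m[of n] by simp
      then have "t < \<gamma> * e * G n" using ge by (simp add: field_simps)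
      with that show False by simp
    qed
    then have fin: "finite ?P" by (meson finite_lessThan finite_subset lessThan_iff subsetI)
    have ne: "0 \<in> ?P" using t G0 by simp
    have "nn e \<in> ?P" unfolding nn_def using fin ne by (intro Max_in) auto
    moreover have "\<gamma> * e * G n \<le> \<gamma> * e * G (nn e)" if "n \<le> nn e"
      using monoD[OF mono that] ge by (intro mult_left_mono) auto
    moreover have "n \<le> nn e" if "n \<in> ?P" unfolding nn_def using fin that by (rule Max_ge)
    ultimately show ?thesis by auto
  qed
  have pos: "\<forall>\<^sub>F e in at_right 0. (0::real) < e" by (rule eventually_at_right_less)
  show ?thesis
  proof (rule that[of nn, OF key])
    show "filterlim nn at_top (at_right 0)"
      unfolding filterlim_at_top
    proof
      fix Z
      have "((\<lambda>e. \<gamma> * e * G Z) \<longlongrightarrow> \<gamma> * 0 * G Z) (at_right 0)" by (intro tendsto_intros)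
      then have "\<forall>\<^sub>F e in at_right 0. \<gamma> * e * G Z < t" using t by (intro order_tendstoD(2)) auto
      then show "\<forall>\<^sub>F e in at_right 0. Z \<le> nn e" using pos
      proof eventually_elim
        case (elim e)
        then show ?case using key[of e Z] by simp
      qed
    qed
    have "((\<lambda>e. t / \<gamma> - e * b) \<longlongrightarrow> t / \<gamma> - 0 * b) (at_right 0)" by (intro tendsto_intros)
    then have lim: "((\<lambda>e. t / \<gamma> - e * b) \<longlongrightarrow> t / \<gamma>) (at_right 0)" by simp
    show "((\<lambda>e. e * G (nn e)) \<longlongrightarrow> t / \<gamma>) (at_right 0)"
    proof (rule tendsto_sandwich[OF _ _ lim tendsto_const])
      show "\<forall>\<^sub>F e in at_right 0. e * G (nn e) \<le> t / \<gamma>"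
        using pos
      proof eventually_elim
        case (elim e)
        then have "\<gamma> * e * G (nn e) \<le> t" using key[of e "nn e"] by simp
        then show ?case using g by (simp add: field_simps)
      qed
      show "\<forall>\<^sub>F e in at_right 0. t / \<gamma> - e * b \<le> e * G (nn e)"
        using pos
      proof eventually_elim
        case (elim e)
        then have "t < \<gamma> * e * G (Suc (nn e))" using key[of e "Suc (nn e)"] by simp
        also have "\<dots> \<le> \<gamma> * e * (G (nn e) + b)" using step[of "nn e"] g elim by (intro mult_left_mono) auto
        finally show ?case using g by (simp add: field_simps)
      qed
    qed
  qed
qed

text \<open>For \<open>n = nn e\<close> the unconditional tail of the hitting time tends to
  \<open>p / (1 + t)\<close>, with \<open>p\<close> the escape probability. Asymptotically all of
  this tail lies in the escape event, so the conditional probability tends to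
  \<open>1 - 1 / (1 + t)\<close>.\<close>

theorem theorem3p1:
  fixes M :: "'a measure"
    and X :: "nat \<Rightarrow> 'a \<Rightarrow> real"
    and A :: "nat \<Rightarrow> real"
    and \<mu> :: "real measure"
    and f :: "real \<Rightarrow> real"
    and U :: "real \<Rightarrow> 'a \<Rightarrow> real"
    and t :: real
  defines "S \<equiv> (\<lambda>n \<omega>. \<Sum>i\<in>{1..n}. X i \<omega>)"
  assumes P: "prob_space M"
    and indep: "prob_space.indep_vars M (\<lambda>_. borel) X {1..}"
    and ident: "\<And>i. i \<ge> 1 \<Longrightarrow> distr M borel (X i) = distr M borel (X 1)"
    and recurrent: "recurrent_walk M S"
    and A_pos: "\<And>n. n \<ge> 1 \<Longrightarrow> A n > 0"
    and conv: "weak_conv_m (\<lambda>n. distr M borel (\<lambda>\<omega>. S n \<omega> / A n)) \<mu>"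
    and stable: "stable_index_one \<mu>"
    and dens_meas: "f \<in> borel_measurable lborel"
    and dens_nonneg: "\<And>x. f x \<ge> 0"
    and density: "\<mu> = density lborel f"
    and dens_cont: "continuous_on UNIV f"
    and cramer: "Limsup at_infinity (\<lambda>s. ereal (cmod (char (distr M borel (X 1)) s))) < 1"
    and U_meas: "\<And>e. e > 0 \<Longrightarrow> U e \<in> borel_measurable M"
    and U_unif: "\<And>e. e > 0 \<Longrightarrow> distr M borel (U e) = uniform_measure lborel {-e<..<e}"
    and U_indep: "\<And>e. e > 0 \<Longrightarrow>
        prob_space.indep_vars M (\<lambda>_. borel) (\<lambda>i. if i = 0 then U e else X i) UNIV"
    and t_pos: "t > 0"
  shows "((\<lambda>e. \<P>(\<omega> in M.
              (\<exists>n\<ge>1. \<bar>U e \<omega> + S n \<omega>\<bar> < e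
                  \<and> (\<forall>k\<in>{1..<n}. \<not> \<bar>U e \<omega> + S k \<omega>\<bar> < e)
                  \<and> (2 * f 0 * \<P>(\<omega>' in M. \<forall>m\<ge>1. S m \<omega>' \<noteq> 0)) * e * Ginterp A (real n) \<le> t)
            \<bar> (\<forall>m\<ge>1. S m \<omega> \<noteq> 0)))
         \<longlongrightarrow> t / (1 + t)) (at_right 0)"
proof -

  \<comment> \<open>Laws of the walk, the attraction hypotheses and the density at 0\<close>
  interpret prob_space M by (rule P)
  define \<nu> where "\<nu> = distr M borel (X 1)"
  have Xm: "X i \<in> borel_measurable M" if "i \<ge> 1" for i
    using indep that by (auto simp: indep_vars_def)
  have Sm[measurable]: "S n \<in> borel_measurable M" for n
    unfolding S_def by (intro borel_measurable_sum Xm) auto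
  define W where "W e = (\<lambda>i. if i = 0 then U e else X i)" for e
  have walk: "iid_walk M (W e) \<nu>" if "e > 0" for e
  proof unfold_locales
    show "indep_vars (\<lambda>_. borel) (W e) UNIV" unfolding W_def using U_indep[OF that] .
    show "distr M borel (W e i) = \<nu>" if "i \<ge> 1" for i
      using ident[OF that] that by (simp add: W_def \<nu>_def)
  qed
  have S_eq: "iid_walk.S (W e) = S" if "e > 0" for e
    using iid_walk.S_def[OF walk[OF that]] by (auto simp: fun_eq_iff S_def W_def)
  have W0: "W e 0 = U e" for e by (simp add: W_def)
  define L where "L k = distr M borel (S k)" for k
  have L: "real_distribution (L k)" for k
    unfolding L_def by (rule real_distribution_distr) measurable
  have charL: "char (L k) s = char \<nu> s ^ k" for k s
    using iid_walk.char_S[OF walk[of 1], of k s] S_eq[of 1] by (simp add: L_def)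
  obtain \<sigma> m \<kappa> where \<sigma>: "\<sigma> > 0" and mu: "real_distribution \<mu>"
    and char_mu: "\<And>t. char \<mu> t = exp (of_real (- (\<sigma> * \<bar>t\<bar>)) + \<i> * of_real (m * t - \<kappa> * (t * ln \<bar>t\<bar>)))"
    and cmod_mu: "\<And>t. cmod (char \<mu> t) = exp (- (\<sigma> * \<bar>t\<bar>))"
    using stable_index_one_cases[OF stable] by metis
  have nu: "real_distribution \<nu>" unfolding \<nu>_def by (rule real_distribution_distr) (rule Xm, simp)
  have char_scaled: "char (distr M borel (\<lambda>\<omega>. S n \<omega> / A n)) t = char \<nu> (t / A n) ^ n" for n t
  proof -
    have "char (distr M borel (\<lambda>\<omega>. S n \<omega> / A n)) t = (CLINT \<omega>|M. iexp (t * (S n \<omega> / A n)))"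
      unfolding char_def by (rule integral_distr) measurable
    also have "\<dots> = (CLINT \<omega>|M. iexp (t / A n * S n \<omega>))" by simp
    also have "\<dots> = char (L n) (t / A n)"
      unfolding char_def L_def by (rule integral_distr[symmetric]) measurable
    finally show ?thesis by (simp only: charL)
  qed
  interpret SA: stable_attraction \<nu> A \<mu> \<sigma>
  proof (intro stable_attraction.intro stable_attraction_axioms.intro)
    show "uniform_limit {-T..T} (\<lambda>n t. char \<nu> (t / A n) ^ n) (char \<mu>) sequentially" for T
    proof -
      have "uniform_limit {-T..T} (\<lambda>n. char (distr M borel (\<lambda>\<omega>. S n \<omega> / A n))) (char \<mu>) sequentially"
        by (rule weak_conv_imp_char_uniform_limit[OF _ mu conv]) (rule real_distribution_distr, measurable)
      then show ?thesis by (simp only: char_scaled[abs_def])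
    qed
    show "Limsup at_infinity (\<lambda>s. ereal (cmod (char \<nu> s))) < 1" using cramer by (simp add: \<nu>_def)
  qed (use nu mu cmod_mu \<sigma> A_pos in auto)
  interpret D: stable_one_density \<mu> f \<sigma> m \<kappa>
    using mu density dens_nonneg dens_cont \<sigma> char_mu
    by (intro stable_one_density.intro stable_one_density_axioms.intro) auto
  have f0: "f 0 > 0" by (rule D.f_pos)
  have f0_eq: "SA.dens0 = f 0"
    unfolding SA.dens0_def SA.char_int_def
    by (rule density_at_0_eq_char_integral[OF mu density dens_nonneg dens_cont cmod_mu \<sigma>, symmetric])

  \<comment> \<open>Divergence of \<open>G\<close> from recurrence, by Borel-Cantelli\<close>
  have Ginf: "filterlim (Gsum A) at_top sequentially"
  proof (rule SA.Gsum_at_top[OF L charL], rule notI)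
    assume sum: "summable (\<lambda>k. measure (L k) {- (1/2)<..<1/2})"
    define E where "E k = {\<omega> \<in> space M. \<bar>S k \<omega>\<bar> < 1/2}" for k
    have E: "E k \<in> sets M" for k unfolding E_def by measurable
    have "measure (L k) {- (1/2)<..<1/2} = prob (E k)" for k
      unfolding L_def E_def by (subst measure_distr) (auto intro!: arg_cong[where f = prob])
    then have "summable (\<lambda>k. prob (E k))" using sum by simp
    then have "AE \<omega> in M. \<forall>\<^sub>F k in sequentially. \<omega> \<in> space M - E k"
      by (intro borel_cantelli_AE1 E) (auto simp: emeasure_eq_measure)
    moreover have "AE \<omega> in M. \<exists>\<^sub>\<infinity>n. \<bar>S n \<omega>\<bar> < 1/2"
      using recurrent unfolding recurrent_walk_def by (rule allE[where x = "1/2"]) simp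
    ultimately have "AE \<omega> in M. False"
    proof eventually_elim
      case (elim \<omega>)
      have "\<forall>\<^sub>F k in sequentially. \<not> \<bar>S k \<omega>\<bar> < 1/2"
        using elim(1) by eventually_elim (auto simp: E_def)
      then show False using elim(2) by (simp add: cofinite_eq_sequentially frequently_def)
    qed
    then show False by simp
  qed

  \<comment> \<open>Limits of the survival probability and of the visits to 0\<close>
  define V where "V e n = prob {\<omega> \<in> space M. \<forall>j\<in>{1..n}. U e \<omega> + S j \<omega> \<notin> {-e<..<e}}" for e n
  have V_eq: "V e n = iid_walk.survive M (W e) e n" if "e > 0" for e n
    by (simp add: iid_walk.survive_def[OF walk[OF that]] V_def S_eq[OF that] W0)
  have unif: "distr M borel (W e 0) = uniform_measure lborel {-e<..<e}" if "e > 0" for e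
    unfolding W0 by (rule U_unif[OF that])
  interpret AH: attracted_hitting \<nu> A \<mu> \<sigma> L V
  proof (intro attracted_hitting.intro attracted_hitting_axioms.intro)
    show "stable_attraction \<nu> A \<mu> \<sigma>" ..
    show "V e n \<le> V e m" if "e > 0" "m \<le> n" for e m n
      using iid_walk.survive_antimono[OF walk[OF that(1)] that(2)] by (simp add: V_eq[OF that(1)])
    show "(\<Sum>k\<le>N. lo k * V e (N - k)) \<le> 1 \<and> 1 \<le> (\<Sum>k\<le>N. hi k * V e (N - k))"
      if e: "e > 0"
        and "\<And>k y. \<bar>y\<bar> < e \<Longrightarrow> lo k \<le> measure (L k) {y - e<..<y + e}"
        and "\<And>k y. \<bar>y\<bar> < e \<Longrightarrow> measure (L k) {y - e<..<y + e} \<le> hi k" for e lo hi N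
      using iid_walk.renewal_bounds[OF walk[OF e] e unif[OF e], of lo hi N] that(2,3)
      by (simp add: V_eq[OF e] S_eq[OF e] L_def)
  qed (use L charL Ginf in \<open>auto simp: V_def\<close>)

  \<comment> \<open>Visits to 0 by \<open>S\<close> do not involve the start, so the choice
    \<open>e = 1\<close> is arbitrary.\<close>
  interpret W1: iid_walk M "W 1" \<nu> by (rule walk) simp
  have S1: "W1.S = S" by (rule S_eq) simp
  define p where "p = \<P>(\<omega> in M. \<forall>m\<ge>1. S m \<omega> \<noteq> 0)"
  have p_escape: "p = W1.escape" by (simp add: p_def W1.escape_def S1)
  have z_eq: "AH.z k = prob {\<omega> \<in> space M. S k \<omega> = 0}" for k
    unfolding AH.z_def L_def by (subst measure_distr) (auto intro!: arg_cong[where f = prob])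
  have pR: "p * suminf AH.z = 1"
    using W1.escape_mult_suminf AH.z_summable unfolding p_escape S1 z_eq[abs_def] by simp
  have p0: "p > 0"
  proof -
    have "p \<ge> 0" by (simp add: p_def)
    moreover have "p \<noteq> 0" using pR by auto
    ultimately show ?thesis by simp
  qed
  define \<gamma> where "\<gamma> = 2 * f 0 * p"
  have g: "\<gamma> > 0" using f0 p0 by (simp add: \<gamma>_def)
  have Gmono: "mono (Gsum A)" by (rule Gsum_mono) (rule A_pos)
  \<comment> \<open>The increments of \<open>G\<close> are bounded because \<open>A\<close> tends to
    infinity.\<close>
  obtain b where b: "\<And>n. 1 / A (Suc n) \<le> b"
  proof -
    have "(\<lambda>n. 1 / A n) \<longlonglongrightarrow> 0"
      by (intro tendsto_divide_0[OF tendsto_const] filterlim_at_top_imp_at_infinity SA.A_at_top)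
    then have "Bseq (\<lambda>n. 1 / A n)" by (intro convergent_imp_Bseq convergentI)
    then obtain B where "\<And>n. norm (1 / A n) \<le> B" by (auto simp: Bseq_def)
    then show ?thesis by (intro that[of B]) (metis abs_le_D1 real_norm_def)
  qed
  obtain nn :: "real \<Rightarrow> nat" where
    key: "\<And>e n. e > 0 \<Longrightarrow> \<gamma> * e * Gsum A n \<le> t \<longleftrightarrow> n \<le> nn e"
    and nn: "filterlim nn at_top (at_right 0)"
    and eG: "((\<lambda>e. e * Gsum A (nn e)) \<longlongrightarrow> t / \<gamma>) (at_right 0)"
    using level_index[OF Gmono Gsum_0 Ginf _ g t_pos, of b] b by auto
  have "((\<lambda>e. V e (nn e) * (suminf AH.z + 2 * SA.dens0 * (t / \<gamma>))) \<longlongrightarrow> 1) (at_right 0)"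
    using f0 f0_eq t_pos g by (intro AH.V_limit[OF nn eG]) auto
  \<comment> \<open>The first term is \<open>1 / p\<close>, and the factor \<open>p\<close> inside
    \<gamma> makes the second one \<open>t / p\<close>: this is the reason for the normalisation by
    \<gamma>.\<close>
  moreover have "suminf AH.z + 2 * SA.dens0 * (t / \<gamma>) = (1 + t) / p"
  proof -
    have "suminf AH.z = 1 / p" using pR p0 by (simp add: field_simps)
    moreover have "2 * SA.dens0 * (t / \<gamma>) = t / p" using f0 p0 by (simp add: \<gamma>_def f0_eq)
    ultimately show ?thesis by (simp add: add_divide_distrib)
  qed
  ultimately have "((\<lambda>e. V e (nn e) * ((1 + t) / p) * (p / (1 + t))) \<longlongrightarrow> 1 * (p / (1 + t))) (at_right 0)"
    by (intro tendsto_mult tendsto_const) simp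
  moreover have "V e (nn e) * ((1 + t) / p) * (p / (1 + t)) = V e (nn e)" for e
    using p0 t_pos by simp
  ultimately have Vlim: "((\<lambda>e. V e (nn e)) \<longlongrightarrow> p / (1 + t)) (at_right 0)" by simp

  \<comment> \<open>From survival to the law conditional on escape\<close>
  define H where "H e = {\<omega> \<in> space M. (\<exists>k\<in>{1..nn e}. \<bar>U e \<omega> + S k \<omega>\<bar> < e) \<and> (\<forall>m\<ge>1. S m \<omega> \<noteq> 0)}" for e
  define q where "q n = prob {\<omega> \<in> space M. \<forall>j\<in>{1..n}. S j \<omega> \<noteq> 0}" for n
  have q_lim: "q \<longlonglongrightarrow> p"
    using W1.avoid_zero_tendsto unfolding W1.avoid_zero_eq S1 p_escape q_def .
  \<comment> \<open>On escape the window is either hit by time \<open>nn e\<close> or survived.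
    Conversely, \<open>H e\<close> and survival are disjoint, and both exclude a return to 0 up to
    \<open>nn e\<close>: such a return would put the walk back at its start, inside the window.
    Since \<open>q\<close> tends to \<open>p\<close>, the two bounds meet.\<close>
  have Hb: "p - V e (nn e) \<le> prob (H e)" "prob (H e) \<le> q (nn e) - V e (nn e)" if e: "e > 0" for e
  proof -
    note [measurable] = U_meas[OF e]
    let ?Om = "{\<omega> \<in> space M. \<forall>m\<ge>1. S m \<omega> \<noteq> 0}"
    let ?Q = "{\<omega> \<in> space M. \<forall>j\<in>{1..nn e}. S j \<omega> \<noteq> 0}"
    let ?A = "{\<omega> \<in> space M. \<forall>j\<in>{1..nn e}. U e \<omega> + S j \<omega> \<notin> {-e<..<e}}"
    have in_iff: "x \<in> {-e<..<e} \<longleftrightarrow> \<bar>x\<bar> < e" for x by auto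
    have sets[measurable]: "?Om \<in> sets M" "?Q \<in> sets M" "?A \<in> sets M" "H e \<in> sets M"
      unfolding H_def by measurable
    have sub: "?Om \<subseteq> H e \<union> ?A" and disj: "H e \<inter> ?A = {}"
      unfolding H_def in_iff by blast+
    have "p = prob ?Om" by (simp add: p_def)
    also have "\<dots> \<le> prob (H e \<union> ?A)"
      by (rule finite_measure_mono[OF sub]) simp
    also have "\<dots> \<le> prob (H e) + prob ?A" by (intro measure_Un_le sets)
    finally show "p - V e (nn e) \<le> prob (H e)" by (simp add: V_def)
    have "prob (H e) + prob ?A = prob (H e \<union> ?A)"
      by (rule finite_measure_Union[symmetric, OF _ _ disj]) (rule sets)+
    also have "\<dots> \<le> prob ?Q"
    proof (rule finite_measure_mono_AE)
      have "AE \<omega> in M. U e \<omega> \<in> {-e<..<e}"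
        using iid_walk.AE_uniform_start[OF walk[OF e] e unif[OF e]] by (simp only: W0)
      then show "AE \<omega> in M. \<omega> \<in> H e \<union> ?A \<longrightarrow> \<omega> \<in> ?Q"
      proof eventually_elim
        case (elim \<omega>)
        have "S j \<omega> \<noteq> 0" if "\<omega> \<in> ?A" "j \<in> {1..nn e}" for j
        proof
          assume "S j \<omega> = 0"
          then have "U e \<omega> + S j \<omega> \<in> {-e<..<e}" using elim by simp
          then show False using that by blast
        qed
        then show ?case by (auto simp: H_def)
      qed
    qed simp
    finally show "prob (H e) \<le> q (nn e) - V e (nn e)" by (simp add: V_def q_def)
  qed
  have pos: "\<forall>\<^sub>F e in at_right 0. (0::real) < e" by (rule eventually_at_right_less)
  have "((\<lambda>e. prob (H e)) \<longlongrightarrow> p - p / (1 + t)) (at_right 0)"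
  proof (rule tendsto_sandwich)
    show "\<forall>\<^sub>F e in at_right 0. p - V e (nn e) \<le> prob (H e)"
      using pos by eventually_elim (rule Hb)
    show "\<forall>\<^sub>F e in at_right 0. prob (H e) \<le> q (nn e) - V e (nn e)"
      using pos by eventually_elim (rule Hb)
    show "((\<lambda>e. p - V e (nn e)) \<longlongrightarrow> p - p / (1 + t)) (at_right 0)"
      by (intro tendsto_intros Vlim)
    show "((\<lambda>e. q (nn e) - V e (nn e)) \<longlongrightarrow> p - p / (1 + t)) (at_right 0)"
      by (intro tendsto_diff Vlim filterlim_compose[OF q_lim nn])
  qed
  then have "((\<lambda>e. prob (H e) / p) \<longlongrightarrow> (p - p / (1 + t)) / p) (at_right 0)"
    using p0 by (intro tendsto_divide tendsto_const) auto
  moreover have "(p - p / (1 + t)) / p = t / (1 + t)"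
  proof -
    have "(p - p / (1 + t)) / p = 1 - 1 / (1 + t)" using p0 by (simp add: diff_divide_distrib)
    also have "\<dots> = t / (1 + t)" using t_pos by (simp add: field_simps)
    finally show ?thesis .
  qed
  ultimately have lim: "((\<lambda>e. prob (H e) / p) \<longlongrightarrow> t / (1 + t)) (at_right 0)" by simp
  have ev: "\<forall>\<^sub>F e in at_right 0. \<P>(\<omega> in M.
              (\<exists>n\<ge>1. \<bar>U e \<omega> + S n \<omega>\<bar> < e
                  \<and> (\<forall>k\<in>{1..<n}. \<not> \<bar>U e \<omega> + S k \<omega>\<bar> < e)
                  \<and> (2 * f 0 * \<P>(\<omega>' in M. \<forall>m\<ge>1. S m \<omega>' \<noteq> 0)) * e * Ginterp A (real n) \<le> t)
            \<bar> (\<forall>m\<ge>1. S m \<omega> \<noteq> 0)) = prob (H e) / p"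
    using pos
  proof eventually_elim
    case (elim e)
    \<comment> \<open>Any hit by time \<open>nn e\<close> forces the first hit to occur by then, and
      \<open>key\<close> identifies this bound with the condition on \<open>G\<close>.\<close>
    have hit: "(\<exists>n\<ge>1. \<bar>U e \<omega> + S n \<omega>\<bar> < e \<and> (\<forall>k\<in>{1..<n}. \<not> \<bar>U e \<omega> + S k \<omega>\<bar> < e)
                  \<and> \<gamma> * e * Ginterp A (real n) \<le> t) \<longleftrightarrow> (\<exists>k\<in>{1..nn e}. \<bar>U e \<omega> + S k \<omega>\<bar> < e)" for \<omega>
      unfolding Ginterp_of_nat key[OF elim]
    proof
      assume "\<exists>k\<in>{1..nn e}. \<bar>U e \<omega> + S k \<omega>\<bar> < e"
      then obtain k where k: "1 \<le> k" "k \<le> nn e" "\<bar>U e \<omega> + S k \<omega>\<bar> < e" by auto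
      define n where "n = (LEAST n. 1 \<le> n \<and> \<bar>U e \<omega> + S n \<omega>\<bar> < e)"
      have "1 \<le> n \<and> \<bar>U e \<omega> + S n \<omega>\<bar> < e" unfolding n_def using k by (intro LeastI) auto
      moreover have "n \<le> k" unfolding n_def using k by (intro Least_le) auto
      moreover have "\<not> \<bar>U e \<omega> + S j \<omega>\<bar> < e" if "j \<in> {1..<n}" for j
        using that not_less_Least[of j "\<lambda>n. 1 \<le> n \<and> \<bar>U e \<omega> + S n \<omega>\<bar> < e"] by (auto simp: n_def)
      ultimately show "\<exists>n\<ge>1. \<bar>U e \<omega> + S n \<omega>\<bar> < e \<and> (\<forall>k\<in>{1..<n}. \<not> \<bar>U e \<omega> + S k \<omega>\<bar> < e) \<and> n \<le> nn e"
        using k by (intro exI[of _ n]) auto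
    qed auto
    show ?case
      unfolding p_def[symmetric] \<gamma>_def[symmetric] cond_prob_def hit H_def by simp
  qed
  show ?thesis using lim by (simp only: tendsto_cong[OF ev])
qed

end
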